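(* Consider the problem $$J[y(\cdot),u(\cdot)]=\int_a^b L(t,y(t),u(t))\,\Delta t\longrightarrow\min,\qquad y^\Delta(t)=\varphi(t,y(t),u(t)),\qquad (y(a)=y_a),\ (y(b)=y_b),\tag{P}$$ where $y(\cdot)\in C^1_{rd}[\mathbb{T}]$, $u(\cdot)\in C_{rd}[\mathbb{T}]$, $y(t)\in\mathbb{R}^n$ and $u(t)\in\mathbb{R}^m$ for all $t\in\mathbb{T}$, $m\le n$, and each of the endpoint conditions in parentheses may or may not be present. Assume that $L:\mathbb{T}\times\mathbb{R}^n\times\mathbb{R}^m\to\mathbb{R}$ and $\varphi:\mathbb{T}\times\mathbb{R}^n\times\mathbb{R}^m\to\mathbb{R}^n$ are $C^1$-functions of $(y,u)$ for each $t$, and that for each control $u(\cdot)\in C_{rd}[\mathbb{T};\mathbb{R}^m]$ there exists a corresponding $y(\cdot)\in C^1_{rd}[\mathbb{T};\mathbb{R}^n]$ solving $y^\Delta(t)=\varphi(t,y(t),u(t))$. If $(y_\ast(\cdot),u_\ast(\cdot))$ is a weak local minimizer of (P), then there exists a set of multipliers $(\psi_{0_\ast},\psi_\ast(\cdot))\neq 0$, where $\psi_{0_\ast}$ is a nonnegative constant and $\psi_\ast(\cdot):\mathbb{T}\to\mathbb{R}^n$ is delta differentiable on $\mathbb{T}^k$, such that for all $t\in\mathbb{T}^k$ $$y_\ast^\Delta(t)=H_{\psi^\sigma}(t,y_\ast(t),u_\ast(t),\psi_{0_\ast},\psi_\ast^\sigma(t)),$$ $$\psi_\ast^\Delta(t)=-H_y(t,y_\ast(t),u_\ast(t),\psi_{0_\ast},\psi_\ast^\sigma(t)),$$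 $$H_u(t,y_\ast(t),u_\ast(t),\psi_{0_\ast},\psi_\ast^\sigma(t))=0,$$ where the Hamiltonian $H$ is defined by $H(t,y,u,\psi_0,\psi^\sigma)=\psi_0L(t,y,u)+\psi^\sigma\cdot\varphi(t,y,u)$. If $y(a)$ is free in (P) (the condition $y(a)=y_a$ is not present), then $\psi_\ast(a)=0$; if $y(b)$ is free in (P) (the condition $y(b)=y_b$ is not present), then $\psi_\ast(b)=0$.
   Context: A time scale is a nonempty closed subset of $\mathbb{R}$. Throughout $\mathbb{T}=[a,b]\cap\mathbb{T}_0$ with $a<b$ and $\mathbb{T}_0$ a time scale, where $a=\min\mathbb{T}$ and $b=\max\mathbb{T}$. The forward jump operator is $\sigma(t)=\inf\{s\in\mathbb{T}:s>t\}$ (with $\sigma(b)=b$), the backward jump operator is $\rho(t)=\sup\{s\in\mathbb{T}:s<t\}$ (with $\rho(a)=a$). A point $t$ is right-dense if $\sigma(t)=t$, left-dense if $\rho(t)=t$. $\mathbb{T}^k=\mathbb{T}\setminus(\rho(b),b]$. We write $f^\sigma=f\circ\sigma$. A function $f$ on $\mathbb{T}$ is delta differentiable at $t\in\mathbb{T}^k$ with delta derivative $f^\Delta(t)$ if for all $\varepsilon>0$ there is a neighborhood $U=(t-\delta,t+\delta)\cap\mathbb{T}$ with $|f(\sigma(t))-f(s)-f^\Delta(t)(\sigma(t)-s)|\le\varepsilon|\sigma(t)-s|$ for all $s\in U$. A function is rd-continuous if it is continuous at right-dense points and its left-sided limit exists at left-dense points; $C_{rd}[\mathbb{T}]=C_{rd}[\mathbb{T};\mathbb{R}^m]$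 is the set of rd-continuous functions and $C^1_{rd}[\mathbb{T}]=C^1_{rd}[\mathbb{T};\mathbb{R}^n]$ the set of delta differentiable functions with rd-continuous delta derivative. The delta integral is $\int_c^d f(t)\Delta t=F(d)-F(c)$ where $F^\Delta=f$. A pair $(y,u)$ is admissible for (P) if $y\in C^1_{rd}[\mathbb{T};\mathbb{R}^n]$, $u\in C_{rd}[\mathbb{T};\mathbb{R}^m]$, $y^\Delta(t)=\varphi(t,y(t),u(t))$ for $t\in\mathbb{T}^k$, and the boundary conditions that are present hold. An admissible pair $(y_\ast,u_\ast)$ is a weak local minimizer of (P) if there exists $\delta>0$ such that $J[y_\ast,u_\ast]\le J[y,u]$ for all admissible pairs $(y,u)$ with $\|y-y_\ast\|_{1,\infty}+\|u-u_\ast\|_\infty<\delta$, where $\|f\|_\infty=\sup_{t\in\mathbb{T}^k}|f(t)|$ and $\|y\|_{1,\infty}=\|y\|_\infty+\|y^\Delta\|_\infty$. $H_y,H_u,H_{\psi^\sigma}$ denote partial derivatives of $H(t,y,u,\psi_0,\psi^\sigma)$ with respect to the arguments $y$, $u$, $\psi^\sigma$; $\psi$ is regarded as a row vector. $(\psi_{0_\ast},\psi_\ast(\cdot))\ne0$ means that $\psi_{0_\ast}$ and the function $\psi_\ast(\cdot)$ are not both zero.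
   Formalization: Besides being C^1 in (y,u) for each t, L, φ and their first derivatives in (y,u) are assumed rd-continuous in t along every continuous curve in (y,u); without regularity in t the claim is false. *)

theory Defs
  imports "HOL-Analysis.Analysis"
begin

section \<open>Time scales\<close>

definition time_scale :: "real set \<Rightarrow> bool" where
  "time_scale T \<longleftrightarrow> T \<noteq> {} \<and> closed T"

definition fwd_jump :: "real set \<Rightarrow> real \<Rightarrow> real" where
  "fwd_jump T t = (if {s \<in> T. t < s} = {} then t else Inf {s \<in> T. t < s})"

definition bwd_jump :: "real set \<Rightarrow> real \<Rightarrow> real" where
  "bwd_jump T t = (if {s \<in> T. s < t} = {} then t else Sup {s \<in> T. s < t})"

definition right_dense :: "real set \<Rightarrow> real \<Rightarrow> bool" where
  "right_dense T t \<longleftrightarrow> fwd_jump T t = t"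

definition left_dense :: "real set \<Rightarrow> real \<Rightarrow> bool" where
  "left_dense T t \<longleftrightarrow> bwd_jump T t = t"

text \<open>The set \<open>T\<^sup>k\<close>, for a time scale that has a maximum (which is then \<open>Sup T\<close>).\<close>

definition tk :: "real set \<Rightarrow> real set" where
  "tk T = T - {bwd_jump T (Sup T) <.. Sup T}"


section \<open>Delta derivative and delta integral\<close>

definition has_delta_derivative ::
    "real set \<Rightarrow> (real \<Rightarrow> 'a::real_normed_vector) \<Rightarrow> 'a \<Rightarrow> real \<Rightarrow> bool" where
  "has_delta_derivative T f d t \<longleftrightarrow>
     (\<forall>\<epsilon>>0. \<exists>\<delta>>0. \<forall>s \<in> {t - \<delta> <..< t + \<delta>} \<inter> T.
        norm (f (fwd_jump T t) - f s - (fwd_jump T t - s) *\<^sub>R d) \<le> \<epsilon> * \<bar>fwd_jump T t - s\<bar>)"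

definition delta_differentiable ::
    "real set \<Rightarrow> (real \<Rightarrow> 'a::real_normed_vector) \<Rightarrow> real \<Rightarrow> bool" where
  "delta_differentiable T f t \<longleftrightarrow> (\<exists>d. has_delta_derivative T f d t)"

text \<open>The delta derivative is unique at every point of \<open>tk T\<close>, the only points where it is used.\<close>

definition delta_deriv ::
    "real set \<Rightarrow> (real \<Rightarrow> 'a::real_normed_vector) \<Rightarrow> real \<Rightarrow> 'a" where
  "delta_deriv T f t = (THE d. has_delta_derivative T f d t)"

text \<open>Delta antiderivatives on \<open>T\<close> are unique up to a constant, so the value below is determined
  as soon as one exists.\<close>

definition delta_integral ::
    "real set \<Rightarrow> real \<Rightarrow> real \<Rightarrow> (real \<Rightarrow> 'a::real_normed_vector) \<Rightarrow> 'a" where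
  "delta_integral T c d f =
     (THE I. \<exists>F. (\<forall>t\<in>tk T. has_delta_derivative T F (f t) t) \<and> I = F d - F c)"


section \<open>Spaces of rd-continuous functions\<close>

text \<open>The jump operators are those of \<open>T\<close>; the domain \<open>S\<close> of \<open>f\<close> is \<open>T\<close> for functions on the time
  scale and \<open>tk T\<close> for delta derivatives.\<close>

definition rd_continuous_on ::
    "real set \<Rightarrow> real set \<Rightarrow> (real \<Rightarrow> 'a::topological_space) \<Rightarrow> bool" where
  "rd_continuous_on T S f \<longleftrightarrow>
     (\<forall>t\<in>S. (right_dense T t \<longrightarrow> continuous (at t within S) f) \<and>
            (left_dense T t \<longrightarrow> (\<exists>l. (f \<longlongrightarrow> l) (at t within (S \<inter> {..<t})))))"

definition C_rd :: "real set \<Rightarrow> (real \<Rightarrow> 'a::real_normed_vector) set" where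
  "C_rd T = {f. rd_continuous_on T T f}"

definition C1_rd :: "real set \<Rightarrow> (real \<Rightarrow> 'a::real_normed_vector) set" where
  "C1_rd T = {f. (\<forall>t\<in>tk T. delta_differentiable T f t) \<and>
                 rd_continuous_on T (tk T) (delta_deriv T f)}"

definition sup_norm :: "real set \<Rightarrow> (real \<Rightarrow> 'a::real_normed_vector) \<Rightarrow> real" where
  "sup_norm T f = (SUP t\<in>tk T. norm (f t))"

definition C1_norm :: "real set \<Rightarrow> (real \<Rightarrow> 'a::real_normed_vector) \<Rightarrow> real" where
  "C1_norm T y = sup_norm T y + sup_norm T (delta_deriv T y)"


section \<open>Regularity of the data\<close>

definition C1_fun :: "('a::real_normed_vector \<Rightarrow> 'b::real_normed_vector) \<Rightarrow> bool" where
  "C1_fun f \<longleftrightarrow>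
     (\<exists>D. (\<forall>x. (f has_derivative blinfun_apply (D x)) (at x)) \<and> continuous_on UNIV D)"

definition total_deriv ::
    "('a::real_normed_vector \<Rightarrow> 'b::real_normed_vector) \<Rightarrow> 'a \<Rightarrow> 'a \<Rightarrow>\<^sub>L 'b" where
  "total_deriv f x = Blinfun (frechet_derivative f (at x))"

text \<open>The usual meaning of rd-continuity for a function of time and a further variable
  (Bohner and Peterson): it is rd-continuous in time along every continuous \<open>x\<close>.\<close>

definition rd_continuous_field ::
    "real set \<Rightarrow> (real \<Rightarrow> 'a::real_normed_vector \<Rightarrow> 'b::real_normed_vector) \<Rightarrow> bool" where
  "rd_continuous_field T f \<longleftrightarrow>
     (\<forall>x. continuous_on T x \<longrightarrow> rd_continuous_on T T (\<lambda>t. f t (x t)))"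

text \<open>Being \<open>C\<^sup>1\<close> in \<open>(y, u)\<close> for each fixed \<open>t\<close> says nothing about the dependence on \<open>t\<close>.
  The second conjunct is the regularity in \<open>t\<close> under which the delta integrals exist and the
  first-order calculus on \<open>C1_rd \<times> C_rd\<close> is available.  It cannot be dropped: on \<open>[-1, 1]\<close>, with
  free endpoints, dynamics \<open>y' = u\<close> and the Lagrangian \<open>y\<^sup>3 / (y\<^sup>2 + t\<^sup>2) + c (y\<^sup>2 + u\<^sup>2)\<close>, read as
  \<open>y + c (y\<^sup>2 + u\<^sup>2)\<close> at \<open>t = 0\<close>, with \<open>c\<close> large, the zero pair is a minimizer, but the adjoint
  equation at \<open>t = 0\<close> forces all multipliers to vanish.\<close>

definition C1_data ::
    "real set \<Rightarrow> (real \<Rightarrow> 'a::real_normed_vector \<Rightarrow> 'b::real_normed_vector \<Rightarrow> 'c::real_normed_vector)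
      \<Rightarrow> bool" where
  "C1_data T f \<longleftrightarrow>
     (\<forall>t\<in>T. C1_fun (\<lambda>(y, u). f t y u)) \<and>
     (rd_continuous_field T (\<lambda>t (y, u). f t y u) \<and>
      rd_continuous_field T (\<lambda>t. total_deriv (\<lambda>(y, u). f t y u)))"


section \<open>The optimal control problem\<close>

definition cost ::
    "real set \<Rightarrow> real \<Rightarrow> real \<Rightarrow> (real \<Rightarrow> 'y \<Rightarrow> 'u \<Rightarrow> real) \<Rightarrow> (real \<Rightarrow> 'y) \<Rightarrow> (real \<Rightarrow> 'u) \<Rightarrow> real" where
  "cost T a b L y u = delta_integral T a b (\<lambda>t. L t (y t) (u t))"

definition solves_dynamics ::
    "real set \<Rightarrow> (real \<Rightarrow> 'y \<Rightarrow> 'u \<Rightarrow> 'y) \<Rightarrow> (real \<Rightarrow> 'y::real_normed_vector) \<Rightarrow> (real \<Rightarrow> 'u) \<Rightarrow> bool" where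
  "solves_dynamics T \<phi> y u \<longleftrightarrow> (\<forall>t\<in>tk T. delta_deriv T y t = \<phi> t (y t) (u t))"

text \<open>An endpoint condition is \<open>Some v\<close> when it is present, with prescribed value \<open>v\<close>, and
  \<open>None\<close> when the endpoint is free.\<close>

definition endpoint_condition :: "'y option \<Rightarrow> 'y \<Rightarrow> bool" where
  "endpoint_condition c z \<longleftrightarrow> (\<forall>v. c = Some v \<longrightarrow> z = v)"

definition admissible ::
    "real set \<Rightarrow> real \<Rightarrow> real \<Rightarrow>
      (real \<Rightarrow> 'y::real_normed_vector \<Rightarrow> 'u::real_normed_vector \<Rightarrow> 'y) \<Rightarrow>
      'y option \<Rightarrow> 'y option \<Rightarrow> (real \<Rightarrow> 'y) \<Rightarrow> (real \<Rightarrow> 'u) \<Rightarrow> bool" where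
  "admissible T a b \<phi> ya yb y u \<longleftrightarrow>
     y \<in> C1_rd T \<and> u \<in> C_rd T \<and> solves_dynamics T \<phi> y u \<and>
     endpoint_condition ya (y a) \<and> endpoint_condition yb (y b)"

definition weak_local_minimizer ::
    "real set \<Rightarrow> real \<Rightarrow> real \<Rightarrow>
      (real \<Rightarrow> 'y::real_normed_vector \<Rightarrow> 'u::real_normed_vector \<Rightarrow> real) \<Rightarrow> (real \<Rightarrow> 'y \<Rightarrow> 'u \<Rightarrow> 'y) \<Rightarrow>
      'y option \<Rightarrow> 'y option \<Rightarrow> (real \<Rightarrow> 'y) \<Rightarrow> (real \<Rightarrow> 'u) \<Rightarrow> bool" where
  "weak_local_minimizer T a b L \<phi> ya yb y0 u0 \<longleftrightarrow>
     admissible T a b \<phi> ya yb y0 u0 \<and>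
     (\<exists>\<delta>>0. \<forall>y u. admissible T a b \<phi> ya yb y u \<and>
         C1_norm T (\<lambda>t. y t - y0 t) + sup_norm T (\<lambda>t. u t - u0 t) < \<delta> \<longrightarrow>
         cost T a b L y0 u0 \<le> cost T a b L y u)"


section \<open>The Hamiltonian and its partial gradients\<close>

definition hamiltonian ::
    "(real \<Rightarrow> 'y::real_inner \<Rightarrow> 'u \<Rightarrow> real) \<Rightarrow> (real \<Rightarrow> 'y \<Rightarrow> 'u \<Rightarrow> 'y) \<Rightarrow>
      real \<Rightarrow> 'y \<Rightarrow> 'u \<Rightarrow> real \<Rightarrow> 'y \<Rightarrow> real" where
  "hamiltonian L \<phi> t y u p0 p = p0 * L t y u + p \<bullet> \<phi> t y u"

text \<open>Row vectors are identified with vectors, so a partial derivative of the scalar Hamiltonian is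
  a gradient.\<close>

definition grad :: "('a::real_inner \<Rightarrow> real) \<Rightarrow> 'a \<Rightarrow> 'a" where
  "grad f x = (THE g. GDERIV f x :> g)"

definition H_y ::
    "(real \<Rightarrow> 'y::real_inner \<Rightarrow> 'u::real_inner \<Rightarrow> real) \<Rightarrow> (real \<Rightarrow> 'y \<Rightarrow> 'u \<Rightarrow> 'y) \<Rightarrow>
      real \<Rightarrow> 'y \<Rightarrow> 'u \<Rightarrow> real \<Rightarrow> 'y \<Rightarrow> 'y" where
  "H_y L \<phi> t y u p0 p = grad (\<lambda>z. hamiltonian L \<phi> t z u p0 p) y"

definition H_u ::
    "(real \<Rightarrow> 'y::real_inner \<Rightarrow> 'u::real_inner \<Rightarrow> real) \<Rightarrow> (real \<Rightarrow> 'y \<Rightarrow> 'u \<Rightarrow> 'y) \<Rightarrow>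
      real \<Rightarrow> 'y \<Rightarrow> 'u \<Rightarrow> real \<Rightarrow> 'y \<Rightarrow> 'u" where
  "H_u L \<phi> t y u p0 p = grad (\<lambda>v. hamiltonian L \<phi> t y v p0 p) u"

definition H_psi ::
    "(real \<Rightarrow> 'y::real_inner \<Rightarrow> 'u::real_inner \<Rightarrow> real) \<Rightarrow> (real \<Rightarrow> 'y \<Rightarrow> 'u \<Rightarrow> 'y) \<Rightarrow>
      real \<Rightarrow> 'y \<Rightarrow> 'u \<Rightarrow> real \<Rightarrow> 'y \<Rightarrow> 'y" where
  "H_psi L \<phi> t y u p0 p = grad (\<lambda>q. hamiltonian L \<phi> t y u p0 q) p"

end

theory Submission
  imports Defs
begin

text \<open>
  The theorem is a multiplier rule for the end-point map of a control system.  Adjoin the running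
  cost to the state, so that the problem asks for an extreme value of the first coordinate of the final
  point \<open>Y(b)\<close> over all trajectories of \<open>Y\<^sup>\<Delta> = \<Phi>(t, Y, u)\<close>.  The linearised system along the minimizer
  maps a variation (of the initial value and of the control) to a variation of the final point, and the
  image is a linear subspace.  If the subspace were the whole space of constrained final data, then finitely
  many variations would give a map of a Euclidean space into itself that is continuous near \<open>0\<close> and has
  an invertible derivative at \<open>0\<close>; such a map covers a neighbourhood
  (\<open>endpoint_interior\<close>), so that some nearby trajectory would satisfy the end conditions at a smaller
  cost.  Hence there is a nonzero covector \<open>p\<close> that annihilates the image
  (\<open>boundary_endpoint_multiplier\<close>), and \<open>p\<close> consists of \<open>\<psi>\<^sub>0\<close> and \<open>\<psi>(b)\<close>.

  The adjoint equation is solved backward from \<open>p\<close>.  By the product rule on time scales, the pairing of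
  its solution \<open>\<Psi>\<close> with a solution \<open>\<eta>\<close> of the linearised equation grows by the delta integral of
  \<open>H\<^sub>u \<cdot> v\<close> (\<open>adjoint_duality\<close>).  The orthogonality of \<open>p\<close> then says that \<open>\<Psi>(a) \<cdot> \<eta>(a)\<close> and the
  integral of \<open>H\<^sub>u \<cdot> v\<close> vanish for all admitted variations; as \<open>H\<^sub>u\<close> is itself an admitted control variation
  \<open>v\<close>, it vanishes (\<open>multiplier_adjoint\<close>).

  Three analytic points support this.

  First, the delta integral of an rd-continuous \<open>f\<close> is the ordinary integral over \<open>[a, t]\<close> of \<open>f\<close> composed
  with the floor \<open>s \<mapsto> sup {r \<in> T. r \<le> s}\<close>, which freezes \<open>f\<close> on every gap of the time scale
  (\<open>has_delta_derivative_integral\<close>).  Dynamic equations become Volterra equations on a real interval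
  with a delay, the adjoint equation one with an advance, and a weighted supremum norm solves
  both (\<open>volterra_exists\<close>, \<open>volterra_exists_backward\<close>) and yields Gronwall's estimate.

  Second, the regularity in \<open>t\<close> is given only along continuous curves, whereas controls have jumps, and
  the calculus needs estimates uniform in \<open>t\<close>.  An interpolation argument (\<open>joint_limit\<close>) turns regularity
  along curves into one-sided limits in \<open>(t, x)\<close> jointly; the compactness of \<open>T\<close> then gives a uniform
  modulus of continuity of the derivative near the minimizer
  (\<open>field_uniformly_continuous_along\<close>).

  Third, trajectories for nearby initial values and controls have to exist on all of \<open>T\<close>.  The dynamics are
  modified outside a tube around the minimizer so as to become globally Lipschitz, and Gronwall's estimate
  keeps the solutions inside the tube (\<open>perturbed_trajectory_exists\<close>, \<open>perturbation_first_order\<close>).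
\<close>

section \<open>Jump operators and one-sided neighbourhoods\<close>

text \<open>
  The form in which the compactness of the time scale is used below: since \<open>P\<close> becomes weaker as the radius
  shrinks, the minimum of the radii of a finite subcover serves every point.
\<close>

lemma compact_uniform_radius:
  fixes S :: "'a::metric_space set"
  assumes "compact S"
    and local: "\<And>t. t \<in> S \<Longrightarrow> \<exists>r>0. \<forall>s\<in>S. dist s t < r \<longrightarrow> P r s"
    and anti: "\<And>r r' s. P r s \<Longrightarrow> 0 < r' \<Longrightarrow> r' \<le> r \<Longrightarrow> P r' s"
  shows "\<exists>r>(0::real). \<forall>s\<in>S. P r s"
proof -
  obtain R where R: "\<And>t. t \<in> S \<Longrightarrow> R t > 0 \<and> (\<forall>s\<in>S. dist s t < R t \<longrightarrow> P (R t) s)"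
    using local by metis
  have "S \<subseteq> (\<Union>t\<in>S. ball t (R t))" using R by force
  then obtain C where C: "C \<subseteq> S" "finite C" "S \<subseteq> (\<Union>t\<in>C. ball t (R t))"
    by (rule compactE_image[OF \<open>compact S\<close>, of S "\<lambda>t. ball t (R t)", rotated]) auto
  define r where "r = Min (insert 1 (R ` C))"
  have "r > 0" unfolding r_def using C R by (subst Min_gr_iff) auto
  moreover have "P r s" if "s \<in> S" for s
  proof -
    have "s \<in> (\<Union>t\<in>C. ball t (R t))" using C that by blast
    then obtain t where t: "t \<in> C" "dist s t < R t" by (auto simp: dist_commute)
    then have "P (R t) s" using R C that by blast
    moreover have "r \<le> R t" unfolding r_def using C t by (intro Min_le) auto
    ultimately show ?thesis using anti \<open>r > 0\<close> by blast
  qed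
  ultimately show ?thesis by blast
qed

locale time_scale_interval =
  fixes T :: "real set" and a b :: real
  assumes closed_T: "closed T" and T_sub: "T \<subseteq> {a..b}"
    and a_in: "a \<in> T" and b_in: "b \<in> T" and a_less_b: "a < b"
begin

lemma compact_T: "compact T"
  using closed_T T_sub by (meson bounded_closed_interval bounded_subset compact_eq_bounded_closed)

lemma in_T_bounds: "t \<in> T \<Longrightarrow> a \<le> t \<and> t \<le> b"
  using T_sub by auto

lemma Sup_T: "Sup T = b"
  using b_in T_sub by (intro cSup_eq_maximum) auto

lemma fwd_jump_props:
  assumes "t \<in> T"
  shows "t \<le> fwd_jump T t" "fwd_jump T t \<in> T" "\<And>s. s \<in> T \<Longrightarrow> t < s \<Longrightarrow> fwd_jump T t \<le> s"
proof -
  let ?S = "{s \<in> T. t < s}"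
  have bdd: "bdd_below ?S" by (intro bdd_belowI[of _ t]) auto
  show "t \<le> fwd_jump T t"
    unfolding fwd_jump_def by (auto intro!: cInf_greatest)
  have "Inf ?S \<in> T" if "?S \<noteq> {}"
  proof -
    have "Inf ?S \<in> closure ?S" using that bdd by (rule closure_contains_Inf)
    also have "\<dots> \<subseteq> closure T" by (rule closure_mono) auto
    finally show ?thesis using closed_T by simp
  qed
  then show "fwd_jump T t \<in> T"
    using assms unfolding fwd_jump_def by (cases "?S = {}") simp_all
  show "fwd_jump T t \<le> s" if "s \<in> T" "t < s" for s
  proof -
    have "Inf ?S \<le> s" using that bdd by (intro cInf_lower) auto
    moreover have "?S \<noteq> {}" using that by blast
    ultimately show ?thesis unfolding fwd_jump_def by (simp only: if_False)
  qed
qed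

lemma right_dense_accumulates:
  assumes "t \<in> T" "t < b" "right_dense T t" "d > 0"
  obtains s where "s \<in> T" "t < s" "s < t + d"
proof -
  have ne: "{s \<in> T. t < s} \<noteq> {}" using b_in assms by auto
  then have "Inf {s \<in> T. t < s} < t + d"
    using assms unfolding right_dense_def fwd_jump_def if_not_P[OF ne] by simp
  then show ?thesis using cInf_lessD[OF ne] that by blast
qed

lemma left_dense_accumulates:
  assumes "t \<in> T" "a < t" "left_dense T t" "d > 0"
  obtains s where "s \<in> T" "s < t" "t - d < s"
proof -
  have ne: "{s \<in> T. s < t} \<noteq> {}" using a_in assms by auto
  then have "t - d < Sup {s \<in> T. s < t}"
    using assms unfolding left_dense_def bwd_jump_def if_not_P[OF ne] by simp
  then show ?thesis using less_cSupD[OF ne] that by blast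
qed

lemma tk_iff: "t \<in> tk T \<longleftrightarrow> t \<in> T \<and> (t = b \<longrightarrow> left_dense T b)"
proof -
  have ne: "{s \<in> T. s < b} \<noteq> {}" using a_in a_less_b by auto
  have bdd: "bdd_above {s \<in> T. s < b}" by (intro bdd_aboveI[of _ b]) auto
  have *: "bwd_jump T b = Sup {s \<in> T. s < b}" unfolding bwd_jump_def if_not_P[OF ne] ..
  have 1: "bwd_jump T b \<le> b" unfolding * using ne by (intro cSup_least) auto
  have 2: "t \<le> bwd_jump T b" if "t \<in> T" "t < b" for t
    unfolding * using that bdd by (intro cSup_upper) auto
  show ?thesis
    unfolding tk_def Sup_T left_dense_def
    using 1 2[of t] in_T_bounds[of t] by (cases "t = b") auto
qed

lemma tk_sub_T: "t \<in> tk T \<Longrightarrow> t \<in> T" by (simp add: tk_iff)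

lemma a_in_tk: "a \<in> tk T" using a_in a_less_b by (simp add: tk_iff)

text \<open>
  At a scattered point the one-sided punctured neighbourhood is empty.  One-sided limits then exist
  trivially, so that statements about them need no case distinction between dense and scattered points.
\<close>

lemma left_scattered_trivial:
  assumes "t \<in> T" "\<not> left_dense T t"
  shows "at t within (T \<inter> {..<t}) = bot"
proof -
  have ne: "{s \<in> T. s < t} \<noteq> {}" using assms unfolding left_dense_def bwd_jump_def by (auto split: if_splits simp del: Collect_empty_eq)
  have bdd: "bdd_above {s \<in> T. s < t}" by (intro bdd_aboveI[of _ t]) auto
  have *: "bwd_jump T t = Sup {s \<in> T. s < t}" unfolding bwd_jump_def if_not_P[OF ne] ..
  have "bwd_jump T t \<le> t" unfolding * using ne by (intro cSup_least) auto
  then have "bwd_jump T t < t" using assms unfolding left_dense_def by simp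
  moreover have "s \<le> bwd_jump T t" if "s \<in> T" "s < t" for s
    unfolding * using that bdd by (intro cSup_upper) auto
  ultimately have "\<exists>d>0. \<forall>s\<in>T \<inter> {..<t}. s \<noteq> t \<and> dist s t < d \<longrightarrow> False"
    by (intro exI[of _ "t - bwd_jump T t"]) (force simp: dist_real_def)
  then show ?thesis by (simp add: trivial_limit_def eventually_at)
qed

lemma right_scattered_trivial:
  assumes "t \<in> T" "\<not> right_dense T t"
  shows "at t within (T \<inter> {t<..}) = bot"
proof -
  have "t < fwd_jump T t" using assms fwd_jump_props(1) unfolding right_dense_def by force
  then have "\<exists>d>0. \<forall>s\<in>T \<inter> {t<..}. s \<noteq> t \<and> dist s t < d \<longrightarrow> False"
    using fwd_jump_props(3)[OF assms(1)]
    by (intro exI[of _ "fwd_jump T t - t"]) (force simp: dist_real_def)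
  then show ?thesis by (simp add: trivial_limit_def eventually_at)
qed

lemma at_within_T_split: "at t within T = sup (at t within (T \<inter> {..<t})) (at t within (T \<inter> {t<..}))"
proof -
  have "at t within T = at t within (T \<inter> {..<t} \<union> T \<inter> {t<..})"
    unfolding at_within_def by (intro arg_cong2[where f=inf] refl arg_cong[where f=principal]) auto
  then show ?thesis by (simp add: at_within_union)
qed

text \<open>
  An rd-continuous function may have different limits from the left and from the right, so local
  properties are checked separately at the point, to its left and to its right.
\<close>

lemma uniform_radius:
  assumes pt: "\<And>t. t \<in> T \<Longrightarrow> \<exists>r>0. P r t"
    and left: "\<And>t. t \<in> T \<Longrightarrow> \<exists>r>0. eventually (P r) (at t within (T \<inter> {..<t}))"
    and right: "\<And>t. t \<in> T \<Longrightarrow> \<exists>r>0. eventually (P r) (at t within (T \<inter> {t<..}))"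
    and anti: "\<And>r r' s. P r s \<Longrightarrow> 0 < r' \<Longrightarrow> r' \<le> r \<Longrightarrow> P r' s"
  shows "\<exists>r>(0::real). \<forall>s\<in>T. P r s"
proof (rule compact_uniform_radius[OF compact_T _ anti])
  fix t assume t: "t \<in> T"
  obtain r1 where r1: "r1 > 0" "P r1 t" using pt[OF t] by blast
  obtain r2 d2 where r2: "r2 > 0" "d2 > 0" "\<forall>s\<in>T. s < t \<and> dist s t < d2 \<longrightarrow> P r2 s"
    using left[OF t] unfolding eventually_at by auto
  obtain r3 d3 where r3: "r3 > 0" "d3 > 0" "\<forall>s\<in>T. s > t \<and> dist s t < d3 \<longrightarrow> P r3 s"
    using right[OF t] unfolding eventually_at by auto
  define r where "r = Min {r1, r2, r3, d2, d3}"
  have r: "r > 0" "r \<le> r1" "r \<le> r2" "r \<le> r3" "r \<le> d2" "r \<le> d3"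
    unfolding r_def using r1 r2 r3 by auto
  have "P r s" if s: "s \<in> T" "dist s t < r" for s
  proof (cases rule: linorder_cases[of s t])
    case less
    then have "P r2 s" using s r r2 by auto
    then show ?thesis using anti r by blast
  next
    case equal
    then show ?thesis using anti r r1 by blast
  next
    case greater
    then have "P r3 s" using s r r3 by auto
    then show ?thesis using anti r by blast
  qed
  then show "\<exists>r>0. \<forall>s\<in>T. dist s t < r \<longrightarrow> P r s" using r by blast
qed

section \<open>Delta derivatives\<close>

lemma has_delta_derivative_iff:
  "has_delta_derivative T f d t \<longleftrightarrow>
    (\<forall>e>0. \<exists>r>0. \<forall>s\<in>T. \<bar>s - t\<bar> < r \<longrightarrow>
      norm (f (fwd_jump T t) - f s - (fwd_jump T t - s) *\<^sub>R d) \<le> e * \<bar>fwd_jump T t - s\<bar>)"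
proof -
  have "(\<forall>s\<in>{t - r<..<t + r} \<inter> T. Q s) \<longleftrightarrow> (\<forall>s\<in>T. \<bar>s - t\<bar> < r \<longrightarrow> Q s)" for r Q
    by (auto simp: abs_less_iff)
  then show ?thesis unfolding has_delta_derivative_def by simp
qed

lemma has_delta_derivativeD:
  assumes "has_delta_derivative T f d t" "e > 0"
  obtains r where "r > 0" "\<And>s. s \<in> T \<Longrightarrow> \<bar>s - t\<bar> < r \<Longrightarrow>
      norm (f (fwd_jump T t) - f s - (fwd_jump T t - s) *\<^sub>R d) \<le> e * \<bar>fwd_jump T t - s\<bar>"
  using assms unfolding has_delta_derivative_iff by blast

lemma has_delta_derivative_cong:
  assumes "t \<in> T" "\<And>s. s \<in> T \<Longrightarrow> f s = g s"
  shows "has_delta_derivative T f d t \<longleftrightarrow> has_delta_derivative T g d t"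
  unfolding has_delta_derivative_iff using assms fwd_jump_props(2)[OF assms(1)] by simp

text \<open>
  Two candidates \<open>d\<close> and \<open>d'\<close> are compared at a point \<open>s \<noteq> \<sigma>(t)\<close> close to \<open>t\<close>: the point \<open>t\<close> itself if it is
  right-scattered, otherwise a nearby point to the right, or to the left if \<open>t = b\<close>, which belongs to \<open>T\<^sup>k\<close> only
  when it is left-dense.
\<close>

lemma has_delta_derivative_unique:
  assumes t: "t \<in> tk T" and f: "has_delta_derivative T f d t" and f': "has_delta_derivative T f d' t"
  shows "d = d'"
proof -
  have "norm (d - d') \<le> 2 * e" if e: "e > 0" for e
  proof -
    obtain r where r: "r > 0" "\<And>s. s \<in> T \<Longrightarrow> \<bar>s - t\<bar> < r \<Longrightarrow>
      norm (f (fwd_jump T t) - f s - (fwd_jump T t - s) *\<^sub>R d) \<le> e * \<bar>fwd_jump T t - s\<bar>"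
      using has_delta_derivativeD[OF f e] by blast
    obtain r' where r': "r' > 0" "\<And>s. s \<in> T \<Longrightarrow> \<bar>s - t\<bar> < r' \<Longrightarrow>
      norm (f (fwd_jump T t) - f s - (fwd_jump T t - s) *\<^sub>R d') \<le> e * \<bar>fwd_jump T t - s\<bar>"
      using has_delta_derivativeD[OF f' e] by blast
    have "\<exists>s\<in>T. \<bar>s - t\<bar> < min r r' \<and> s \<noteq> fwd_jump T t"
    proof (cases "right_dense T t")
      case False
      then show ?thesis using r r' t tk_sub_T
        by (intro bexI[of _ t]) (auto simp: right_dense_def)
    next
      case rd: True
      then have st: "fwd_jump T t = t" by (simp add: right_dense_def)
      show ?thesis
      proof (cases "t = b")
        case True
        then have "left_dense T t" "a < t" using t a_less_b by (auto simp: tk_iff)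
        then obtain s where "s \<in> T" "s < t" "t - min r r' < s"
          using left_dense_accumulates[of t "min r r'"] tk_sub_T[OF t] r(1) r'(1) by auto
        then show ?thesis unfolding st by (intro bexI[of _ s]) auto
      next
        case False
        then have "t < b" using in_T_bounds[OF tk_sub_T[OF t]] by simp
        then obtain s where "s \<in> T" "t < s" "s < t + min r r'"
          using right_dense_accumulates[of t "min r r'"] rd tk_sub_T[OF t] r(1) r'(1) by auto
        then show ?thesis unfolding st by (intro bexI[of _ s]) auto
      qed
    qed
    then obtain s where s: "s \<in> T" "\<bar>s - t\<bar> < r" "\<bar>s - t\<bar> < r'" "s \<noteq> fwd_jump T t" by auto
    have "\<bar>fwd_jump T t - s\<bar> * norm (d - d') = norm ((f (fwd_jump T t) - f s - (fwd_jump T t - s) *\<^sub>R d')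
        - (f (fwd_jump T t) - f s - (fwd_jump T t - s) *\<^sub>R d))"
      by (simp add: scaleR_diff_right[symmetric])
    also have "\<dots> \<le> e * \<bar>fwd_jump T t - s\<bar> + e * \<bar>fwd_jump T t - s\<bar>"
      using r(2)[OF s(1,2)] r'(2)[OF s(1,3)] by (intro norm_triangle_le_diff) simp
    also have "\<dots> = \<bar>fwd_jump T t - s\<bar> * (2 * e)" by simp
    finally show ?thesis using s(4) by simp
  qed
  from this[of "norm (d - d') / 4"] show ?thesis by (cases "d = d'") auto
qed

lemma delta_deriv_eq:
  assumes "t \<in> tk T" "has_delta_derivative T f d t"
  shows "delta_deriv T f t = d"
  unfolding delta_deriv_def using assms has_delta_derivative_unique by (intro the_equality) auto

lemma delta_deriv_works:
  assumes "t \<in> tk T" "delta_differentiable T f t"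
  shows "has_delta_derivative T f (delta_deriv T f t) t"
  using assms(2) delta_deriv_eq[OF assms(1)] unfolding delta_differentiable_def by auto

text \<open>
  Subtracting the defining estimate at \<open>t\<close> from the one at \<open>s\<close> eliminates \<open>f(\<sigma>(t))\<close>.  The error that
  remains is proportional to the graininess \<open>\<mu> = \<sigma>(t) - t\<close>, hence small once the tolerance is chosen against \<open>\<mu>\<close>.
\<close>

lemma has_delta_derivative_continuous:
  assumes t: "t \<in> T" and f: "has_delta_derivative T f d t"
  shows "continuous (at t within T) f"
  unfolding continuous_within_eps_delta
proof (intro allI impI)
  fix e :: real assume e: "e > 0"
  define \<mu> where "\<mu> = fwd_jump T t - t"
  have \<mu>: "\<mu> \<ge> 0" using fwd_jump_props(1)[OF t] by (simp add: \<mu>_def)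
  \<comment> \<open>The two estimates contribute at most \<open>c (2 \<mu> + 1) = e / 2\<close> when \<open>\<bar>s - t\<bar> < 1\<close>.\<close>
  define c where "c = e / (2 * (2 * \<mu> + 1))"
  have c: "c > 0" "c * (2 * \<mu> + 1) = e / 2" using e \<mu> by (auto simp: c_def field_simps)
  obtain r where r: "r > 0" "\<And>s. s \<in> T \<Longrightarrow> \<bar>s - t\<bar> < r \<Longrightarrow>
      norm (f (fwd_jump T t) - f s - (fwd_jump T t - s) *\<^sub>R d) \<le> c * \<bar>fwd_jump T t - s\<bar>"
    using has_delta_derivativeD[OF f c(1)] by blast
  define r' where "r' = Min {r, 1, e / (2 * (norm d + 1))}"
  have r': "r' > 0" "r' \<le> r" "r' \<le> 1" "r' \<le> e / (2 * (norm d + 1))"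
    unfolding r'_def using r e by (auto simp: add_nonneg_pos)
  have "dist (f s) (f t) < e" if s: "s \<in> T" "dist s t < r'" for s
  proof -
    have s': "\<bar>s - t\<bar> < r" "\<bar>s - t\<bar> < 1" "\<bar>s - t\<bar> < e / (2 * (norm d + 1))"
      using s r' by (auto simp: dist_real_def)
    have eq: "f t - f s = (f (fwd_jump T t) - f s - (fwd_jump T t - s) *\<^sub>R d)
        - (f (fwd_jump T t) - f t - (fwd_jump T t - t) *\<^sub>R d) + (t - s) *\<^sub>R d"
      by (simp add: algebra_simps)
    have "norm (f t - f s) \<le> norm (f (fwd_jump T t) - f s - (fwd_jump T t - s) *\<^sub>R d)
        + norm (f (fwd_jump T t) - f t - (fwd_jump T t - t) *\<^sub>R d) + norm ((t - s) *\<^sub>R d)"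
      by (subst eq) (rule order_trans[OF norm_triangle_ineq add_right_mono[OF norm_triangle_ineq4]])
    also have "\<dots> \<le> c * \<bar>fwd_jump T t - s\<bar> + c * \<bar>fwd_jump T t - t\<bar> + \<bar>t - s\<bar> * norm d"
      using r(2)[OF s(1) s'(1)] r(2)[OF t] r(1) by simp
    also have "c * \<bar>fwd_jump T t - s\<bar> + c * \<bar>fwd_jump T t - t\<bar> \<le> c * (2 * \<mu> + 1)"
    proof -
      have "\<bar>fwd_jump T t - s\<bar> + \<bar>fwd_jump T t - t\<bar> \<le> 2 * \<mu> + 1"
        using s'(2) \<mu> abs_triangle_ineq[of "fwd_jump T t - t" "t - s"] unfolding \<mu>_def
        by (simp add: abs_minus_commute)
      then show ?thesis using c(1) by (simp add: distrib_left[symmetric])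
    qed
    also have "\<bar>t - s\<bar> * norm d \<le> \<bar>s - t\<bar> * (norm d + 1)"
      by (simp add: abs_minus_commute mult_left_mono)
    also have "\<bar>s - t\<bar> * (norm d + 1) < e / 2"
    proof -
      have "0 < 2 * (norm d + 1)" by (simp add: add_nonneg_pos)
      then show ?thesis using s'(3) by (simp add: pos_less_divide_eq algebra_simps)
    qed
    finally show ?thesis using c(2) by (simp add: dist_norm norm_minus_commute)
  qed
  then show "\<exists>d>0. \<forall>x'\<in>T. dist x' t < d \<longrightarrow> dist (f x') (f t) < e" using r'(1) by blast
qed

lemma has_delta_derivative_const: "has_delta_derivative T (\<lambda>t. c) 0 t"
  unfolding has_delta_derivative_def by (simp add: zero_less_one exI[of _ 1])

lemma has_delta_derivative_bounded_linear:
  assumes h: "bounded_linear h" and f: "has_delta_derivative T f d t"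
  shows "has_delta_derivative T (\<lambda>s. h (f s)) (h d) t"
proof -
  interpret bounded_linear h by fact
  obtain K where K: "K > 0" "\<And>x. norm (h x) \<le> norm x * K" using pos_bounded by blast
  show ?thesis unfolding has_delta_derivative_iff
  proof (intro allI impI)
    fix e :: real assume e: "e > 0"
    then have "e / K > 0" using K by simp
    then obtain r where r: "r > 0" "\<And>s. s \<in> T \<Longrightarrow> \<bar>s - t\<bar> < r \<Longrightarrow>
      norm (f (fwd_jump T t) - f s - (fwd_jump T t - s) *\<^sub>R d) \<le> e / K * \<bar>fwd_jump T t - s\<bar>"
      using has_delta_derivativeD[OF f] by blast
    have "norm (h (f (fwd_jump T t)) - h (f s) - (fwd_jump T t - s) *\<^sub>R h d) \<le> e * \<bar>fwd_jump T t - s\<bar>"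
      if s: "s \<in> T" "\<bar>s - t\<bar> < r" for s
    proof -
      have "norm (h (f (fwd_jump T t)) - h (f s) - (fwd_jump T t - s) *\<^sub>R h d)
          = norm (h (f (fwd_jump T t) - f s - (fwd_jump T t - s) *\<^sub>R d))"
        by (simp add: diff scale)
      also have "\<dots> \<le> (e / K * \<bar>fwd_jump T t - s\<bar>) * K"
        using K(2) mult_right_mono[OF r(2)[OF s], of K] K(1) by (meson less_imp_le order_trans)
      finally show ?thesis using K(1) by simp
    qed
    then show "\<exists>r>0. \<forall>s\<in>T. \<bar>s - t\<bar> < r \<longrightarrow>
      norm (h (f (fwd_jump T t)) - h (f s) - (fwd_jump T t - s) *\<^sub>R h d) \<le> e * \<bar>fwd_jump T t - s\<bar>"
      using r(1) by blast
  qed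
qed

lemma has_delta_derivative_diff:
  assumes f: "has_delta_derivative T f d t" and g: "has_delta_derivative T g d' t"
  shows "has_delta_derivative T (\<lambda>s. f s - g s) (d - d') t"
  unfolding has_delta_derivative_iff
proof (intro allI impI)
  fix e :: real assume e: "e > 0"
  then have e2: "e / 2 > 0" by simp
  let ?s = "fwd_jump T t"
  obtain r where r: "r > 0" "\<And>s. s \<in> T \<Longrightarrow> \<bar>s - t\<bar> < r \<Longrightarrow>
      norm (f ?s - f s - (?s - s) *\<^sub>R d) \<le> e / 2 * \<bar>?s - s\<bar>"
    using has_delta_derivativeD[OF f e2] by blast
  obtain r' where r': "r' > 0" "\<And>s. s \<in> T \<Longrightarrow> \<bar>s - t\<bar> < r' \<Longrightarrow>
      norm (g ?s - g s - (?s - s) *\<^sub>R d') \<le> e / 2 * \<bar>?s - s\<bar>"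
    using has_delta_derivativeD[OF g e2] by blast
  have "norm (f ?s - g ?s - (f s - g s) - (?s - s) *\<^sub>R (d - d')) \<le> e * \<bar>?s - s\<bar>"
    if s: "s \<in> T" "\<bar>s - t\<bar> < min r r'" for s
  proof -
    have "norm (f ?s - g ?s - (f s - g s) - (?s - s) *\<^sub>R (d - d'))
      = norm ((f ?s - f s - (?s - s) *\<^sub>R d) - (g ?s - g s - (?s - s) *\<^sub>R d'))"
      by (simp add: algebra_simps)
    also have "\<dots> \<le> e / 2 * \<bar>?s - s\<bar> + e / 2 * \<bar>?s - s\<bar>"
      using r(2)[of s] r'(2)[of s] s by (intro norm_triangle_le_diff) simp
    finally show ?thesis by simp
  qed
  then show "\<exists>r>0. \<forall>s\<in>T. \<bar>s - t\<bar> < r \<longrightarrow>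
      norm (f ?s - g ?s - (f s - g s) - (?s - s) *\<^sub>R (d - d')) \<le> e * \<bar>?s - s\<bar>"
    using r(1) r'(1) by (intro exI[of _ "min r r'"]) auto
qed

lemma has_delta_derivative_Pair:
  assumes f: "has_delta_derivative T f d t" and g: "has_delta_derivative T g e t"
  shows "has_delta_derivative T (\<lambda>s. (f s, g s)) (d, e) t"
proof -
  have "bounded_linear (\<lambda>x::'a. (x, 0 :: 'b))" "bounded_linear (\<lambda>x::'b. (0 :: 'a, - x))"
    by (intro bounded_linear_Pair bounded_linear_minus bounded_linear_ident bounded_linear_zero)+
  from has_delta_derivative_diff[OF has_delta_derivative_bounded_linear[OF this(1) f]
      has_delta_derivative_bounded_linear[OF this(2) g]]
  show ?thesis by simp
qed

text \<open>
  One factor is evaluated at \<open>t\<close> and the other at \<open>\<sigma>(t)\<close>.  This asymmetry is the reason why the adjoint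
  variable enters the Hamiltonian through \<open>\<psi>\<^sup>\<sigma>\<close>.
\<close>

lemma has_delta_derivative_inner:
  fixes f g :: "real \<Rightarrow> 'e::real_inner"
  assumes t: "t \<in> T" and f: "has_delta_derivative T f d t" and g: "has_delta_derivative T g d' t"
  shows "has_delta_derivative T (\<lambda>s. f s \<bullet> g s) (d \<bullet> g t + f (fwd_jump T t) \<bullet> d') t"
  unfolding has_delta_derivative_iff
proof (intro allI impI)
  fix e :: real assume e: "e > 0"
  let ?s = "fwd_jump T t"
  define M where "M = norm (g t) + 1 + norm d + norm (f ?s)"
  have M: "M > 0" by (simp add: M_def add_pos_nonneg add_nonneg_pos)
  define c where "c = min 1 (e / M)"
  have c: "c > 0" "c \<le> 1" "c * M \<le> e" using e M by (auto simp: c_def min_def field_simps)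
  obtain r where r: "r > 0" "\<And>s. s \<in> T \<Longrightarrow> \<bar>s - t\<bar> < r \<Longrightarrow>
      norm (f ?s - f s - (?s - s) *\<^sub>R d) \<le> c * \<bar>?s - s\<bar>"
    using has_delta_derivativeD[OF f c(1)] by blast
  obtain r' where r': "r' > 0" "\<And>s. s \<in> T \<Longrightarrow> \<bar>s - t\<bar> < r' \<Longrightarrow>
      norm (g ?s - g s - (?s - s) *\<^sub>R d') \<le> c * \<bar>?s - s\<bar>"
    using has_delta_derivativeD[OF g c(1)] by blast
  obtain q where q: "q > 0" "\<And>s. s \<in> T \<Longrightarrow> \<bar>s - t\<bar> < q \<Longrightarrow> norm (g s - g t) < c"
    using has_delta_derivative_continuous[OF t g] c(1)
    unfolding continuous_within_eps_delta dist_real_def dist_norm by blast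
  have "norm (f ?s \<bullet> g ?s - f s \<bullet> g s - (?s - s) *\<^sub>R (d \<bullet> g t + f ?s \<bullet> d')) \<le> e * \<bar>?s - s\<bar>"
    if s: "s \<in> T" "\<bar>s - t\<bar> < Min {r, r', q}" for s
  proof -
    have gs: "norm (g s - g t) \<le> c" using q(2)[of s] s by simp
    then have gs1: "norm (g s) \<le> norm (g t) + 1" using c(2) norm_triangle_sub[of "g s" "g t"] by linarith
    have eq: "f ?s \<bullet> g ?s - f s \<bullet> g s - (?s - s) *\<^sub>R (d \<bullet> g t + f ?s \<bullet> d')
      = (f ?s - f s - (?s - s) *\<^sub>R d) \<bullet> g s + (?s - s) * (d \<bullet> (g s - g t))
        + f ?s \<bullet> (g ?s - g s - (?s - s) *\<^sub>R d')"
      by (simp add: inner_simps algebra_simps)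
    have "\<bar>(f ?s - f s - (?s - s) *\<^sub>R d) \<bullet> g s\<bar> \<le> (c * \<bar>?s - s\<bar>) * (norm (g t) + 1)"
      using r(2)[of s] s gs1 c(1) by (intro order_trans[OF Cauchy_Schwarz_ineq2] mult_mono) auto
    moreover have "\<bar>(?s - s) * (d \<bullet> (g s - g t))\<bar> \<le> \<bar>?s - s\<bar> * (norm d * c)"
      unfolding abs_mult using gs
      by (intro mult_left_mono order_trans[OF Cauchy_Schwarz_ineq2]) auto
    moreover have "\<bar>f ?s \<bullet> (g ?s - g s - (?s - s) *\<^sub>R d')\<bar> \<le> norm (f ?s) * (c * \<bar>?s - s\<bar>)"
      using r'(2)[of s] s by (intro order_trans[OF Cauchy_Schwarz_ineq2] mult_left_mono) auto
    ultimately have "norm (f ?s \<bullet> g ?s - f s \<bullet> g s - (?s - s) *\<^sub>R (d \<bullet> g t + f ?s \<bullet> d'))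
      \<le> (c * \<bar>?s - s\<bar>) * (norm (g t) + 1) + \<bar>?s - s\<bar> * (norm d * c) + norm (f ?s) * (c * \<bar>?s - s\<bar>)"
      unfolding eq real_norm_def by linarith
    also have "\<dots> = (c * M) * \<bar>?s - s\<bar>" unfolding M_def by (simp add: algebra_simps)
    also have "\<dots> \<le> e * \<bar>?s - s\<bar>" using c(3) by (intro mult_right_mono) auto
    finally show ?thesis .
  qed
  then show "\<exists>r>0. \<forall>s\<in>T. \<bar>s - t\<bar> < r \<longrightarrow>
      norm (f ?s \<bullet> g ?s - f s \<bullet> g s - (?s - s) *\<^sub>R (d \<bullet> g t + f ?s \<bullet> d')) \<le> e * \<bar>?s - s\<bar>"
    using r(1) r'(1) q(1) by (intro exI[of _ "Min {r, r', q}"]) auto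
qed

text \<open>
  A mean value inequality by induction along the time scale.  Let \<open>c\<close> be the supremum of the points up to
  which \<open>\<parallel>F(s) - F(a)\<parallel> \<le> e (s - a)\<close>.  The inequality holds at \<open>c\<close> by continuity, and the derivative at \<open>c\<close>
  carries it beyond \<open>c\<close>, either across the jump to \<open>\<sigma>(c)\<close> or to points shortly after \<open>c\<close>; hence \<open>c = b\<close>.
\<close>

lemma delta_derivative_zero_constant:
  assumes F: "\<And>t. t \<in> tk T \<Longrightarrow> has_delta_derivative T F 0 t" and t0: "t0 \<in> T"
  shows "F t0 = F a"
proof -
  have "norm (F t0 - F a) \<le> e * (t0 - a)" if e: "e > 0" for e
  proof -
    define good where "good s \<longleftrightarrow> norm (F s - F a) \<le> e * (s - a)" for s
    define S where "S = {t \<in> T. \<forall>s\<in>T. s \<le> t \<longrightarrow> good s}"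
    have "good s" if "s \<in> T" "s \<le> a" for s
      using in_T_bounds[OF that(1)] that(2) by (simp add: good_def)
    then have aS: "a \<in> S" using a_in unfolding S_def by auto
    have bdd: "bdd_above S" by (intro bdd_aboveI[of _ b]) (auto simp: S_def dest: in_T_bounds)
    define c where "c = Sup S"
    have "c \<in> closure S" unfolding c_def using aS bdd by (intro closure_contains_Sup) auto
    moreover have "closure S \<subseteq> closure T" by (intro closure_mono) (auto simp: S_def)
    ultimately have cT: "c \<in> T" using closed_T by auto
    have below: "s \<in> S" if "s \<in> T" "s < c" for s
    proof -
      obtain t where "t \<in> S" "s < t" using less_cSupD[of S s] aS \<open>s < c\<close> unfolding c_def by auto
      then show ?thesis using that unfolding S_def by auto
    qed
    have good_c: "good c"
    proof (rule ccontr)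
      assume ng: "\<not> good c"
      then have cS: "c \<notin> S" using cT unfolding S_def by auto
      then have ac: "a < c" using aS in_T_bounds[OF cT] by (cases "a = c") auto
      have acc: "\<exists>s\<in>S. c - d < s \<and> s < c" if "d > 0" for d
      proof -
        have "c - d < Sup S" using that by (simp add: c_def)
        then obtain s where s: "s \<in> S" "c - d < s" using less_cSupD[of S "c - d"] aS by auto
        moreover have "s \<le> c" unfolding c_def using s bdd by (intro cSup_upper) auto
        ultimately show ?thesis using cS by (cases "s = c") auto
      qed
      have "left_dense T c"
      proof (rule ccontr)
        assume "\<not> left_dense T c"
        then have "eventually (\<lambda>_. False) (at c within (T \<inter> {..<c}))"
          using left_scattered_trivial[OF cT] by simp
        then obtain d where "d > 0" "\<forall>s\<in>T \<inter> {..<c}. \<not> (s \<noteq> c \<and> dist s c < d)"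
          unfolding eventually_at by auto
        moreover from acc[OF this(1)] obtain s where "s \<in> S" "c - d < s" "s < c" by blast
        ultimately show False unfolding S_def by (fastforce simp: dist_real_def)
      qed
      then have "c \<in> tk T" using cT by (auto simp: tk_iff)
      then have cont: "continuous (at c within T) F"
        using F has_delta_derivative_continuous[OF cT] by blast
      define g where "g = norm (F c - F a) - e * (c - a)"
      have "g > 0" using ng by (simp add: g_def good_def)
      then obtain d where d: "d > 0" "\<And>s. s \<in> T \<Longrightarrow> dist s c < d \<Longrightarrow> dist (F s) (F c) < g"
        using cont unfolding continuous_within_eps_delta by blast
      obtain s where s: "s \<in> S" "c - d < s" "s < c" using acc[OF d(1)] by blast
      then have "dist (F s) (F c) < g" using d(2)[of s] unfolding S_def by (auto simp: dist_real_def)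
      moreover have "norm (F c - F a) \<le> norm (F s - F c) + norm (F s - F a)"
        using norm_triangle_ineq4[of "F s - F a" "F s - F c"] by simp
      moreover have "norm (F s - F a) \<le> e * (s - a)" using s(1) unfolding S_def good_def by auto
      moreover have "e * (s - a) \<le> e * (c - a)" using s e by simp
      ultimately show False unfolding g_def dist_norm by linarith
    qed
    have cS: "c \<in> S"
      unfolding S_def using below good_c cT by (auto simp: S_def le_less)
    have "c = b"
    proof (rule ccontr)
      assume "c \<noteq> b"
      then have cb: "c < b" using in_T_bounds[OF cT] by simp
      then have "c \<in> tk T" using cT by (auto simp: tk_iff)
      then have Fc: "has_delta_derivative T F 0 c" using F by blast
      obtain r where r: "r > 0" "\<And>s. s \<in> T \<Longrightarrow> \<bar>s - c\<bar> < r \<Longrightarrow>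
        norm (F (fwd_jump T c) - F s) \<le> e * \<bar>fwd_jump T c - s\<bar>"
        using has_delta_derivativeD[OF Fc e] by auto
      have extend: "good s" if "norm (F s - F c) \<le> e * (s - c)" for s
        using that good_c norm_triangle_ineq[of "F s - F c" "F c - F a"]
        unfolding good_def by (simp add: algebra_simps)
      have "\<exists>t\<in>S. c < t"
      proof (cases "right_dense T c")
        case True
        then have sc: "fwd_jump T c = c" by (simp add: right_dense_def)
        obtain s where s: "s \<in> T" "c < s" "s < c + r"
          using right_dense_accumulates[OF cT cb True r(1)] by blast
        have "good u" if "u \<in> T" "u \<le> s" for u
        proof (cases "u \<le> c")
          case True
          then show ?thesis using cS that unfolding S_def by auto
        next
          case False
          then show ?thesis using r(2)[OF that(1)] s that sc
            by (intro extend) (auto simp: norm_minus_commute)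
        qed
        then show ?thesis using s unfolding S_def by auto
      next
        case False
        then have sc: "c < fwd_jump T c" using fwd_jump_props(1)[OF cT] by (simp add: right_dense_def)
        have "good u" if "u \<in> T" "u \<le> fwd_jump T c" for u
        proof (cases "u \<le> c")
          case True
          then show ?thesis using cS that unfolding S_def by auto
        next
          case False
          then have "u = fwd_jump T c" using fwd_jump_props(3)[OF cT that(1)] that(2) by simp
          then show ?thesis using r(2)[OF cT] r(1) sc by (intro extend) auto
        qed
        then show ?thesis using sc fwd_jump_props(2)[OF cT] unfolding S_def by auto
      qed
      then show False using cSup_upper[OF _ bdd] unfolding c_def by force
    qed
    then show ?thesis using cS t0 in_T_bounds[OF t0] unfolding S_def good_def by auto
  qed
  note bound = this
  have "norm (F t0 - F a) \<le> 0"
  proof (rule field_le_epsilon)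
    fix e :: real assume "e > 0"
    have "norm (F t0 - F a) \<le> e / (t0 - a + 1) * (t0 - a)"
      using \<open>e > 0\<close> in_T_bounds[OF t0] by (intro bound) auto
    also have "\<dots> \<le> e" using \<open>e > 0\<close> in_T_bounds[OF t0] by (simp add: field_simps)
    finally show "norm (F t0 - F a) \<le> 0 + e" by simp
  qed
  then show ?thesis by simp
qed

lemma delta_antiderivative_unique:
  assumes F: "\<And>t. t \<in> tk T \<Longrightarrow> has_delta_derivative T F (f t) t"
    and G: "\<And>t. t \<in> tk T \<Longrightarrow> has_delta_derivative T G (f t) t" and t: "t \<in> T"
  shows "F t - F a = G t - G a"
proof -
  have "(\<lambda>s. F s - G s) t = (\<lambda>s. F s - G s) a"
    using t by (rule delta_derivative_zero_constant[rotated])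
      (use has_delta_derivative_diff[OF F G] in auto)
  then show ?thesis by (simp add: algebra_simps)
qed

end

section \<open>Rd-continuous functions\<close>

text \<open>
  The function \<open>f \<circ> ts_floor T\<close> extends \<open>f\<close> from the time scale to the real interval and is constant on every
  gap \<open>[t, \<sigma>(t))\<close>, where its integral is \<open>(\<sigma>(t) - t) f(t)\<close>, the contribution of a right-scattered point to the
  delta integral.
\<close>

definition ts_floor :: "real set \<Rightarrow> real \<Rightarrow> real" where
  "ts_floor T s = Sup (T \<inter> {..s})"

context time_scale_interval
begin

abbreviation rd :: "(real \<Rightarrow> 'x::topological_space) \<Rightarrow> bool" where
  "rd f \<equiv> rd_continuous_on T T f"

abbreviation flr :: "real \<Rightarrow> real" where
  "flr \<equiv> ts_floor T"

lemma C_rd_iff: "f \<in> C_rd T \<longleftrightarrow> rd f"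
  by (simp add: C_rd_def)

lemma rd_iff:
  "rd f \<longleftrightarrow> (\<forall>t\<in>T. (right_dense T t \<longrightarrow> continuous (at t within T) f) \<and>
    (\<exists>l. (f \<longlongrightarrow> l) (at t within (T \<inter> {..<t}))))"
  unfolding rd_continuous_on_def using left_scattered_trivial by (metis tendsto_bot)

lemma rd_left:
  assumes "rd f" "t \<in> T"
  obtains l where "(f \<longlongrightarrow> l) (at t within (T \<inter> {..<t}))"
  using assms unfolding rd_iff by blast

lemma rd_continuous_right_dense:
  assumes "rd f" "t \<in> T" "right_dense T t"
  shows "(f \<longlongrightarrow> f t) (at t within T)"
  using assms unfolding rd_iff continuous_within by blast

lemma rd_right:
  assumes "rd f" "t \<in> T"
  shows "(f \<longlongrightarrow> f t) (at t within (T \<inter> {t<..}))"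
proof (cases "right_dense T t")
  case True
  show ?thesis
    by (rule tendsto_within_subset[OF rd_continuous_right_dense[OF assms True]]) simp
next
  case False
  then show ?thesis using right_scattered_trivial[OF assms(2)] by simp
qed

lemma continuous_on_imp_rd: "continuous_on T f \<Longrightarrow> rd f"
  unfolding rd_iff continuous_on_eq_continuous_within continuous_within
  by (meson Int_lower1 tendsto_within_subset)

lemma rd_Pair:
  assumes "rd f" "rd g"
  shows "rd (\<lambda>t. (f t, g t))"
  unfolding rd_iff continuous_within
proof (intro ballI conjI impI)
  fix t assume t: "t \<in> T"
  obtain l l' where "(f \<longlongrightarrow> l) (at t within (T \<inter> {..<t}))" "(g \<longlongrightarrow> l') (at t within (T \<inter> {..<t}))"
    using rd_left assms t by metis
  then show "\<exists>l. ((\<lambda>t. (f t, g t)) \<longlongrightarrow> l) (at t within (T \<inter> {..<t}))" using tendsto_Pair by blast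
  show "((\<lambda>t. (f t, g t)) \<longlongrightarrow> (f t, g t)) (at t within T)" if "right_dense T t"
    using assms t that by (intro tendsto_Pair rd_continuous_right_dense)
qed

lemma rd_compose:
  assumes g: "continuous_on UNIV g" and f: "rd f"
  shows "rd (\<lambda>t. g (f t))"
proof -
  have g': "((\<lambda>t. g (f t)) \<longlongrightarrow> g l) F" if "(f \<longlongrightarrow> l) F" for l F
    using that by (intro continuous_on_tendsto_compose[OF g]) auto
  show ?thesis unfolding rd_iff continuous_within
  proof (intro ballI conjI impI)
    fix t assume t: "t \<in> T"
    show "\<exists>l. ((\<lambda>t. g (f t)) \<longlongrightarrow> l) (at t within (T \<inter> {..<t}))" using rd_left[OF f t] g' by metis
    show "((\<lambda>t. g (f t)) \<longlongrightarrow> g (f t)) (at t within T)" if "right_dense T t"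
      by (rule g'[OF rd_continuous_right_dense[OF f t that]])
  qed
qed

lemma rd_compose2:
  assumes "continuous_on UNIV (\<lambda>p. g (fst p) (snd p))" "rd f" "rd h"
  shows "rd (\<lambda>t. g (f t) (h t))"
  using rd_compose[OF assms(1) rd_Pair[OF assms(2,3)]] by simp

lemma rd_const: "rd (\<lambda>t. c)"
  by (simp add: continuous_on_imp_rd)

lemma rd_add: "rd f \<Longrightarrow> rd g \<Longrightarrow> rd (\<lambda>t. f t + g t :: 'x::real_normed_vector)"
  by (rule rd_compose2) (intro continuous_intros)

lemma rd_scaleR: "rd f \<Longrightarrow> rd (\<lambda>t. c *\<^sub>R f t :: 'x::real_normed_vector)"
  by (rule rd_compose) (intro continuous_intros)

lemma rd_continuous_on_subset:
  assumes f: "rd f" and S: "S \<subseteq> T" and eq: "\<And>t. t \<in> S \<Longrightarrow> g t = f t"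
  shows "rd_continuous_on T S g"
  unfolding rd_continuous_on_def continuous_within
proof (intro ballI conjI impI)
  fix t assume t: "t \<in> S"
  have ev: "\<forall>\<^sub>F s in at t within R. f s = g s" if "R \<subseteq> S" for R
    using that eq unfolding eventually_at by (intro exI[of _ 1]) auto
  show "(g \<longlongrightarrow> g t) (at t within S)" if "right_dense T t"
  proof -
    have "(f \<longlongrightarrow> f t) (at t within S)"
      using rd_continuous_right_dense[OF f _ that] S t tendsto_within_subset by blast
    then show ?thesis using eq[OF t] tendsto_cong[OF ev[OF subset_refl]] by simp
  qed
  obtain l where "(f \<longlongrightarrow> l) (at t within (T \<inter> {..<t}))" using rd_left[OF f] S t by blast
  then have "(f \<longlongrightarrow> l) (at t within (S \<inter> {..<t}))"
    by (rule tendsto_within_subset) (use S in auto)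
  then show "\<exists>l. (g \<longlongrightarrow> l) (at t within (S \<inter> {..<t}))"
    using tendsto_cong[OF ev[of "S \<inter> {..<t}"]] by auto
qed

text \<open>
  The forward jump is itself rd-continuous, although it is discontinuous at left-dense right-scattered
  points: to the left of \<open>t\<close> it is squeezed by \<open>s \<le> \<sigma>(s) \<le> t\<close>, and to the right of a right-dense \<open>t\<close> it
  cannot jump over the points of \<open>T\<close> that accumulate at \<open>t\<close>.
\<close>

lemma rd_fwd_jump:
  assumes f: "continuous_on T f"
  shows "rd (\<lambda>t. f (fwd_jump T t))"
proof -
  have "((\<lambda>s. f (fwd_jump T s)) \<longlongrightarrow> f t) F"
    if "(fwd_jump T \<longlongrightarrow> t) F" "t \<in> T" "eventually (\<lambda>s. s \<in> T) F" for t F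
    using that fwd_jump_props(2)
    by (intro continuous_on_tendsto_compose[OF f]) (auto elim: eventually_mono)
  note f_limit = this
  have in_T: "\<forall>\<^sub>F s in at t within S. s \<in> T" if "S \<subseteq> T" for t S
    using that by (auto simp: eventually_at intro: exI[of _ 1])
  show ?thesis unfolding rd_iff continuous_within
  proof (intro ballI conjI impI)
    fix t assume t: "t \<in> T"
    have left: "(fwd_jump T \<longlongrightarrow> t) (at t within (T \<inter> {..<t}))"
    proof (rule tendsto_sandwich[of "\<lambda>s. s" _ _ "\<lambda>s. t"])
      show "\<forall>\<^sub>F s in at t within T \<inter> {..<t}. s \<le> fwd_jump T s"
        using fwd_jump_props(1) by (auto simp: eventually_at intro: exI[of _ 1])
      show "\<forall>\<^sub>F s in at t within T \<inter> {..<t}. fwd_jump T s \<le> t"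
        using fwd_jump_props(3) t by (auto simp: eventually_at intro: exI[of _ 1])
    qed auto
    then show "\<exists>l. ((\<lambda>t. f (fwd_jump T t)) \<longlongrightarrow> l) (at t within (T \<inter> {..<t}))"
      using f_limit[OF left t in_T] by blast
    assume dense: "right_dense T t"
    have "(fwd_jump T \<longlongrightarrow> t) (at t within (T \<inter> {t<..}))"
    proof (rule tendstoI)
      fix e :: real assume e: "e > 0"
      show "\<forall>\<^sub>F s in at t within T \<inter> {t<..}. dist (fwd_jump T s) t < e"
      proof (cases "t = b")
        case True
        then have "T \<inter> {t<..} = {}" using in_T_bounds by force
        then show ?thesis by simp
      next
        case False
        then obtain u where u: "u \<in> T" "t < u" "u < t + e"
          using right_dense_accumulates[OF t _ dense e] in_T_bounds[OF t] by force
        have "dist (fwd_jump T s) t < e" if "s \<in> T" "t < s" "s < u" for s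
          using fwd_jump_props(1)[OF that(1)] fwd_jump_props(3)[OF that(1) u(1) that(3)] that u
          by (simp add: dist_real_def)
        then show ?thesis using u unfolding eventually_at
          by (intro exI[of _ "u - t"]) (auto simp: dist_real_def)
      qed
    qed
    with left have "(fwd_jump T \<longlongrightarrow> t) (at t within T)"
      unfolding at_within_T_split[of t] by (rule filterlim_sup)
    from f_limit[OF this t in_T]
    show "((\<lambda>t. f (fwd_jump T t)) \<longlongrightarrow> f (fwd_jump T t)) (at t within T)"
      using dense by (simp add: right_dense_def)
  qed
qed

lemma rd_bounded:
  fixes f :: "real \<Rightarrow> 'x::real_normed_vector"
  assumes f: "rd f"
  obtains M where "M > 0" "\<And>t. t \<in> T \<Longrightarrow> norm (f t) \<le> M"
proof -
  have lim: "\<exists>r>0. \<forall>\<^sub>F s in F. norm (f s) \<le> 1 / r" if "(f \<longlongrightarrow> l) F" for l F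
  proof (intro exI conjI)
    show "\<forall>\<^sub>F s in F. norm (f s) \<le> 1 / (1 / (norm l + 1))"
      using tendstoD[OF that zero_less_one]
    proof (rule eventually_mono)
      fix s assume "dist (f s) l < 1"
      then show "norm (f s) \<le> 1 / (1 / (norm l + 1))"
        using norm_triangle_sub[of "f s" l] by (simp add: dist_norm)
    qed
  qed (simp add: add_nonneg_pos)
  \<comment> \<open>A local bound, written as \<open>1 / r\<close> so that it weakens as \<open>r\<close> decreases.\<close>
  have "\<exists>r>(0::real). \<forall>s\<in>T. norm (f s) \<le> 1 / r"
  proof (rule uniform_radius)
    fix t assume t: "t \<in> T"
    show "\<exists>r>(0::real). norm (f t) \<le> 1 / r"
      by (rule exI[of _ "1 / (norm (f t) + 1)"]) (simp add: add_nonneg_pos)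
    show "\<exists>r>(0::real). \<forall>\<^sub>F s in at t within T \<inter> {..<t}. norm (f s) \<le> 1 / r"
      using rd_left[OF f t] lim by metis
    show "\<exists>r>(0::real). \<forall>\<^sub>F s in at t within T \<inter> {t<..}. norm (f s) \<le> 1 / r"
      using rd_right[OF f t] lim by metis
  next
    fix r r' :: real and s
    assume *: "norm (f s) \<le> 1 / r" "0 < r'" "r' \<le> r"
    then have "1 / r \<le> 1 / r'" by (intro divide_left_mono) auto
    with *(1) show "norm (f s) \<le> 1 / r'" by linarith
  qed
  then obtain r where "r > 0" "\<forall>s\<in>T. norm (f s) \<le> 1 / r" by blast
  then show ?thesis using that[of "1 / r"] by simp
qed

section \<open>The delta integral as an integral over the real line\<close>

lemma flr_props:
  assumes "a \<le> s"
  shows "flr s \<in> T" "flr s \<le> s" "\<And>t. t \<in> T \<Longrightarrow> t \<le> s \<Longrightarrow> t \<le> flr s"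
proof -
  let ?S = "T \<inter> {..s}"
  have ne: "?S \<noteq> {}" using a_in assms by auto
  have bdd: "bdd_above ?S" by (intro bdd_aboveI[of _ s]) auto
  have "closed ?S" using closed_T by (intro closed_Int) auto
  then have "Sup ?S \<in> ?S" by (rule closed_contains_Sup[OF ne bdd])
  then show "flr s \<in> T" "flr s \<le> s" unfolding ts_floor_def by auto
  show "t \<le> flr s" if "t \<in> T" "t \<le> s" for t
    unfolding ts_floor_def using that bdd by (intro cSup_upper) auto
qed

lemma flr_T: "t \<in> T \<Longrightarrow> flr t = t"
  using flr_props[of t] in_T_bounds[of t] by (auto intro: antisym)

text \<open>
  A delay by the floor followed by a jump is an advance.  This makes the adjoint equation a Volterra
  equation in reversed time.
\<close>

lemma le_fwd_jump_flr:
  assumes s: "a \<le> s" "s \<le> b"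
  shows "s \<le> fwd_jump T (flr s)"
proof (rule ccontr)
  let ?t = "flr s" and ?u = "fwd_jump T (flr s)"
  assume "\<not> s \<le> ?u"
  then have us: "?u < s" by simp
  note t = flr_props[OF s(1)]
  have "?u \<le> ?t" using t(3)[OF fwd_jump_props(2)[OF t(1)]] us by simp
  then have tu: "?u = ?t" using fwd_jump_props(1)[OF t(1)] by simp
  then have "right_dense T ?t" "?t < s" using us by (simp_all add: right_dense_def)
  then obtain v where "v \<in> T" "?t < v" "v < s"
    using right_dense_accumulates[OF t(1), of "s - ?t"] s by force
  then show False using t(3)[of v] by simp
qed

lemma flr_right:
  assumes s: "a \<le> s" "s < b" and gap: "\<not> (s \<in> T \<and> right_dense T s)"
  shows "\<exists>d>0. \<forall>r. s < r \<and> r < s + d \<longrightarrow> flr r = flr s"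
proof -
  let ?t = "flr s" and ?u = "fwd_jump T (flr s)"
  have t: "?t \<in> T" "?t \<le> s" using flr_props s by auto
  have "s \<noteq> ?u"
  proof
    assume su: "s = ?u"
    then have "s \<in> T" using fwd_jump_props(2)[OF t(1)] by simp
    then show False using gap flr_T[of s] su by (simp add: right_dense_def)
  qed
  then have u: "s < ?u" using le_fwd_jump_flr[of s] s by simp
  have "flr r = ?t" if "s < r" "r < ?u" for r
  proof (rule antisym)
    show "?t \<le> flr r" using flr_props(3)[of r ?t] t that s by simp
    show "flr r \<le> ?t"
      using fwd_jump_props(3)[OF t(1), of "flr r"] flr_props(1,2)[of r] that s by force
  qed
  then show ?thesis using u by (intro exI[of _ "?u - s"]) auto
qed

lemma rd_flr_right_continuous:
  fixes f :: "real \<Rightarrow> 'x::metric_space"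
  assumes f: "rd f" and s: "a \<le> s" "s < b"
  shows "((\<lambda>r. f (flr r)) \<longlongrightarrow> f (flr s)) (at_right s)"
proof (cases "s \<in> T \<and> right_dense T s")
  case False
  then obtain d where "d > 0" "\<forall>r. s < r \<and> r < s + d \<longrightarrow> flr r = flr s"
    using flr_right[OF s] by blast
  then have "\<forall>\<^sub>F r in at_right s. f (flr r) = f (flr s)"
    unfolding eventually_at_right_field by (intro exI[of _ "s + d"]) auto
  then show ?thesis by (rule tendsto_eventually)
next
  case True
  show ?thesis
  proof (rule tendstoI)
    fix e :: real assume "e > 0"
    then obtain d where d: "d > 0" "\<And>r. r \<in> T \<Longrightarrow> r \<noteq> s \<Longrightarrow> dist r s < d \<Longrightarrow> dist (f r) (f s) < e"
      using tendstoD[OF rd_continuous_right_dense[OF f]] True unfolding eventually_at by metis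
    have "dist (f (flr r)) (f (flr s)) < e" if r: "s < r" "r < s + d" for r
    proof -
      have "flr r \<in> T" "s \<le> flr r" "flr r \<le> r" using flr_props[of r] s r True by auto
      then show ?thesis using d(2)[of "flr r"] flr_T[of s] True r \<open>e > 0\<close>
        by (cases "flr r = s") (auto simp: dist_real_def)
    qed
    then show "\<forall>\<^sub>F r in at_right s. dist (f (flr r)) (f (flr s)) < e"
      unfolding eventually_at_right_field using d(1) by (intro exI[of _ "s + d"]) auto
  qed
qed

text \<open>
  By right-continuity, \<open>f \<circ> flr\<close> is the pointwise limit of the step functions that sample it at the next
  multiple of \<open>1 / (n + 1)\<close>; so it is measurable, and it is bounded.
\<close>

lemma rd_integrable:
  fixes f :: "real \<Rightarrow> 'e::euclidean_space"
  assumes f: "rd f" and cd: "a \<le> c" "d \<le> b"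
  shows "(\<lambda>s. f (flr s)) integrable_on {c..d}"
proof -
  define r where "r n s = (of_int \<lfloor>real (Suc n) * s\<rfloor> + 1) / real (Suc n)" for n s
  have r: "s < r n s" "r n s \<le> s + 1 / real (Suc n)" for n s
  proof -
    define N where "N = real (Suc n)"
    have N: "N > 0" by (simp add: N_def)
    have "N * s < of_int \<lfloor>N * s\<rfloor> + 1" "of_int \<lfloor>N * s\<rfloor> \<le> N * s" by linarith+
    then show "s < r n s" "r n s \<le> s + 1 / real (Suc n)"
      unfolding r_def N_def[symmetric] using N by (simp_all add: field_simps)
  qed
  have r_lim: "filterlim (\<lambda>n. r n s) (at_right s) sequentially" for s
  proof -
    have "(\<lambda>n. r n s) \<longlonglongrightarrow> s"
    proof (rule tendsto_sandwich[of "\<lambda>n. s" _ _ "\<lambda>n. s + 1 / real (Suc n)"])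
      show "(\<lambda>n. s + 1 / real (Suc n)) \<longlonglongrightarrow> s"
        using tendsto_add[OF tendsto_const LIMSEQ_inverse_real_of_nat, of s]
        by (simp add: inverse_eq_divide)
    qed (use r in \<open>auto simp: less_imp_le\<close>)
    then show ?thesis unfolding filterlim_at
      using r(1)[of s] by (auto simp: less_imp_neq[symmetric] less_imp_le)
  qed
  have meas: "(\<lambda>s. f (flr s)) \<in> borel_measurable (lebesgue_on {a..<b})"
  proof (rule borel_measurable_LIMSEQ_metric)
    fix n
    define h where "h k = f (flr ((of_int k + 1) / real (Suc n)))" for k :: int
    have "(\<lambda>s::real. \<lfloor>real (Suc n) * s\<rfloor>) \<in> measurable borel (count_space UNIV)" by measurable
    then have "(\<lambda>s. h \<lfloor>real (Suc n) * s\<rfloor>) \<in> borel_measurable borel"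
      by (rule measurable_compose) simp
    then have "(\<lambda>s. h \<lfloor>real (Suc n) * s\<rfloor>) \<in> borel_measurable (lebesgue_on {a..<b})"
      by (simp add: measurable_completion measurable_restrict_space1)
    then show "(\<lambda>s. f (flr (r n s))) \<in> borel_measurable (lebesgue_on {a..<b})"
      by (simp add: h_def r_def)
  next
    fix s assume "s \<in> space (lebesgue_on {a..<b})"
    then have s: "a \<le> s" "s < b" by auto
    show "(\<lambda>n. f (flr (r n s))) \<longlonglongrightarrow> f (flr s)"
      by (rule filterlim_compose[OF rd_flr_right_continuous[OF f s] r_lim])
  qed
  obtain M where M: "\<And>t. t \<in> T \<Longrightarrow> norm (f t) \<le> M" using rd_bounded[OF f] by metis
  have neg: "negligible ({a..<b} - {a..b} \<union> ({a..b} - {a..<b}))"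
    by (rule negligible_subset[OF negligible_sing[of b]]) auto
  have "(\<lambda>s. f (flr s)) integrable_on {a..<b}"
  proof (rule measurable_bounded_by_integrable_imp_integrable[OF meas, of "\<lambda>_. M"])
    show "(\<lambda>_. M) integrable_on {a..<b}"
      using integrable_const_ivl[of M a b] integrable_spike_set_eq[OF neg, of "\<lambda>_. M"] by simp
  qed (use M flr_props in auto)
  then have "(\<lambda>s. f (flr s)) integrable_on {a..b}"
    using integrable_spike_set_eq[OF neg] by blast
  then show ?thesis by (rule integrable_on_subinterval) (use cd in auto)
qed

text \<open>
  The bound is asked only on \<open>[s, t)\<close>: for consecutive points \<open>s < t\<close> the value \<open>f(t)\<close> may be far from \<open>d\<close>
  and has no influence on the integral over the gap.
\<close>

lemma integral_flr_estimate:
  fixes f :: "real \<Rightarrow> 'e::euclidean_space"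
  assumes f: "rd f" and st: "s \<in> T" "t \<in> T" "s \<le> t" and e: "e \<ge> 0"
    and bound: "\<And>r. r \<in> T \<Longrightarrow> s \<le> r \<Longrightarrow> r < t \<Longrightarrow> norm (f r - d) \<le> e"
  shows "norm (integral {a..t} (\<lambda>r. f (flr r)) - integral {a..s} (\<lambda>r. f (flr r)) - (t - s) *\<^sub>R d)
    \<le> e * (t - s)"
proof -
  note b = in_T_bounds[OF st(1)] in_T_bounds[OF st(2)]
  have "((\<lambda>r. f (flr r) - d) has_integral
      (integral {s..t} (\<lambda>r. f (flr r)) - (t - s) *\<^sub>R d)) {s..t}"
    using has_integral_const_real[of d s t] st b
    by (intro has_integral_diff integrable_integral rd_integrable[OF f]) auto
  then have "norm (integral {s..t} (\<lambda>r. f (flr r)) - (t - s) *\<^sub>R d) \<le> e * measure lborel {s..t}"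
  proof (rule has_integral_bound_real[OF e, of "{t}", rotated])
    fix r assume r: "r \<in> {s..t} - {t}"
    then have "flr r \<in> T" "s \<le> flr r" "flr r < t"
      using flr_props[of r] st b by (auto intro: le_less_trans)
    then show "norm (f (flr r) - d) \<le> e" using bound by blast
  qed auto
  moreover have "integral {a..s} (\<lambda>r. f (flr r)) + integral {s..t} (\<lambda>r. f (flr r))
      = integral {a..t} (\<lambda>r. f (flr r))"
    using b st by (intro Henstock_Kurzweil_Integration.integral_combine rd_integrable[OF f]) auto
  then have "integral {s..t} (\<lambda>r. f (flr r))
      = integral {a..t} (\<lambda>r. f (flr r)) - integral {a..s} (\<lambda>r. f (flr r))"
    by (simp add: algebra_simps)
  ultimately show ?thesis using st by simp
qed

text \<open>
  The fundamental theorem of calculus.  At a right-dense point the integrand is close to \<open>f(t)\<close> on both sides.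
  At a right-scattered point the integral over the gap is exact, and the part to the left of \<open>t\<close> is of
  order \<open>t - s\<close>, which is negligible against \<open>\<sigma>(t) - s \<ge> \<sigma>(t) - t > 0\<close>.
\<close>

lemma has_delta_derivative_integral:
  fixes f :: "real \<Rightarrow> 'e::euclidean_space"
  assumes f: "rd f" and t: "t \<in> T"
  shows "has_delta_derivative T (\<lambda>t. y0 + integral {a..t} (\<lambda>r. f (flr r))) (f t) t"
proof -
  define G where "G t = integral {a..t} (\<lambda>r. f (flr r))" for t
  note est = integral_flr_estimate[OF f, folded G_def]
  let ?s = "fwd_jump T t"
  have "has_delta_derivative T G (f t) t"
    unfolding has_delta_derivative_iff
  proof (intro allI impI)
    fix e :: real assume e: "e > 0"
    show "\<exists>r>0. \<forall>s\<in>T. \<bar>s - t\<bar> < r \<longrightarrow> norm (G ?s - G s - (?s - s) *\<^sub>R f t) \<le> e * \<bar>?s - s\<bar>"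
    proof (cases "right_dense T t")
      case True
      then have st: "?s = t" by (simp add: right_dense_def)
      obtain r where r: "r > 0" "\<And>s. s \<in> T \<Longrightarrow> s \<noteq> t \<Longrightarrow> dist s t < r \<Longrightarrow> dist (f s) (f t) < e"
        using tendstoD[OF rd_continuous_right_dense[OF f t True] e] unfolding eventually_at by metis
      have near: "norm (f u - f t) \<le> e" if "u \<in> T" "\<bar>u - t\<bar> < r" for u
        using r(2)[OF that(1)] that(2) e by (cases "u = t") (auto simp: dist_norm)
      have "norm (G t - G s - (t - s) *\<^sub>R f t) \<le> e * \<bar>t - s\<bar>" if s: "s \<in> T" "\<bar>s - t\<bar> < r" for s
      proof (cases "s \<le> t")
        case True
        then show ?thesis using est[OF s(1) t True, of e "f t"] near s e by auto
      next
        case False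
        then have "norm (G s - G t - (s - t) *\<^sub>R f t) \<le> e * (s - t)"
          using near s e by (intro est[OF t s(1)]) auto
        also have "G s - G t - (s - t) *\<^sub>R f t = - (G t - G s - (t - s) *\<^sub>R f t)"
          by (simp add: algebra_simps)
        finally show ?thesis using False by (simp only: norm_minus_cancel) simp
      qed
      then show ?thesis using r(1) st by auto
    next
      case False
      define \<mu> where "\<mu> = ?s - t"
      have \<mu>: "\<mu> > 0" using False fwd_jump_props(1)[OF t] by (simp add: \<mu>_def right_dense_def)
      obtain M where M: "M > 0" "\<And>t. t \<in> T \<Longrightarrow> norm (f t) \<le> M" using rd_bounded[OF f] by metis
      have "norm (f r - f t) \<le> 0" if "r \<in> T" "t \<le> r" "r < ?s" for r
        using fwd_jump_props(3)[OF t that(1)] that by (cases "r = t") auto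
      then have jump: "G ?s = G t + \<mu> *\<^sub>R f t"
        using est[OF t fwd_jump_props(2,1)[OF t], of 0 "f t"] by (simp add: \<mu>_def algebra_simps)
      define r where "r = min \<mu> (e * \<mu> / (2 * M))"
      have "norm (G ?s - G s - (?s - s) *\<^sub>R f t) \<le> e * \<bar>?s - s\<bar>" if s: "s \<in> T" "\<bar>s - t\<bar> < r" for s
      proof (cases "s \<le> t")
        case True
        have "norm (f r - f t) \<le> 2 * M" if "r \<in> T" for r
          using norm_triangle_ineq4[of "f r" "f t"] M(2)[OF that] M(2)[OF t] by linarith
        then have "norm (G t - G s - (t - s) *\<^sub>R f t) \<le> (2 * M) * (t - s)"
          using M(1) by (intro est[OF s(1) t True]) auto
        also have "\<dots> \<le> e * \<mu>"
          using s(2) True M(1) by (simp add: r_def field_simps)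
        also have "\<dots> \<le> e * \<bar>?s - s\<bar>" using e True \<mu> by (simp add: \<mu>_def)
        finally show ?thesis unfolding jump by (simp add: \<mu>_def algebra_simps)
      next
        case False
        then have "?s \<le> s" using fwd_jump_props(3)[OF t s(1)] by simp
        moreover have "s - t < ?s - t" using s(2) unfolding r_def \<mu>_def by linarith
        ultimately have False by linarith
        then show ?thesis ..
      qed
      moreover have "r > 0" using \<mu> e M by (simp add: r_def)
      ultimately show ?thesis by blast
    qed
  qed
  then have "has_delta_derivative T (\<lambda>t. G t - (- y0)) (f t - 0) t"
    by (intro has_delta_derivative_diff has_delta_derivative_const)
  then show ?thesis by (simp add: G_def add.commute)
qed

lemma delta_antiderivative_integral:
  fixes f :: "real \<Rightarrow> 'e::euclidean_space"
  assumes f: "rd f" and F: "\<And>t. t \<in> tk T \<Longrightarrow> has_delta_derivative T F (f t) t" and t: "t \<in> T"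
  shows "F t = F a + integral {a..t} (\<lambda>r. f (flr r))"
  using delta_antiderivative_unique[OF F has_delta_derivative_integral[OF f, of _ 0] t] tk_sub_T
  by (simp add: algebra_simps)

lemma delta_integral_eq:
  assumes "\<And>t. t \<in> tk T \<Longrightarrow> has_delta_derivative T F (f t) t"
  shows "delta_integral T a b f = F b - F a"
  unfolding delta_integral_def
  using delta_antiderivative_unique[OF _ assms b_in] assms by (intro the_equality) blast+

end

section \<open>Volterra integral equations\<close>

lemma has_integral_exp_weight:
  fixes k a t :: real
  assumes "a \<le> t" "k > 0"
  shows "((\<lambda>s. exp (k * (s - a))) has_integral (exp (k * (t - a)) - 1) / k) {a..t}"
proof -
  have "((\<lambda>s. exp (k * (s - a)) / k) has_vector_derivative exp (k * (s - a))) (at s within {a..t})" for s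
    unfolding has_real_derivative_iff_has_vector_derivative[symmetric]
    using assms by (auto intro!: derivative_eq_intros)
  from fundamental_theorem_of_calculus[OF assms(1) this] show ?thesis
    by (simp add: diff_divide_distrib)
qed

text \<open>
  Banach's fixed point theorem in the supremum norm weighted by \<open>exp (- (2 K + 1) (t - a))\<close>, in which the
  integral operator is a contraction with factor \<open>1 / 2\<close> on the whole interval at once.  The right-hand
  side \<open>G\<close> is an operator that may use all past values of the unknown, so that
  it can contain the floor of the time scale.
\<close>

lemma volterra_exists:
  fixes G :: "(real \<Rightarrow> 'e::euclidean_space) \<Rightarrow> real \<Rightarrow> 'e"
  assumes ab: "a \<le> b" and K: "K \<ge> 0"
    and int: "\<And>z. continuous_on {a..b} z \<Longrightarrow> G z integrable_on {a..b}"
    and lip: "\<And>z w s N. continuous_on {a..b} z \<Longrightarrow> continuous_on {a..b} w \<Longrightarrow> s \<in> {a..b} \<Longrightarrow>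
      (\<And>r. r \<in> {a..s} \<Longrightarrow> norm (z r - w r) \<le> N) \<Longrightarrow> norm (G z s - G w s) \<le> K * N"
  obtains y where "continuous_on {a..b} y" "\<And>t. t \<in> {a..b} \<Longrightarrow> y t = y0 + integral {a..t} (G y)"
proof -
  define k where "k = 2 * K + 1"
  have k: "k > 0" "K / k \<le> 1 / 2" using K by (auto simp: k_def field_simps)
  \<comment> \<open>Clamping to \<open>[a, b]\<close> yields bounded continuous functions on the whole line, a complete space.\<close>
  define cl where "cl t = max a (min b t)" for t
  have cl: "cl t \<in> {a..b}" for t using ab by (auto simp: cl_def)
  have cl_id: "cl t = t" if "t \<in> {a..b}" for t using that by (auto simp: cl_def)
  have cl_cont: "continuous_on UNIV cl" unfolding cl_def by (intro continuous_intros)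
  define W where "W z = (\<lambda>s. exp (k * (s - a)) *\<^sub>R apply_bcontfun z s)" for z :: "real \<Rightarrow>\<^sub>C 'e"
  have W: "continuous_on S (W z)" for S z unfolding W_def by (intro continuous_intros) auto
  define q where "q z = (\<lambda>t. exp (- (k * (t - a))) *\<^sub>R (y0 + integral {a..t} (G (W z))))" for z
  have q: "continuous_on {a..b} (q z)" for z
    unfolding q_def by (intro continuous_intros indefinite_integral_continuous_1 int W)
  define Q where "Q z = Bcontfun (\<lambda>t. q z (cl t))" for z
  have mem: "(\<lambda>t. q z (cl t)) \<in> bcontfun" for z
  proof -
    have "continuous_on UNIV (\<lambda>t. q z (cl t))"
      using q cl by (intro continuous_on_compose2[OF q cl_cont]) auto
    moreover have "bounded (range (\<lambda>t. q z (cl t)))"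
      by (rule bounded_subset[OF compact_imp_bounded[OF compact_continuous_image[OF q compact_Icc]]])
        (use cl in auto)
    ultimately show ?thesis by (simp add: bcontfun_def)
  qed
  have Q: "apply_bcontfun (Q z) t = q z (cl t)" for z t
    unfolding Q_def by (subst Bcontfun_inverse[OF mem]) simp
  have contr: "dist (Q z) (Q w) \<le> 1 / 2 * dist z w" for z w
  proof (rule dist_bound)
    fix t
    define \<tau> where "\<tau> = cl t"
    have \<tau>: "a \<le> \<tau>" "\<tau> \<le> b" using cl[of t] by (auto simp: \<tau>_def)
    define D where "D = dist z w"
    have D: "norm (apply_bcontfun z r - apply_bcontfun w r) \<le> D" for r
      using dist_bounded[of z r w] by (simp add: D_def dist_norm)
    have G_int: "G (W z) integrable_on {a..\<tau>}" for z
      by (rule integrable_on_subinterval[OF int[OF W]]) (use \<tau> in auto)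
    have "norm (integral {a..\<tau>} (\<lambda>s. G (W z) s - G (W w) s))
      \<le> integral {a..\<tau>} (\<lambda>s. K * D * exp (k * (s - a)))"
    proof (rule integral_norm_bound_integral)
      show "(\<lambda>s. G (W z) s - G (W w) s) integrable_on {a..\<tau>}"
        by (intro integrable_diff G_int)
      show "(\<lambda>s. K * D * exp (k * (s - a))) integrable_on {a..\<tau>}"
        by (intro integrable_continuous_interval continuous_intros)
      fix s assume s: "s \<in> {a..\<tau>}"
      have "norm (W z r - W w r) \<le> exp (k * (s - a)) * D" if "r \<in> {a..s}" for r
      proof -
        have "norm (W z r - W w r) = exp (k * (r - a)) * norm (apply_bcontfun z r - apply_bcontfun w r)"
          by (simp add: W_def scaleR_diff_right[symmetric])
        also have "\<dots> \<le> exp (k * (s - a)) * D"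
          using that k D by (intro mult_mono) auto
        finally show ?thesis .
      qed
      then have "norm (G (W z) s - G (W w) s) \<le> K * (exp (k * (s - a)) * D)"
        using s \<tau> by (intro lip W) auto
      then show "norm (G (W z) s - G (W w) s) \<le> K * D * exp (k * (s - a))" by (simp add: mult_ac)
    qed
    also have "\<dots> = K * D * ((exp (k * (\<tau> - a)) - 1) / k)"
      using has_integral_mult_right[OF has_integral_exp_weight[OF \<tau>(1) k(1)]] by (rule integral_unique)
    finally have bound: "norm (integral {a..\<tau>} (\<lambda>s. G (W z) s - G (W w) s))
        \<le> K * D * ((exp (k * (\<tau> - a)) - 1) / k)" .
    have "dist (apply_bcontfun (Q z) t) (apply_bcontfun (Q w) t)
      = exp (- (k * (\<tau> - a))) * norm (integral {a..\<tau>} (\<lambda>s. G (W z) s - G (W w) s))"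
      unfolding Q q_def \<tau>_def[symmetric] dist_norm scaleR_diff_right[symmetric] integral_diff[OF G_int G_int]
      by simp
    also have "\<dots> \<le> exp (- (k * (\<tau> - a))) * (K * D * ((exp (k * (\<tau> - a)) - 1) / k))"
      using bound by (intro mult_left_mono) auto
    also have "\<dots> = (K / k) * D * (1 - exp (- (k * (\<tau> - a))))"
    proof -
      have "exp (- X) * (K * D * ((exp X - 1) / k)) = (K / k) * D * (1 - exp (- X))" for X
        using k(1) by (simp add: field_simps exp_minus)
      then show ?thesis .
    qed
    also have "\<dots> \<le> 1 / 2 * D * 1"
      using k K \<tau> by (intro mult_mono) (auto simp: D_def)
    finally show "dist (apply_bcontfun (Q z) t) (apply_bcontfun (Q w) t) \<le> 1 / 2 * dist z w"
      by (simp add: D_def)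
  qed
  have "\<exists>!z. Q z = z" by (rule banach_fix_type[of "1/2"]) (use contr in auto)
  then obtain z where z: "Q z = z" by blast
  have "W z t = y0 + integral {a..t} (G (W z))" if "t \<in> {a..b}" for t
    using Q[of z t] that unfolding z cl_id[OF that] q_def
    by (subst W_def) (simp add: exp_minus)
  then show ?thesis using that[of "W z"] W by blast
qed

text \<open>
  Reflection of time, \<open>t \<mapsto> - t\<close>, turns an equation that looks into the future into one that looks
  into the past.
\<close>

lemma volterra_exists_backward:
  fixes G :: "(real \<Rightarrow> 'e::euclidean_space) \<Rightarrow> real \<Rightarrow> 'e"
  assumes ab: "a \<le> b" and K: "K \<ge> 0"
    and int: "\<And>z. continuous_on {a..b} z \<Longrightarrow> G z integrable_on {a..b}"
    and lip: "\<And>z w s N. continuous_on {a..b} z \<Longrightarrow> continuous_on {a..b} w \<Longrightarrow> s \<in> {a..b} \<Longrightarrow>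
      (\<And>r. r \<in> {s..b} \<Longrightarrow> norm (z r - w r) \<le> N) \<Longrightarrow> norm (G z s - G w s) \<le> K * N"
  obtains y where "continuous_on {a..b} y" "\<And>t. t \<in> {a..b} \<Longrightarrow> y t = y1 + integral {t..b} (G y)"
proof -
  define G' where "G' z s = G (\<lambda>r. z (- r)) (- s)" for z s
  have refl: "continuous_on {a..b} (\<lambda>r. z (- r))" if "continuous_on {- b..- a} z" for z :: "real \<Rightarrow> 'e"
    by (rule continuous_on_compose2[OF that]) (auto intro!: continuous_intros)
  obtain x where x: "continuous_on {- b..- a} x"
    "\<And>t. t \<in> {- b..- a} \<Longrightarrow> x t = y1 + integral {- b..t} (G' x)"
  proof (rule volterra_exists[of "- b" "- a" K G' y1])
    show "G' z integrable_on {- b..- a}" if "continuous_on {- b..- a} z" for z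
      unfolding G'_def using int[OF refl[OF that]] integrable_reflect_real[where f="G (\<lambda>r. z (- r))" and a=a and b=b]
      by simp
    show "norm (G' z s - G' w s) \<le> K * N"
      if "continuous_on {- b..- a} z" "continuous_on {- b..- a} w" "s \<in> {- b..- a}"
        "\<And>r. r \<in> {- b..s} \<Longrightarrow> norm (z r - w r) \<le> N" for z w s N
      unfolding G'_def using that by (intro lip refl) auto
  qed (use ab K in auto)
  define y where "y = (\<lambda>t. x (- t))"
  have "y t = y1 + integral {t..b} (G y)" if "t \<in> {a..b}" for t
  proof -
    have "G' x = (\<lambda>s. G y (- s))" by (simp add: G'_def y_def fun_eq_iff)
    then have "y t = y1 + integral {- b..- t} (\<lambda>s. G y (- s))"
      using x(2)[of "- t"] that by (simp add: y_def)
    then show ?thesis using integral_reflect_real[of b t "G y"] by simp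
  qed
  moreover have "continuous_on {a..b} y" unfolding y_def by (rule refl[OF x(1)])
  ultimately show ?thesis using that by blast
qed

text \<open>
  With the same weight, the integral inequality at a point where the weighted norm of \<open>w\<close> is largest bounds this
  maximum by a constant plus half of itself.
\<close>

lemma volterra_gronwall:
  fixes w :: "real \<Rightarrow> 'e::euclidean_space"
  assumes ab: "a \<le> b" and K: "K \<ge> 0" and c: "c \<ge> 0"
    and w: "continuous_on {a..b} w" and h: "h integrable_on {a..b}"
    and eq: "\<And>t. t \<in> {a..b} \<Longrightarrow> w t = w0 + integral {a..t} h"
    and bound: "\<And>s. s \<in> {a..b} \<Longrightarrow> \<exists>r\<in>{a..s}. norm (h s) \<le> c + K * norm (w r)"
    and t: "t \<in> {a..b}"
  shows "norm (w t) \<le> 2 * (norm w0 + c * (b - a)) * exp ((2 * K + 1) * (b - a))"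
proof -
  define k where "k = 2 * K + 1"
  have k: "k > 0" "K / k \<le> 1 / 2" using K by (auto simp: k_def field_simps)
  define E where "E = norm w0 + c * (b - a)"
  have E: "E \<ge> 0" using ab c by (simp add: E_def)
  have "continuous_on {a..b} (\<lambda>t. exp (- (k * (t - a))) * norm (w t))"
    by (intro continuous_intros w)
  then obtain m where m: "m \<in> {a..b}"
    "\<And>t. t \<in> {a..b} \<Longrightarrow> exp (- (k * (t - a))) * norm (w t) \<le> exp (- (k * (m - a))) * norm (w m)"
    using continuous_attains_sup[OF compact_Icc, of a b] ab by force
  define N where "N = exp (- (k * (m - a))) * norm (w m)"
  have N: "N \<ge> 0" by (simp add: N_def)
  have wN: "norm (w r) \<le> N * exp (k * (r - a))" if "r \<in> {a..b}" for r
  proof -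
    have "n \<le> N * exp X" if "exp (- X) * n \<le> N" for n X
      using that by (simp add: exp_minus field_simps)
    then show ?thesis using m(2)[OF that] unfolding N_def[symmetric] by blast
  qed
  have h_int: "h integrable_on {a..m}"
    by (rule integrable_on_subinterval[OF h]) (use m in auto)
  have "norm (integral {a..m} h) \<le> integral {a..m} (\<lambda>s. c + K * N * exp (k * (s - a)))"
  proof (rule integral_norm_bound_integral[OF h_int])
    show "(\<lambda>s. c + K * N * exp (k * (s - a))) integrable_on {a..m}"
      by (intro integrable_continuous_interval continuous_intros)
    fix s assume s: "s \<in> {a..m}"
    then obtain r where r: "r \<in> {a..s}" "norm (h s) \<le> c + K * norm (w r)"
      using bound[of s] m(1) by auto
    have "norm (w r) \<le> N * exp (k * (r - a))" using r s m(1) by (intro wN) auto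
    also have "\<dots> \<le> N * exp (k * (s - a))" using r k N by (intro mult_left_mono) auto
    finally have "K * norm (w r) \<le> K * (N * exp (k * (s - a)))" using K by (rule mult_left_mono)
    then show "norm (h s) \<le> c + K * N * exp (k * (s - a))" using r(2) by (simp add: mult_ac)
  qed
  also have "\<dots> = c * (m - a) + K * N * ((exp (k * (m - a)) - 1) / k)"
  proof (rule integral_unique)
    show "((\<lambda>s. c + K * N * exp (k * (s - a))) has_integral
        c * (m - a) + K * N * ((exp (k * (m - a)) - 1) / k)) {a..m}"
      using m(1) has_integral_const_real[of c a m]
      by (intro has_integral_add has_integral_mult_right has_integral_exp_weight k(1)) (auto simp: mult_ac)
  qed
  finally have "norm (w m) \<le> norm w0 + (c * (m - a) + K * N * ((exp (k * (m - a)) - 1) / k))"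
    unfolding eq[OF m(1)] by (rule order_trans[OF norm_triangle_ineq add_left_mono])
  also have "\<dots> \<le> E + (K / k) * N * exp (k * (m - a))"
  proof -
    have "c * (m - a) \<le> c * (b - a)" using m(1) c by (intro mult_left_mono) auto
    moreover have "K * N * ((exp (k * (m - a)) - 1) / k) \<le> (K / k) * N * exp (k * (m - a))"
      using K N k by (simp add: field_simps)
    ultimately show ?thesis by (simp add: E_def)
  qed
  also have "(K / k) * N * exp (k * (m - a)) \<le> (1 / 2) * N * exp (k * (m - a))"
    using k N by (intro mult_right_mono) auto
  also have "(1 / 2) * N * exp (k * (m - a)) = norm (w m) / 2"
    by (simp add: N_def exp_minus)
  finally have "norm (w m) \<le> 2 * E" by simp
  moreover have "N \<le> norm (w m)"
    unfolding N_def using m(1) k by (simp add: mult_left_le_one_le)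
  ultimately have "N \<le> 2 * E" by simp
  have "norm (w t) \<le> N * exp (k * (t - a))" by (rule wN[OF t])
  also have "\<dots> \<le> 2 * E * exp (k * (b - a))"
    using \<open>N \<le> 2 * E\<close> t k E by (intro mult_mono) auto
  finally show ?thesis by (simp add: E_def k_def)
qed

section \<open>Rd-continuous fields\<close>

text \<open>
  The points \<open>d k\<close> together with their limit \<open>0\<close> form a compact set on which the prescription is
  continuous; Tietze's theorem extends it.
\<close>

lemma continuous_through_sequence:
  fixes x :: "nat \<Rightarrow> 'x::real_inner"
  assumes pos: "\<And>k. 0 < d k" and dec: "\<And>k. d (Suc k) < d k" and d: "d \<longlonglongrightarrow> (0::real)"
    and x: "x \<longlonglongrightarrow> \<xi>"
  obtains g where "continuous_on UNIV g" "g 0 = \<xi>" "\<And>k. g (d k) = x k"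
proof -
  have mono: "d j < d i" if "i < j" for i j
    using lift_Suc_mono_less[of "\<lambda>k. - d k" i j] dec that by simp
  then have mono': "i < j" if "d j < d i" for i j
    using that by (metis less_asym linorder_neqE_nat)
  have inj: "d i = d j \<longleftrightarrow> i = j" for i j
    using mono[of i j] mono[of j i] by (cases i j rule: linorder_cases) auto
  define K where "K = insert 0 (range d)"
  have "compact K" unfolding K_def using d by (rule compact_sequence_with_limit)
  then have K: "closedin (top_of_set UNIV) K" using compact_imp_closed by simp
  define g0 where "g0 r = (if r = 0 then \<xi> else x (THE k. d k = r))" for r
  have g0: "g0 0 = \<xi>" "g0 (d k) = x k" for k
    using pos[of k] by (auto simp: g0_def inj)
  have "continuous_on K g0" unfolding continuous_on_iff
  proof (intro ballI allI impI)
    fix r and e :: real assume r: "r \<in> K" and e: "e > 0"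
    show "\<exists>\<delta>>0. \<forall>r'\<in>K. dist r' r < \<delta> \<longrightarrow> dist (g0 r') (g0 r) < e"
    proof (cases "r = 0")
      case True
      obtain N where N: "\<And>k. k \<ge> N \<Longrightarrow> dist (x k) \<xi> < e" using x e unfolding lim_sequentially by blast
      have "dist (g0 r') (g0 r) < e" if "r' \<in> K" "dist r' r < d N" for r'
      proof (cases "r' = 0")
        case False
        then obtain k where k: "r' = d k" using \<open>r' \<in> K\<close> by (auto simp: K_def)
        then have "N < k" using that pos[of k] True mono' by (auto simp: dist_real_def)
        then show ?thesis using N[of k] True k g0 by simp
      qed (use True e in simp)
      then show ?thesis using pos by blast
    next
      case False
      then obtain k where k: "r = d k" using r by (auto simp: K_def)
      define \<delta> where "\<delta> = Min ((\<lambda>j. \<bar>d j - d k\<bar>) ` ({..Suc k} - {k}))"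
      have fin: "finite ((\<lambda>j. \<bar>d j - d k\<bar>) ` ({..Suc k} - {k}))"
        "(\<lambda>j. \<bar>d j - d k\<bar>) ` ({..Suc k} - {k}) \<noteq> {}" by auto
      have "\<delta> > 0" unfolding \<delta>_def using fin by (subst Min_gr_iff) (auto simp: inj)
      have \<delta>: "\<delta> \<le> \<bar>d j - d k\<bar>" if "j \<le> Suc k" "j \<noteq> k" for j
        unfolding \<delta>_def using that by (intro Min_le) auto
      have "r' = r" if "r' \<in> K" "dist r' r < \<delta>" for r'
      proof (rule ccontr)
        assume ne: "r' \<noteq> r"
        have "r' \<le> d (Suc k) \<or> (\<exists>j\<le>Suc k. r' = d j)"
        proof (cases "r' = 0")
          case False
          then obtain j where "r' = d j" using \<open>r' \<in> K\<close> by (auto simp: K_def)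
          then show ?thesis using mono[of "Suc k" j] by (cases "j \<le> Suc k") auto
        qed (use pos[of "Suc k"] in auto)
        then show False
        proof
          assume "r' \<le> d (Suc k)"
          then show False using \<delta>[of "Suc k"] dec[of k] that(2) k by (auto simp: dist_real_def)
        next
          assume "\<exists>j\<le>Suc k. r' = d j"
          then show False using \<delta> that(2) k ne by (force simp: dist_real_def)
        qed
      qed
      then show ?thesis using \<open>\<delta> > 0\<close> e by (metis dist_self)
    qed
  qed
  then obtain g where g: "continuous_on UNIV g" "\<And>r. r \<in> K \<Longrightarrow> g r = g0 r"
    using Tietze_unbounded[OF _ K] by metis
  show ?thesis using that[of g] g g0 by (simp add: K_def)
qed

text \<open>
  Limits along all continuous curves through \<open>(t, \<xi>)\<close> imply a limit in both variables jointly.  Otherwise there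
  are points \<open>(\<tau> k, x k) \<rightarrow> (t, \<xi>)\<close>, with the distance from \<open>\<tau> k\<close> to \<open>t\<close> strictly decreasing, at which \<open>f\<close> stays away from \<open>l\<close>.  A
  continuous curve that passes through every second of these points, and through \<open>\<xi>\<close> at the other times \<open>\<tau> k\<close>, has a limit
  by assumption; the times with value \<open>\<xi>\<close> identify it as \<open>l\<close>, and the remaining ones contradict this.
\<close>

lemma joint_limit:
  fixes f :: "real \<Rightarrow> 'x::real_inner \<Rightarrow> 'b::metric_space"
  assumes t: "t \<notin> S"
    and lims: "\<And>z. continuous_on UNIV z \<Longrightarrow> z t = \<xi> \<Longrightarrow> \<exists>l. ((\<lambda>s. f s (z s)) \<longlongrightarrow> l) (at t within S)"
    and l: "((\<lambda>s. f s \<xi>) \<longlongrightarrow> l) (at t within S)" and e: "e > 0"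
  shows "\<exists>d>0. \<forall>s\<in>S. \<forall>x. dist s t < d \<longrightarrow> dist x \<xi> < d \<longrightarrow> dist (f s x) l < e"
proof (rule ccontr)
  assume contra: "\<not> ?thesis"
  define bad where "bad d s x \<longleftrightarrow> s \<in> S \<and> dist s t < d \<and> dist x \<xi> < d \<and> \<not> dist (f s x) l < e" for d s x
  have bad: "\<exists>s x. bad d s x" if "d > 0" for d
    using contra that unfolding bad_def by blast
  have "\<exists>p. \<forall>k. bad (1 / real (Suc k)) (fst (p k)) (snd (p k)) \<and> dist (fst (p (Suc k))) t < dist (fst (p k)) t"
  proof (rule dependent_nat_choice)
    show "\<exists>p. bad (1 / real (Suc 0)) (fst p) (snd p)" using bad[of 1] by auto
    fix p k assume p: "bad (1 / real (Suc k)) (fst p) (snd p)"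
    then have "dist (fst p) t > 0" using t unfolding bad_def by auto
    then obtain s x where sx: "bad (min (dist (fst p) t) (1 / real (Suc (Suc k)))) s x"
      using bad[of "min (dist (fst p) t) (1 / real (Suc (Suc k)))"] by auto
    then show "\<exists>q. bad (1 / real (Suc (Suc k))) (fst q) (snd q) \<and> dist (fst q) t < dist (fst p) t"
      unfolding bad_def by (intro exI[of _ "(s, x)"]) auto
  qed
  then obtain p where p: "\<And>k. bad (1 / real (Suc k)) (fst (p k)) (snd (p k))"
    "\<And>k. dist (fst (p (Suc k))) t < dist (fst (p k)) t" by blast
  define \<tau> where "\<tau> k = fst (p k)" for k
  have p': "\<tau> k \<in> S" "dist (\<tau> k) t \<le> 1 / real (Suc k)" "dist (snd (p k)) \<xi> \<le> 1 / real (Suc k)"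
    "\<not> dist (f (\<tau> k) (snd (p k))) l < e" for k
    using p(1)[of k] unfolding bad_def \<tau>_def by (simp_all only: less_imp_le simp_thms)
  define x where "x k = (if even k then snd (p k) else \<xi>)" for k
  have small: "(\<lambda>k. 1 / real (Suc k)) \<longlonglongrightarrow> 0"
    using LIMSEQ_inverse_real_of_nat by (simp add: inverse_eq_divide)
  have d: "(\<lambda>k. dist (\<tau> k) t) \<longlonglongrightarrow> 0"
  proof (rule tendsto_sandwich[OF _ _ tendsto_const small])
    show "\<forall>\<^sub>F k in sequentially. dist (\<tau> k) t \<le> 1 / real (Suc k)"
      using p'(2) by (intro always_eventually allI)
  qed simp
  have "(\<lambda>k. dist (x k) \<xi>) \<longlonglongrightarrow> 0"
  proof (rule tendsto_sandwich[OF _ _ tendsto_const small])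
    show "\<forall>\<^sub>F k in sequentially. dist (x k) \<xi> \<le> 1 / real (Suc k)"
      using p'(3) by (intro always_eventually allI) (simp add: x_def del: of_nat_Suc)
  qed simp
  then have x: "x \<longlonglongrightarrow> \<xi>" by (rule tendsto_dist_iff[THEN iffD2])
  have \<tau>: "\<tau> k \<in> S" "\<tau> k \<noteq> t" for k using p'(1)[of k] t by auto
  obtain g where g: "continuous_on UNIV g" "g 0 = \<xi>" "\<And>k. g (dist (\<tau> k) t) = x k"
  proof (rule continuous_through_sequence[OF _ _ d x])
    show "0 < dist (\<tau> k) t" for k using \<tau>(2) by simp
    show "dist (\<tau> (Suc k)) t < dist (\<tau> k) t" for k using p(2) by (simp add: \<tau>_def)
  qed (rule that)
  \<comment> \<open>Interpolating in the distance to \<open>t\<close> treats approach from either side alike.\<close>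
  define z where "z s = g (dist s t)" for s
  have z: "continuous_on UNIV z" "z t = \<xi>" unfolding z_def
    by (intro continuous_on_compose2[OF g(1)] continuous_intros) (simp_all add: g(2))
  obtain l' where l': "((\<lambda>s. f s (z s)) \<longlongrightarrow> l') (at t within S)" using lims[OF z] by blast
  have \<tau>_lim: "filterlim \<tau> (at t within S) sequentially"
    unfolding filterlim_at using tendsto_dist_iff[THEN iffD2, OF d] \<tau> by simp
  have seq: "(\<lambda>k. f (\<tau> k) (x k)) \<longlonglongrightarrow> l'"
    using filterlim_compose[OF l' \<tau>_lim] by (simp add: z_def g(3))
  have "(\<lambda>k. f (\<tau> (2 * k + 1)) (x (2 * k + 1))) \<longlonglongrightarrow> l'"
    by (rule LIMSEQ_subseq_LIMSEQ[OF seq, of "\<lambda>k. 2 * k + 1", unfolded o_def]) (simp add: strict_mono_def)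
  then have "(\<lambda>k. f (\<tau> (2 * k + 1)) \<xi>) \<longlonglongrightarrow> l'" by (simp add: x_def)
  moreover have "(\<lambda>k. f (\<tau> (2 * k + 1)) \<xi>) \<longlonglongrightarrow> l"
    by (rule LIMSEQ_subseq_LIMSEQ[OF filterlim_compose[OF l \<tau>_lim], of "\<lambda>k. 2 * k + 1", unfolded o_def])
      (simp add: strict_mono_def)
  ultimately have "l' = l" by (rule LIMSEQ_unique)
  then obtain N where "\<And>k. k \<ge> N \<Longrightarrow> dist (f (\<tau> k) (x k)) l < e"
    using seq e unfolding lim_sequentially by blast
  from this[of "2 * N"] p'(4)[of "2 * N"] show False by (simp add: x_def)
qed

lemma joint_limit_compose:
  fixes f :: "real \<Rightarrow> 'x::metric_space \<Rightarrow> 'b::metric_space"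
  assumes joint: "\<And>e. e > 0 \<Longrightarrow> \<exists>d>0. \<forall>s\<in>S. \<forall>x. dist s t < d \<longrightarrow> dist x \<xi> < d \<longrightarrow> dist (f s x) l < e"
    and x: "(x \<longlongrightarrow> \<xi>) (at t within S)"
  shows "((\<lambda>s. f s (x s)) \<longlongrightarrow> l) (at t within S)"
proof (rule tendstoI)
  fix e :: real assume "e > 0"
  then obtain d where d: "d > 0" "\<And>s x. s \<in> S \<Longrightarrow> dist s t < d \<Longrightarrow> dist x \<xi> < d \<Longrightarrow> dist (f s x) l < e"
    using joint by metis
  have "\<forall>\<^sub>F s in at t within S. s \<in> S \<and> dist s t < d"
    unfolding eventually_at using d(1) by blast
  with tendstoD[OF x d(1)] show "\<forall>\<^sub>F s in at t within S. dist (f s (x s)) l < e"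
    by eventually_elim (use d(2) in blast)
qed

context time_scale_interval
begin

lemma field_rd:
  assumes "rd_continuous_field T f" "continuous_on UNIV z"
  shows "rd (\<lambda>t. f t (z t))"
  using assms continuous_on_subset unfolding rd_continuous_field_def by blast

lemma field_joint_left:
  fixes f :: "real \<Rightarrow> 'x::real_inner \<Rightarrow> 'b::real_normed_vector"
  assumes f: "rd_continuous_field T f" and t: "t \<in> T"
  obtains l where "\<And>e. e > 0 \<Longrightarrow>
    \<exists>d>0. \<forall>s\<in>T \<inter> {..<t}. \<forall>x. dist s t < d \<longrightarrow> dist x \<xi> < d \<longrightarrow> dist (f s x) l < e"
proof -
  obtain l where l: "((\<lambda>s. f s \<xi>) \<longlongrightarrow> l) (at t within (T \<inter> {..<t}))"
    using rd_left[OF field_rd[OF f continuous_on_const] t] by blast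
  have "\<exists>d>0. \<forall>s\<in>T \<inter> {..<t}. \<forall>x. dist s t < d \<longrightarrow> dist x \<xi> < d \<longrightarrow> dist (f s x) l < e"
    if e: "e > 0" for e
  proof (rule joint_limit[OF _ _ _ e])
    show "\<exists>l. ((\<lambda>s. f s (z s)) \<longlongrightarrow> l) (at t within T \<inter> {..<t})" if "continuous_on UNIV z" for z
      using rd_left[OF field_rd[OF f that] t] by metis
  qed (use l in auto)
  then show ?thesis using that by blast
qed

lemma field_joint_right:
  fixes f :: "real \<Rightarrow> 'x::real_inner \<Rightarrow> 'b::real_normed_vector"
  assumes f: "rd_continuous_field T f" and t: "t \<in> T" and e: "e > 0"
  shows "\<exists>d>0. \<forall>s\<in>T \<inter> {t<..}. \<forall>x. dist s t < d \<longrightarrow> dist x \<xi> < d \<longrightarrow> dist (f s x) (f t \<xi>) < e"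
proof (rule joint_limit[OF _ _ _ e])
  show "((\<lambda>s. f s \<xi>) \<longlongrightarrow> f t \<xi>) (at t within T \<inter> {t<..})"
    by (rule rd_right[OF field_rd[OF f continuous_on_const] t])
  show "\<exists>l. ((\<lambda>s. f s (z s)) \<longlongrightarrow> l) (at t within T \<inter> {t<..})" if "continuous_on UNIV z" for z
    using rd_right[OF field_rd[OF f that] t] by blast
qed simp

lemma field_joint_right_dense:
  fixes f :: "real \<Rightarrow> 'x::real_inner \<Rightarrow> 'b::real_normed_vector"
  assumes f: "rd_continuous_field T f" and t: "t \<in> T" "right_dense T t" and e: "e > 0"
  shows "\<exists>d>0. \<forall>s\<in>T - {t}. \<forall>x. dist s t < d \<longrightarrow> dist x \<xi> < d \<longrightarrow> dist (f s x) (f t \<xi>) < e"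
proof (rule joint_limit[OF _ _ _ e])
  show "((\<lambda>s. f s \<xi>) \<longlongrightarrow> f t \<xi>) (at t within T - {t})"
    using rd_continuous_right_dense[OF field_rd[OF f continuous_on_const] t]
    by (rule tendsto_within_subset) auto
  show "\<exists>l. ((\<lambda>s. f s (z s)) \<longlongrightarrow> l) (at t within T - {t})" if "continuous_on UNIV z" for z
    using tendsto_within_subset[OF rd_continuous_right_dense[OF field_rd[OF f that] t]] by blast
qed simp

text \<open>
  The definition of an rd-continuous field speaks about continuous \<open>x\<close>.  With joint one-sided limits
  the statement extends to curves that are themselves only rd-continuous, such as controls.
\<close>

lemma field_compose_rd:
  fixes f :: "real \<Rightarrow> 'x::real_inner \<Rightarrow> 'b::real_normed_vector"
  assumes f: "rd_continuous_field T f" and x: "rd x"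
  shows "rd (\<lambda>t. f t (x t))"
  unfolding rd_iff continuous_within
proof (intro ballI conjI impI)
  fix t assume t: "t \<in> T"
  obtain \<xi> where \<xi>: "(x \<longlongrightarrow> \<xi>) (at t within (T \<inter> {..<t}))" using rd_left[OF x t] by blast
  obtain l where "\<And>e. e > 0 \<Longrightarrow>
    \<exists>d>0. \<forall>s\<in>T \<inter> {..<t}. \<forall>x. dist s t < d \<longrightarrow> dist x \<xi> < d \<longrightarrow> dist (f s x) l < e"
    using field_joint_left[OF f t] by metis
  from joint_limit_compose[OF this \<xi>]
  show "\<exists>l. ((\<lambda>t. f t (x t)) \<longlongrightarrow> l) (at t within T \<inter> {..<t})" by blast
  assume dense: "right_dense T t"
  have "(x \<longlongrightarrow> x t) (at t within T - {t})"
    using rd_continuous_right_dense[OF x t dense] by (rule tendsto_within_subset) auto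
  from joint_limit_compose[OF field_joint_right_dense[OF f t dense] this]
  have "((\<lambda>t. f t (x t)) \<longlongrightarrow> f t (x t)) (at t within T - {t})" .
  moreover have "at t within T - {t} = at t within T" unfolding at_within_def by simp
  ultimately show "((\<lambda>t. f t (x t)) \<longlongrightarrow> f t (x t)) (at t within T)" by simp
qed

text \<open>
  Continuity in \<open>x\<close> for each single \<open>t\<close> carries no uniformity in \<open>t\<close>.  To the left and to the right of a point
  both \<open>f t h\<close> and \<open>f t (x t)\<close> are close to the same joint limit, and compactness makes the radius common.
\<close>

lemma field_uniformly_continuous_along:
  fixes f :: "real \<Rightarrow> 'x::real_inner \<Rightarrow> 'b::real_normed_vector"
  assumes f: "rd_continuous_field T f" and cont: "\<And>t. t \<in> T \<Longrightarrow> continuous_on UNIV (f t)"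
    and x: "rd x" and e: "e > 0"
  shows "\<exists>r>0. \<forall>t\<in>T. \<forall>h. dist h (x t) \<le> r \<longrightarrow> dist (f t h) (f t (x t)) \<le> e"
proof (rule uniform_radius)
  have near: "\<exists>r>0. \<forall>\<^sub>F s in at t within S. \<forall>h. dist h (x s) \<le> r \<longrightarrow> dist (f s h) (f s (x s)) \<le> e"
    if joint: "\<And>e. e > 0 \<Longrightarrow> \<exists>d>0. \<forall>s\<in>S. \<forall>x. dist s t < d \<longrightarrow> dist x \<xi> < d \<longrightarrow> dist (f s x) l < e"
      and \<xi>: "(x \<longlongrightarrow> \<xi>) (at t within S)" for S t \<xi> l
  proof -
    obtain d where d: "d > 0" "\<And>s x. s \<in> S \<Longrightarrow> dist s t < d \<Longrightarrow> dist x \<xi> < d \<Longrightarrow> dist (f s x) l < e / 2"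
      using joint[of "e / 2"] e by auto
    have "\<forall>\<^sub>F s in at t within S. s \<in> S \<and> dist s t < d"
      unfolding eventually_at using d(1) by blast
    moreover have "\<forall>\<^sub>F s in at t within S. dist (x s) \<xi> < d / 2" using d(1) by (intro tendstoD[OF \<xi>]) simp
    ultimately have "\<forall>\<^sub>F s in at t within S. \<forall>h. dist h (x s) \<le> d / 2 \<longrightarrow> dist (f s h) (f s (x s)) \<le> e"
    proof (eventually_elim, intro allI impI)
      fix s h assume s: "s \<in> S \<and> dist s t < d" "dist (x s) \<xi> < d / 2" "dist h (x s) \<le> d / 2"
      have "dist h \<xi> < d" using s dist_triangle[of h \<xi> "x s"] by simp
      then have "dist (f s h) l < e / 2" "dist (f s (x s)) l < e / 2" using s d by auto
      then show "dist (f s h) (f s (x s)) \<le> e"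
        using dist_triangle2[of "f s h" "f s (x s)" l] by simp
    qed
    then show ?thesis using d(1) by (intro exI[of _ "d / 2"]) simp
  qed
  fix t assume t: "t \<in> T"
  obtain \<xi> where \<xi>: "(x \<longlongrightarrow> \<xi>) (at t within (T \<inter> {..<t}))" using rd_left[OF x t] by blast
  obtain l where "\<And>e. e > 0 \<Longrightarrow>
    \<exists>d>0. \<forall>s\<in>T \<inter> {..<t}. \<forall>x. dist s t < d \<longrightarrow> dist x \<xi> < d \<longrightarrow> dist (f s x) l < e"
    using field_joint_left[OF f t] by metis
  from near[OF this \<xi>]
  show "\<exists>r>0. \<forall>\<^sub>F s in at t within T \<inter> {..<t}. \<forall>h. dist h (x s) \<le> r \<longrightarrow> dist (f s h) (f s (x s)) \<le> e" .
  from near[OF field_joint_right[OF f t] rd_right[OF x t]]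
  show "\<exists>r>0. \<forall>\<^sub>F s in at t within T \<inter> {t<..}. \<forall>h. dist h (x s) \<le> r \<longrightarrow> dist (f s h) (f s (x s)) \<le> e" .
  have "\<exists>d>0. \<forall>h. dist h (x t) < d \<longrightarrow> dist (f t h) (f t (x t)) < e"
    using cont[OF t] e unfolding continuous_on_iff by blast
  then obtain d where "d > 0" "\<And>h. dist h (x t) < d \<Longrightarrow> dist (f t h) (f t (x t)) < e" by blast
  then show "\<exists>r>0. \<forall>h. dist h (x t) \<le> r \<longrightarrow> dist (f t h) (f t (x t)) \<le> e"
    by (intro exI[of _ "d / 2"]) (auto intro: less_imp_le)
qed auto

end

section \<open>Perturbed trajectories of a control system\<close>

context time_scale_interval
begin

lemma continuous_on_of_delta_derivative:
  assumes y: "\<And>t. t \<in> tk T \<Longrightarrow> has_delta_derivative T y (d t) t"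
  shows "continuous_on T y"
  unfolding continuous_on_eq_continuous_within
proof
  fix t assume t: "t \<in> T"
  show "continuous (at t within T) y"
  proof (cases "t \<in> tk T")
    case True
    then show ?thesis using has_delta_derivative_continuous[OF t y] by blast
  next
    case False
    then have b: "t = b" "\<not> left_dense T t" using t by (auto simp: tk_iff)
    have "T \<inter> {b<..} = {}" using in_T_bounds by force
    then have "at t within T = bot"
      using at_within_T_split[of t] left_scattered_trivial[OF t b(2)] b(1) by simp
    then show ?thesis by (simp add: continuous_within)
  qed
qed

definition gronwall_const :: "real \<Rightarrow> real" where
  "gronwall_const K = 2 * (1 + (b - a)) * exp ((2 * K + 1) * (b - a))"

lemma gronwall_const_ge_1: "K \<ge> 0 \<Longrightarrow> gronwall_const K \<ge> 1"
proof -
  assume K: "K \<ge> 0"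
  have "1 * 1 \<le> (2 * (1 + (b - a))) * exp ((2 * K + 1) * (b - a))"
    using K a_less_b by (intro mult_mono) auto
  then show ?thesis by (simp add: gronwall_const_def)
qed

lemma flr_in: "s \<in> {a..b} \<Longrightarrow> flr s \<in> T \<and> flr s \<in> {a..s} \<and> flr s \<in> {a..b}"
  using flr_props[of s] in_T_bounds[of "flr s"] by auto

lemma rd_integral_diff:
  fixes f g :: "real \<Rightarrow> 'e::euclidean_space"
  assumes "rd f" "rd g" "t \<in> {a..b}"
  shows "integral {a..t} (\<lambda>s. f (flr s)) - integral {a..t} (\<lambda>s. g (flr s))
    = integral {a..t} (\<lambda>s. f (flr s) - g (flr s))"
  using assms by (intro integral_diff[symmetric] rd_integrable) auto

text \<open>
  Gronwall's estimate for a dynamic equation; since the floor of \<open>s\<close> lies in \<open>[a, s]\<close>, the equation is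
  of the type considered in \<open>volterra_gronwall\<close>.
\<close>

lemma gronwall:
  fixes w :: "real \<Rightarrow> 'e::euclidean_space"
  assumes K: "K \<ge> 0" and w: "continuous_on {a..b} w" and g: "rd g"
    and eq: "\<And>t. t \<in> {a..b} \<Longrightarrow> w t = w0 + integral {a..t} (\<lambda>s. g (flr s))"
    and w0: "norm w0 \<le> c" and bound: "\<And>t. t \<in> T \<Longrightarrow> norm (g t) \<le> c + K * norm (w t)"
    and t: "t \<in> {a..b}"
  shows "norm (w t) \<le> gronwall_const K * c"
proof -
  have c: "c \<ge> 0" using w0 norm_ge_zero order_trans by blast
  have "norm (w t) \<le> 2 * (norm w0 + c * (b - a)) * exp ((2 * K + 1) * (b - a))"
  proof (rule volterra_gronwall[OF _ K c w _ eq _ t])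
    show "\<exists>r\<in>{a..s}. norm (g (flr s)) \<le> c + K * norm (w r)" if "s \<in> {a..b}" for s
      using flr_in[OF that] bound by (intro bexI[of _ "flr s"]) auto
  qed (use a_less_b rd_integrable[OF g] in auto)
  also have "\<dots> \<le> 2 * (c + c * (b - a)) * exp ((2 * K + 1) * (b - a))"
    using w0 by (intro mult_right_mono) auto
  also have "\<dots> = gronwall_const K * c" by (simp add: gronwall_const_def algebra_simps)
  finally show ?thesis .
qed

lemma initial_value_problem:
  fixes g :: "real \<Rightarrow> 'e::euclidean_space \<Rightarrow> 'e"
  assumes K: "K \<ge> 0" and rd: "\<And>z. continuous_on {a..b} z \<Longrightarrow> rd (\<lambda>t. g t (z t))"
    and lip: "\<And>t p q. t \<in> T \<Longrightarrow> norm (g t p - g t q) \<le> K * norm (p - q)"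
  obtains y where "continuous_on {a..b} y"
    "\<And>t. t \<in> {a..b} \<Longrightarrow> y t = y0 + integral {a..t} (\<lambda>s. g (flr s) (y (flr s)))"
proof -
  have "\<exists>y. continuous_on {a..b} y \<and>
    (\<forall>t\<in>{a..b}. y t = y0 + integral {a..t} (\<lambda>s. g (flr s) (y (flr s))))"
  proof (rule volterra_exists[of a b K "\<lambda>z s. g (flr s) (z (flr s))" y0])
  show "(\<lambda>s. g (flr s) (z (flr s))) integrable_on {a..b}" if "continuous_on {a..b} z" for z
    by (rule rd_integrable[OF rd[OF that]]) auto
  show "norm (g (flr s) (z (flr s)) - g (flr s) (w (flr s))) \<le> K * N"
    if "s \<in> {a..b}" "\<And>r. r \<in> {a..s} \<Longrightarrow> norm (z r - w r) \<le> N" for z w s N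
  proof -
    have "K * norm (z (flr s) - w (flr s)) \<le> K * N"
      using flr_in[OF that(1)] that(2)[of "flr s"] K by (intro mult_left_mono) auto
    then show ?thesis using lip[of "flr s" "z (flr s)" "w (flr s)"] flr_in[OF that(1)] by simp
  qed
  fix y assume "continuous_on {a..b} y"
    "\<And>t. t \<in> {a..b} \<Longrightarrow> y t = y0 + integral {a..t} (\<lambda>s. g (flr s) (y (flr s)))"
  then show "\<exists>y. continuous_on {a..b} y \<and>
    (\<forall>t\<in>{a..b}. y t = y0 + integral {a..t} (\<lambda>s. g (flr s) (y (flr s))))" by blast
qed (use K a_less_b in auto)
  then show ?thesis using that by blast
qed

end

locale control_system = time_scale_interval T a b
  for T :: "real set" and a b :: real +
  fixes \<Phi> :: "real \<Rightarrow> 'e::euclidean_space \<times> 'u::euclidean_space \<Rightarrow> 'e"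
    and D :: "real \<Rightarrow> 'e \<times> 'u \<Rightarrow> ('e \<times> 'u) \<Rightarrow>\<^sub>L 'e"
  assumes \<Phi>_has_derivative: "t \<in> T \<Longrightarrow> (\<Phi> t has_derivative blinfun_apply (D t x)) (at x)"
    and D_continuous: "t \<in> T \<Longrightarrow> continuous_on UNIV (D t)"
    and \<Phi>_field: "rd_continuous_field T \<Phi>"
    and D_field: "rd_continuous_field T D"
begin

text \<open>
  The dynamic equation in integrated form, for a function on the real interval that is affine on the gaps of
  the time scale.  On \<open>T\<close> this is equivalent to the delta differential equation
  (\<open>trajectory_has_delta_derivative\<close>, \<open>trajectory_of_delta_solution\<close>), and it makes the Volterra theory applicable without translation.
\<close>

definition trajectory :: "(real \<Rightarrow> 'e) \<Rightarrow> (real \<Rightarrow> 'u) \<Rightarrow> bool" where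
  "trajectory Y v \<longleftrightarrow> continuous_on {a..b} Y \<and> rd v \<and>
    (\<forall>t\<in>{a..b}. Y t = Y a + integral {a..t} (\<lambda>s. \<Phi> (flr s) (Y (flr s), v (flr s))))"

lemma rd_along:
  assumes "continuous_on {a..b} Y" "rd v"
  shows "rd (\<lambda>t. (Y t, v t))"
  by (rule rd_Pair[OF continuous_on_imp_rd[OF continuous_on_subset[OF assms(1) T_sub]] assms(2)])

lemma rd_\<Phi>: "continuous_on {a..b} Y \<Longrightarrow> rd v \<Longrightarrow> rd (\<lambda>t. \<Phi> t (Y t, v t))"
  by (rule field_compose_rd[OF \<Phi>_field rd_along])

lemma trajectoryD:
  assumes "trajectory Y v"
  shows "continuous_on {a..b} Y" "rd v"
    "t \<in> {a..b} \<Longrightarrow> Y t = Y a + integral {a..t} (\<lambda>s. \<Phi> (flr s) (Y (flr s), v (flr s)))"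
  using assms unfolding trajectory_def by blast+

lemma trajectory_has_delta_derivative:
  assumes Y: "trajectory Y v" and t: "t \<in> T"
  shows "has_delta_derivative T Y (\<Phi> t (Y t, v t)) t"
proof -
  have "has_delta_derivative T (\<lambda>t. Y a + integral {a..t} (\<lambda>s. \<Phi> (flr s) (Y (flr s), v (flr s))))
      (\<Phi> t (Y t, v t)) t"
    by (rule has_delta_derivative_integral[OF rd_\<Phi>[OF trajectoryD(1,2)[OF Y]] t])
  moreover have "Y s = Y a + integral {a..s} (\<lambda>s. \<Phi> (flr s) (Y (flr s), v (flr s)))" if "s \<in> T" for s
    using in_T_bounds[OF that] by (intro trajectoryD(3)[OF Y]) simp
  ultimately show ?thesis by (rule has_delta_derivative_cong[OF t, THEN iffD2, rotated])
qed

lemma trajectory_of_delta_solution: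
  assumes y: "\<And>t. t \<in> tk T \<Longrightarrow> has_delta_derivative T y (\<Phi> t (y t, v t)) t" and v: "rd v"
  obtains Y where "trajectory Y v" "\<And>t. t \<in> T \<Longrightarrow> Y t = y t"
proof -
  have "rd (\<lambda>t. \<Phi> t (y t, v t))"
    by (intro field_compose_rd[OF \<Phi>_field] rd_Pair continuous_on_imp_rd v)
      (rule continuous_on_of_delta_derivative[OF y])
  note rd = this
  define Y where "Y t = y a + integral {a..t} (\<lambda>s. \<Phi> (flr s) (y (flr s), v (flr s)))" for t
  have Y: "Y t = y t" if "t \<in> T" for t
    unfolding Y_def using delta_antiderivative_integral[OF rd y that] by simp
  have "continuous_on {a..b} Y" unfolding Y_def
    by (intro continuous_intros indefinite_integral_continuous_1 rd_integrable[OF rd]) auto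
  moreover have "Y t = Y a + integral {a..t} (\<lambda>s. \<Phi> (flr s) (Y (flr s), v (flr s)))"
    if t: "t \<in> {a..b}" for t
  proof -
    have "integral {a..t} (\<lambda>s. \<Phi> (flr s) (Y (flr s), v (flr s)))
      = integral {a..t} (\<lambda>s. \<Phi> (flr s) (y (flr s), v (flr s)))"
      by (rule integral_cong) (use t flr_in Y in auto)
    then show ?thesis using Y[OF a_in] by (simp add: Y_def)
  qed
  ultimately show ?thesis using that[of Y] Y v unfolding trajectory_def by blast
qed

end

locale reference_trajectory = control_system T a b \<Phi> D
  for T :: "real set" and a b :: real
    and \<Phi> :: "real \<Rightarrow> 'e::euclidean_space \<times> 'u::euclidean_space \<Rightarrow> 'e" and D +
  fixes X :: "real \<Rightarrow> 'e" and u :: "real \<Rightarrow> 'u"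
  assumes reference: "trajectory X u"
begin

lemma X_continuous: "continuous_on {a..b} X" and u_rd: "rd u"
  using reference by (auto simp: trajectory_def)

definition A :: "real \<Rightarrow> ('e \<times> 'u) \<Rightarrow>\<^sub>L 'e" where
  "A t = D t (X t, u t)"

lemma rd_A: "rd A"
  unfolding A_def by (rule field_compose_rd[OF D_field rd_along[OF X_continuous u_rd]])

lemma D_near_reference:
  assumes "e > 0"
  obtains r where "r > 0" "\<And>t p. t \<in> T \<Longrightarrow> dist p (X t, u t) \<le> r \<Longrightarrow> norm (D t p - A t) \<le> e"
  using field_uniformly_continuous_along[OF D_field D_continuous rd_along[OF X_continuous u_rd] assms]
  unfolding A_def dist_norm[of "D _ _"] by metis

text \<open>
  The first-order expansion of the dynamics along the reference trajectory, with an error that is uniform in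
  time.  This is where pointwise \<open>C\<^sup>1\<close> data and rd-continuity in time combine.
\<close>

lemma uniform_linearization:
  assumes e: "e > 0"
  obtains r where "r > 0" "\<And>t p. t \<in> T \<Longrightarrow> dist p (X t, u t) \<le> r \<Longrightarrow>
    norm (\<Phi> t p - \<Phi> t (X t, u t) - A t (p - (X t, u t))) \<le> e * norm (p - (X t, u t))"
proof -
  obtain r where r: "r > 0" "\<And>t p. t \<in> T \<Longrightarrow> dist p (X t, u t) \<le> r \<Longrightarrow> norm (D t p - A t) \<le> e"
    using D_near_reference[OF e] by metis
  have "norm (\<Phi> t p - \<Phi> t (X t, u t) - A t (p - (X t, u t))) \<le> norm (p - (X t, u t)) * e"
    if t: "t \<in> T" and p: "dist p (X t, u t) \<le> r" for t p
    unfolding A_def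
  proof (rule differentiable_bound_linearization[where S = "cball (X t, u t) r"
        and f' = "\<lambda>z. blinfun_apply (D t z)"])
    show "(X t, u t) + s *\<^sub>R (p - (X t, u t)) \<in> cball (X t, u t) r" if "s \<in> {0..1}" for s
    proof -
      have "norm (s *\<^sub>R (p - (X t, u t))) \<le> 1 * norm (p - (X t, u t))"
        unfolding norm_scaleR using that by (intro mult_right_mono) auto
      then show ?thesis using p by (simp add: dist_norm)
    qed
    show "(\<Phi> t has_derivative blinfun_apply (D t z)) (at z within cball (X t, u t) r)" for z
      using \<Phi>_has_derivative[OF t] has_derivative_at_withinI by blast
    show "onorm (blinfun_apply (D t z) - blinfun_apply (D t (X t, u t))) \<le> e"
      if "z \<in> cball (X t, u t) r" for z
    proof -
      have "blinfun_apply (D t z) - blinfun_apply (D t (X t, u t)) = blinfun_apply (D t z - A t)"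
        by (simp add: fun_eq_iff blinfun.diff_left A_def)
      then show ?thesis using r(2)[OF t, of z] that by (simp add: norm_blinfun.rep_eq dist_commute)
    qed
    show "(X t, u t) \<in> cball (X t, u t) r" using r(1) by simp
  qed
  then show ?thesis using that[of r] r(1) by (simp add: mult.commute)
qed

lemma Lipschitz_tube:
  obtains \<rho> K where "\<rho> > 0" "K \<ge> 1"
    "\<And>t p q. t \<in> T \<Longrightarrow> dist p (X t, u t) \<le> \<rho> \<Longrightarrow> dist q (X t, u t) \<le> \<rho> \<Longrightarrow>
      norm (\<Phi> t p - \<Phi> t q) \<le> K * norm (p - q)"
    "\<And>t. t \<in> T \<Longrightarrow> norm (A t) \<le> K"
proof -
  obtain r where r: "r > 0" "\<And>t p. t \<in> T \<Longrightarrow> dist p (X t, u t) \<le> r \<Longrightarrow> norm (D t p - A t) \<le> 1"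
    using D_near_reference[of 1] by (metis zero_less_one)
  obtain M where M: "M > 0" "\<And>t. t \<in> T \<Longrightarrow> norm (A t) \<le> M" using rd_bounded[OF rd_A] by metis
  have "norm (\<Phi> t p - \<Phi> t q) \<le> (M + 1) * norm (p - q)"
    if t: "t \<in> T" and pq: "dist p (X t, u t) \<le> r" "dist q (X t, u t) \<le> r" for t p q
  proof (rule differentiable_bound[of "cball (X t, u t) r"])
    show "(\<Phi> t has_derivative blinfun_apply (D t z)) (at z within cball (X t, u t) r)" for z
      using \<Phi>_has_derivative[OF t] has_derivative_at_withinI by blast
    show "onorm (blinfun_apply (D t z)) \<le> M + 1" if "z \<in> cball (X t, u t) r" for z
      using r(2)[OF t, of z] M(2)[OF t] that norm_triangle_sub[of "D t z" "A t"]
      by (simp add: norm_blinfun.rep_eq[symmetric] dist_commute)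
  qed (use pq in \<open>auto simp: dist_commute\<close>)
  moreover have "norm (A t) \<le> M + 1" if "t \<in> T" for t using M(2)[OF that] by simp
  ultimately show ?thesis using that[of r "M + 1"] r(1) M(1) by auto
qed

text \<open>
  The variational equation along the reference trajectory, \<open>\<eta>\<close> being the variation of the state and \<open>v\<close> that of the
  control.
\<close>

definition linear_trajectory :: "(real \<Rightarrow> 'e) \<Rightarrow> (real \<Rightarrow> 'u) \<Rightarrow> bool" where
  "linear_trajectory \<eta> v \<longleftrightarrow> continuous_on {a..b} \<eta> \<and> rd v \<and>
    (\<forall>t\<in>{a..b}. \<eta> t = \<eta> a + integral {a..t} (\<lambda>s. A (flr s) (\<eta> (flr s), v (flr s))))"

lemma rd_A_along: "continuous_on {a..b} \<eta> \<Longrightarrow> rd v \<Longrightarrow> rd (\<lambda>t. A t (\<eta> t, v t))"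
  by (rule rd_compose2[of blinfun_apply, OF _ rd_A rd_along]) (intro continuous_intros)

lemma linear_trajectoryD:
  assumes "linear_trajectory \<eta> v"
  shows "continuous_on {a..b} \<eta>" "rd v"
    "t \<in> {a..b} \<Longrightarrow> \<eta> t = \<eta> a + integral {a..t} (\<lambda>s. A (flr s) (\<eta> (flr s), v (flr s)))"
  using assms unfolding linear_trajectory_def by blast+

lemma linear_trajectory_zero: "linear_trajectory (\<lambda>t. 0) (\<lambda>t. 0)"
  by (simp add: linear_trajectory_def rd_const zero_prod_def[symmetric])

lemma linear_trajectory_add:
  assumes "linear_trajectory \<eta> v" "linear_trajectory \<zeta> w"
  shows "linear_trajectory (\<lambda>t. \<eta> t + \<zeta> t) (\<lambda>t. v t + w t)"
  unfolding linear_trajectory_def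
proof (intro conjI ballI)
  fix t assume t: "t \<in> {a..b}"
  have "integral {a..t} (\<lambda>s. A (flr s) (\<eta> (flr s) + \<zeta> (flr s), v (flr s) + w (flr s)))
    = integral {a..t} (\<lambda>s. A (flr s) (\<eta> (flr s), v (flr s)) + A (flr s) (\<zeta> (flr s), w (flr s)))"
    by (simp only: blinfun.add_right[symmetric] plus_prod_def fst_conv snd_conv)
  also have "\<dots> = integral {a..t} (\<lambda>s. A (flr s) (\<eta> (flr s), v (flr s)))
      + integral {a..t} (\<lambda>s. A (flr s) (\<zeta> (flr s), w (flr s)))"
    using assms t by (intro integral_add rd_integrable[OF rd_A_along]) (auto dest: linear_trajectoryD(1,2))
  finally show "\<eta> t + \<zeta> t = \<eta> a + \<zeta> a
      + integral {a..t} (\<lambda>s. A (flr s) (\<eta> (flr s) + \<zeta> (flr s), v (flr s) + w (flr s)))"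
    using linear_trajectoryD(3)[OF assms(1) t] linear_trajectoryD(3)[OF assms(2) t]
    by (simp add: algebra_simps)
qed (intro continuous_intros rd_add linear_trajectoryD[OF assms(1)] linear_trajectoryD[OF assms(2)])+

lemma linear_trajectory_scaleR:
  assumes "linear_trajectory \<eta> v"
  shows "linear_trajectory (\<lambda>t. c *\<^sub>R \<eta> t) (\<lambda>t. c *\<^sub>R v t)"
  unfolding linear_trajectory_def
proof (intro conjI ballI)
  fix t assume t: "t \<in> {a..b}"
  have "integral {a..t} (\<lambda>s. A (flr s) (c *\<^sub>R \<eta> (flr s), c *\<^sub>R v (flr s)))
    = c *\<^sub>R integral {a..t} (\<lambda>s. A (flr s) (\<eta> (flr s), v (flr s)))"
    by (simp only: blinfun.scaleR_right[symmetric] scaleR_prod_def fst_conv snd_conv integral_cmul[symmetric])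
  then show "c *\<^sub>R \<eta> t = c *\<^sub>R \<eta> a + integral {a..t} (\<lambda>s. A (flr s) (c *\<^sub>R \<eta> (flr s), c *\<^sub>R v (flr s)))"
    using linear_trajectoryD(3)[OF assms t] by (simp add: scaleR_add_right)
qed (intro continuous_intros rd_scaleR linear_trajectoryD[OF assms])+

lemma linear_trajectory_sum:
  assumes "\<And>i. i \<in> I \<Longrightarrow> linear_trajectory (\<eta> i) (v i)"
  shows "linear_trajectory (\<lambda>t. \<Sum>i\<in>I. \<eta> i t) (\<lambda>t. \<Sum>i\<in>I. v i t)"
  using assms
  by (induction I rule: infinite_finite_induct) (auto intro: linear_trajectory_add linear_trajectory_zero)

lemma linear_trajectory_exists:
  assumes v: "rd v"
  obtains \<eta> where "linear_trajectory \<eta> v" "\<eta> a = \<eta>0"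
proof -
  obtain M where M: "M > 0" "\<And>t. t \<in> T \<Longrightarrow> norm (A t) \<le> M" using rd_bounded[OF rd_A] by metis
  obtain \<eta> where \<eta>: "continuous_on {a..b} \<eta>"
    "\<And>t. t \<in> {a..b} \<Longrightarrow> \<eta> t = \<eta>0 + integral {a..t} (\<lambda>s. A (flr s) (\<eta> (flr s), v (flr s)))"
  proof (rule initial_value_problem[of M "\<lambda>t p. A t (p, v t)" \<eta>0])
    show "norm (A t (p, v t) - A t (q, v t)) \<le> M * norm (p - q)" if t: "t \<in> T" for t p q
    proof -
      have "A t (p, v t) - A t (q, v t) = A t (p - q, 0)"
        by (simp add: blinfun.diff_right[symmetric])
      then show ?thesis using norm_blinfun[of "A t" "(p - q, 0)"] M(2)[OF t]
        mult_right_mono[of "norm (A t)" M "norm (p - q)"] by (simp add: norm_Pair)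
    qed
    show "rd (\<lambda>t. A t (z t, v t))" if "continuous_on {a..b} z" for z
      by (rule rd_A_along[OF that v])
  qed (use M that in auto)
  have "\<eta> a = \<eta>0" using \<eta>(2)[of a] a_less_b by simp
  then show ?thesis using that[of \<eta>] \<eta> v unfolding linear_trajectory_def by blast
qed

end

locale trajectory_tube = reference_trajectory T a b \<Phi> D X u
  for T :: "real set" and a b :: real
    and \<Phi> :: "real \<Rightarrow> 'e::euclidean_space \<times> 'u::euclidean_space \<Rightarrow> 'e" and D X u +
  fixes \<rho> K :: real
  assumes \<rho>: "\<rho> > 0" and K: "K \<ge> 1"
    and Lipschitz: "t \<in> T \<Longrightarrow> dist p (X t, u t) \<le> \<rho> \<Longrightarrow> dist q (X t, u t) \<le> \<rho> \<Longrightarrow>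
      norm (\<Phi> t p - \<Phi> t q) \<le> K * norm (p - q)"
    and A_bound: "t \<in> T \<Longrightarrow> norm (A t) \<le> K"
begin

definition stability_const :: real where
  "stability_const = gronwall_const K * K"

lemma stability_const_ge_1: "stability_const \<ge> 1"
proof -
  have "1 * 1 \<le> gronwall_const K * K"
    using gronwall_const_ge_1[of K] K by (intro mult_mono) auto
  then show ?thesis by (simp add: stability_const_def)
qed

lemma dist_Pair_le: "norm (p - p') \<le> c \<Longrightarrow> norm (q - q') \<le> d \<Longrightarrow> dist (p, q) (p', q') \<le> c + d"
  using norm_Pair_le[of "p - p'" "q - q'"] by (simp add: dist_norm)

lemma perturbed_trajectories_close:
  assumes Y: "trajectory Y v" "\<And>t. t \<in> T \<Longrightarrow> dist (Y t, v t) (X t, u t) \<le> \<rho>"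
    and Z: "trajectory Z w" "\<And>t. t \<in> T \<Longrightarrow> dist (Z t, w t) (X t, u t) \<le> \<rho>"
    and m: "norm (Y a - Z a) \<le> m" "\<And>t. t \<in> T \<Longrightarrow> norm (v t - w t) \<le> m" and t: "t \<in> {a..b}"
  shows "norm (Y t - Z t) \<le> stability_const * m"
proof -
  note Y1 = trajectoryD[OF Y(1)] and Z1 = trajectoryD[OF Z(1)]
  define g where "g t = \<Phi> t (Y t, v t) - \<Phi> t (Z t, w t)" for t
  have rd_YZ: "rd (\<lambda>t. \<Phi> t (Y t, v t))" "rd (\<lambda>t. \<Phi> t (Z t, w t))"
    using Y1(1,2) Z1(1,2) by (auto intro: rd_\<Phi>)
  have m0: "m \<ge> 0" using m(1) norm_ge_zero order_trans by blast
  have "norm ((\<lambda>t. Y t - Z t) t) \<le> gronwall_const K * (K * m)"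
  proof (rule gronwall[of K _ g "Y a - Z a"])
    show "continuous_on {a..b} (\<lambda>t. Y t - Z t)" using Y1(1) Z1(1) by (intro continuous_intros)
    show "rd g" unfolding g_def using rd_YZ by (rule rd_compose2[rotated]) (intro continuous_intros)
    show "Y t - Z t = Y a - Z a + integral {a..t} (\<lambda>s. g (flr s))" if "t \<in> {a..b}" for t
    proof -
      have "Y t - Z t = Y a - Z a + (integral {a..t} (\<lambda>s. \<Phi> (flr s) (Y (flr s), v (flr s)))
          - integral {a..t} (\<lambda>s. \<Phi> (flr s) (Z (flr s), w (flr s))))"
        using Y1(3)[OF that] Z1(3)[OF that] by simp
      then show ?thesis unfolding g_def using rd_integral_diff[OF rd_YZ that] by simp
    qed
    have "1 * m \<le> K * m" using K m0 by (rule mult_right_mono)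
    then show "norm (Y a - Z a) \<le> K * m" using m(1) by simp
    show "norm (g t) \<le> K * m + K * norm (Y t - Z t)" if t: "t \<in> T" for t
    proof -
      have "norm (g t) \<le> K * norm ((Y t, v t) - (Z t, w t))"
        unfolding g_def using t Y(2) Z(2) by (intro Lipschitz) auto
      also have "\<dots> \<le> K * (norm (Y t - Z t) + m)"
        using K norm_Pair_le[of "Y t - Z t" "v t - w t"] m(2)[OF t] by (intro mult_left_mono) auto
      finally show ?thesis by (simp add: algebra_simps)
    qed
  qed (use K t in auto)
  then show ?thesis by (simp add: stability_const_def mult.assoc)
qed

text \<open>
  The dynamics are Lipschitz only in a tube of radius \<open>\<rho>\<close> around the reference trajectory.  Composed with the nearest-point
  projection \<open>P\<close> of the state deviation to a ball they become globally Lipschitz, so that a solution exists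
  on the whole interval; Gronwall's estimate shows that its deviation stays in the ball, where \<open>P\<close>
  is the identity, so it solves the original equation.
\<close>

lemma perturbed_trajectory_exists:
  assumes v: "rd v" and m: "norm \<eta>0 \<le> m" "\<And>t. t \<in> T \<Longrightarrow> norm (v t) \<le> m" and small: "stability_const * m \<le> \<rho> / 2"
  obtains Y where "trajectory Y (\<lambda>t. u t + v t)" "Y a = X a + \<eta>0"
    "\<And>t. t \<in> {a..b} \<Longrightarrow> norm (Y t - X t) \<le> stability_const * m"
proof -
  have m0: "m \<ge> 0" using m(1) norm_ge_zero order_trans by blast
  have "1 * m \<le> stability_const * m" using stability_const_ge_1 m0 by (rule mult_right_mono)
  then have m\<rho>: "m \<le> \<rho> / 2" using small by simp
  define P :: "'e \<Rightarrow> 'e" where "P = closest_point (cball 0 (\<rho> / 2))"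
  have ball: "convex (cball 0 (\<rho> / 2) :: 'e set)" "closed (cball 0 (\<rho> / 2) :: 'e set)"
    "cball 0 (\<rho> / 2) \<noteq> ({} :: 'e set)" using \<rho> by auto
  have P_lip: "norm (P p - P q) \<le> norm (p - q)" for p q
    using closest_point_lipschitz[OF ball] unfolding P_def dist_norm .
  have P_id: "P p = p" if "norm p \<le> \<rho> / 2" for p
    unfolding P_def using that by (intro closest_point_self) simp
  have P_le: "norm (P p) \<le> norm p" for p
    using P_lip[of p 0] P_id[of 0] \<rho> by simp
  have P_ball: "norm (P p) \<le> \<rho> / 2" for p
    using closest_point_in_set[OF ball(2,3), of p] by (simp add: P_def)
  have P_cont: "continuous_on UNIV P"
    unfolding P_def using ball by (intro continuous_on_closest_point)
  define g where "g t p = \<Phi> t (X t + P (p - X t), u t + v t)" for t p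
  have in_tube: "dist (X t + P (p - X t), u t + v t) (X t, u t) \<le> \<rho>" if "t \<in> T" for t p
    using dist_Pair_le[of "X t + P (p - X t)" "X t" "\<rho> / 2" "u t + v t" "u t" "\<rho> / 2"]
      P_ball m(2)[OF that] m\<rho> by simp
  have rd_uv: "rd (\<lambda>t. u t + v t)" by (rule rd_add[OF u_rd v])
  obtain Y where Y: "continuous_on {a..b} Y"
    "\<And>t. t \<in> {a..b} \<Longrightarrow> Y t = X a + \<eta>0 + integral {a..t} (\<lambda>s. g (flr s) (Y (flr s)))"
  proof (rule initial_value_problem[of K g "X a + \<eta>0"])
    show "rd (\<lambda>t. g t (z t))" if "continuous_on {a..b} z" for z
      unfolding g_def using that X_continuous
      by (intro rd_\<Phi> rd_uv continuous_intros continuous_on_compose2[OF P_cont]) auto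
    show "norm (g t p - g t q) \<le> K * norm (p - q)" if t: "t \<in> T" for t p q
    proof -
      have "norm (g t p - g t q)
        \<le> K * norm ((X t + P (p - X t), u t + v t) - (X t + P (q - X t), u t + v t))"
        unfolding g_def using t in_tube by (intro Lipschitz) auto
      also have "\<dots> \<le> K * norm (p - q)"
        using K P_lip[of "p - X t" "q - X t"] by (intro mult_left_mono) (auto simp: norm_Pair)
      finally show ?thesis .
    qed
  qed (use K that in auto)
  have rd_gY: "rd (\<lambda>t. g t (Y t))"
    unfolding g_def using Y(1) X_continuous
    by (intro rd_\<Phi> rd_uv continuous_intros continuous_on_compose2[OF P_cont]) auto
  have Ya: "Y a = X a + \<eta>0" using Y(2)[of a] a_less_b by simp
  have close: "norm (Y t - X t) \<le> stability_const * m" if t: "t \<in> {a..b}" for t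
  proof -
    define h where "h t = g t (Y t) - \<Phi> t (X t, u t)" for t
    have "norm ((\<lambda>t. Y t - X t) t) \<le> gronwall_const K * (K * m)"
    proof (rule gronwall[of K _ h \<eta>0])
      show "continuous_on {a..b} (\<lambda>t. Y t - X t)" using Y(1) X_continuous by (intro continuous_intros)
      show "rd h" unfolding h_def using rd_gY rd_\<Phi>[OF X_continuous u_rd]
        by (rule rd_compose2[rotated]) (intro continuous_intros)
      show "Y t - X t = \<eta>0 + integral {a..t} (\<lambda>s. h (flr s))" if t: "t \<in> {a..b}" for t
      proof -
        have "X t = X a + integral {a..t} (\<lambda>s. \<Phi> (flr s) (X (flr s), u (flr s)))"
          by (rule trajectoryD(3)[OF reference t])
        then have "Y t - X t = \<eta>0 + (integral {a..t} (\<lambda>s. g (flr s) (Y (flr s)))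
            - integral {a..t} (\<lambda>s. \<Phi> (flr s) (X (flr s), u (flr s))))"
          using Y(2)[OF t] by simp
        then show ?thesis unfolding h_def using rd_integral_diff[OF rd_gY rd_\<Phi>[OF X_continuous u_rd] t] by simp
      qed
      have "1 * m \<le> K * m" using K m0 by (rule mult_right_mono)
      then show "norm \<eta>0 \<le> K * m" using m(1) by simp
      show "norm (h t) \<le> K * m + K * norm (Y t - X t)" if t: "t \<in> T" for t
      proof -
        have "norm (h t) \<le> K * norm ((X t + P (Y t - X t), u t + v t) - (X t, u t))"
          unfolding h_def g_def using t in_tube \<rho> by (intro Lipschitz) auto
        also have "\<dots> \<le> K * (norm (Y t - X t) + m)"
          using K norm_Pair_le[of "P (Y t - X t)" "v t"] m(2)[OF t] P_le[of "Y t - X t"]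
          by (intro mult_left_mono) auto
        finally show ?thesis by (simp add: algebra_simps)
      qed
    qed (use K t in auto)
    then show ?thesis by (simp add: stability_const_def mult.assoc)
  qed
  have "g (flr s) (Y (flr s)) = \<Phi> (flr s) (Y (flr s), u (flr s) + v (flr s))" if "s \<in> {a..b}" for s
    using close[of "flr s"] flr_in[OF that] small P_id[of "Y (flr s) - X (flr s)"] by (simp add: g_def)
  then have eq: "integral {a..t} (\<lambda>s. g (flr s) (Y (flr s)))
      = integral {a..t} (\<lambda>s. \<Phi> (flr s) (Y (flr s), u (flr s) + v (flr s)))" if "t \<in> {a..b}" for t
    using that by (intro integral_cong) auto
  have "trajectory Y (\<lambda>t. u t + v t)"
    unfolding trajectory_def
  proof (intro conjI ballI)
    fix t assume t: "t \<in> {a..b}"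
    show "Y t = Y a + integral {a..t} (\<lambda>s. \<Phi> (flr s) (Y (flr s), u (flr s) + v (flr s)))"
      using Y(2)[OF t] eq[OF t] Ya by simp
  qed (use Y(1) rd_uv in auto)
  then show ?thesis using that Ya close by blast
qed

text \<open>
  The defect \<open>Y - X - \<eta>\<close> solves the variational equation up to the linearisation error, and Gronwall's
  estimate transfers the order of that error to the defect.
\<close>

lemma perturbation_first_order:
  assumes e: "e > 0"
  shows "\<exists>r>0. \<forall>Y \<eta> v m. trajectory Y (\<lambda>t. u t + v t) \<and> linear_trajectory \<eta> v \<and> Y a = X a + \<eta> a \<and>
      (\<forall>t\<in>T. norm (v t) \<le> m \<and> norm (Y t - X t) \<le> stability_const * m) \<and> 0 \<le> m \<and> m \<le> r \<longrightarrow>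
      (\<forall>t\<in>{a..b}. norm (Y t - X t - \<eta> t) \<le> e * m)"
proof -
  define e' where "e' = e / (gronwall_const K * (stability_const + 1))"
  have pos: "gronwall_const K > 0" "stability_const + 1 > 0" using gronwall_const_ge_1[of K] K stability_const_ge_1 by auto
  then have e': "e' > 0" using e by (simp add: e'_def)
  obtain r where r: "r > 0" "\<And>t p. t \<in> T \<Longrightarrow> dist p (X t, u t) \<le> r \<Longrightarrow>
    norm (\<Phi> t p - \<Phi> t (X t, u t) - A t (p - (X t, u t))) \<le> e' * norm (p - (X t, u t))"
    using uniform_linearization[OF e'] by metis
  have "norm (Y t - X t - \<eta> t) \<le> e * m"
    if Y: "trajectory Y (\<lambda>t. u t + v t)" and \<eta>: "linear_trajectory \<eta> v" and Ya: "Y a = X a + \<eta> a"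
      and v: "\<And>t. t \<in> T \<Longrightarrow> norm (v t) \<le> m" and close: "\<And>t. t \<in> T \<Longrightarrow> norm (Y t - X t) \<le> stability_const * m"
      and m: "m \<ge> 0" "m \<le> r / (stability_const + 1)" and t: "t \<in> {a..b}" for Y \<eta> v m t
  proof -
    note Y1 = trajectoryD[OF Y] and \<eta>1 = linear_trajectoryD[OF \<eta>]
    define g where "g t = \<Phi> t (Y t, u t + v t) - \<Phi> t (X t, u t) - A t (\<eta> t, v t)" for t
    have rds: "rd (\<lambda>t. \<Phi> t (Y t, u t + v t))" "rd (\<lambda>t. \<Phi> t (X t, u t))" "rd (\<lambda>t. A t (\<eta> t, v t))"
      using Y1(1,2) \<eta>1(1,2) X_continuous u_rd by (auto intro: rd_\<Phi> rd_A_along)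
    have rd_diff: "rd (\<lambda>t. \<Phi> t (Y t, u t + v t) - \<Phi> t (X t, u t))"
      using rds(1,2) by (rule rd_compose2[rotated]) (intro continuous_intros)
    have "norm ((\<lambda>t. Y t - X t - \<eta> t) t) \<le> gronwall_const K * (e' * ((stability_const + 1) * m))"
    proof (rule gronwall[of K _ g 0])
      show "continuous_on {a..b} (\<lambda>t. Y t - X t - \<eta> t)"
        using Y1(1) X_continuous \<eta>1(1) by (intro continuous_intros)
      show "rd g" unfolding g_def using rd_diff rds(3)
        by (rule rd_compose2[rotated]) (intro continuous_intros)
      show "Y t - X t - \<eta> t = 0 + integral {a..t} (\<lambda>s. g (flr s))" if t: "t \<in> {a..b}" for t
      proof -
        have "Y t = Y a + integral {a..t} (\<lambda>s. \<Phi> (flr s) (Y (flr s), u (flr s) + v (flr s)))"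
          "X t = X a + integral {a..t} (\<lambda>s. \<Phi> (flr s) (X (flr s), u (flr s)))"
          "\<eta> t = \<eta> a + integral {a..t} (\<lambda>s. A (flr s) (\<eta> (flr s), v (flr s)))"
          using Y1(3)[OF t] trajectoryD(3)[OF reference t] \<eta>1(3)[OF t] .
        then show ?thesis unfolding g_def
          using rd_integral_diff[OF rds(1,2) t] rd_integral_diff[OF rd_diff rds(3) t] Ya by simp
      qed
      show "norm (0::'e) \<le> e' * ((stability_const + 1) * m)" using e' pos m by simp
      show "norm (g t) \<le> e' * ((stability_const + 1) * m) + K * norm (Y t - X t - \<eta> t)" if t: "t \<in> T" for t
      proof -
        let ?p = "(Y t, u t + v t)" and ?x = "(X t, u t)"
        have d: "norm (?p - ?x) \<le> (stability_const + 1) * m"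
          using dist_Pair_le[of "Y t" "X t" "stability_const * m" "u t + v t" "u t" m] close[OF t] v[OF t]
          by (simp add: dist_norm algebra_simps)
        moreover have "(stability_const + 1) * m \<le> r" using m pos by (simp add: field_simps)
        ultimately have "norm (\<Phi> t ?p - \<Phi> t ?x - A t (?p - ?x)) \<le> e' * norm (?p - ?x)"
          by (intro r(2)[OF t]) (simp add: dist_norm)
        also have "\<dots> \<le> e' * ((stability_const + 1) * m)" using d e' by (intro mult_left_mono) auto
        finally have 1: "norm (\<Phi> t ?p - \<Phi> t ?x - A t (?p - ?x)) \<le> e' * ((stability_const + 1) * m)" .
        have "norm (A t (Y t - X t - \<eta> t, 0)) \<le> norm (A t) * norm (Y t - X t - \<eta> t, 0 :: 'u)"
          by (rule norm_blinfun)
        also have "\<dots> \<le> K * norm (Y t - X t - \<eta> t)"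
          using A_bound[OF t] by (simp add: norm_Pair mult_right_mono)
        finally have 2: "norm (A t (Y t - X t - \<eta> t, 0)) \<le> K * norm (Y t - X t - \<eta> t)" .
        have "g t = (\<Phi> t ?p - \<Phi> t ?x - A t (?p - ?x)) + A t (Y t - X t - \<eta> t, 0)"
        proof -
          have "(Y t - X t - \<eta> t, 0 :: 'u) = (?p - ?x) - (\<eta> t, v t)" by simp
          then have "A t (Y t - X t - \<eta> t, 0) = A t (?p - ?x) - A t (\<eta> t, v t)"
            by (simp only: blinfun.diff_right)
          then show ?thesis by (simp add: g_def)
        qed
        then show ?thesis
          using norm_triangle_mono[OF 1 2] by simp
      qed
    qed (use K t in auto)
    also have "gronwall_const K * (e' * ((stability_const + 1) * m)) = e * m"
      using pos by (simp add: e'_def)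
    finally show ?thesis .
  qed
  moreover have "r / (stability_const + 1) > 0" using r(1) pos by simp
  ultimately show ?thesis by (intro exI[of _ "r / (stability_const + 1)"]) blast
qed

end

section \<open>The adjoint equation\<close>

text \<open>
  The transpose with respect to the inner products, written out in a basis: in this form it is visibly continuous in \<open>B\<close> and
  \<open>p\<close> jointly, hence rd-continuous along rd-continuous arguments.
\<close>

definition blinfun_adjoint :: "('x::euclidean_space \<Rightarrow>\<^sub>L 'y::real_inner) \<Rightarrow> 'y \<Rightarrow> 'x" where
  "blinfun_adjoint B p = (\<Sum>i\<in>Basis. (B i \<bullet> p) *\<^sub>R i)"

lemma inner_blinfun_adjoint: "h \<bullet> blinfun_adjoint B p = B h \<bullet> p"
proof -
  have "B h \<bullet> p = B (\<Sum>i\<in>Basis. (h \<bullet> i) *\<^sub>R i) \<bullet> p" by (simp add: euclidean_representation)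
  also have "\<dots> = (\<Sum>i\<in>Basis. (h \<bullet> i) * (B i \<bullet> p))"
    by (simp add: blinfun.sum_right blinfun.scaleR_right inner_sum_left)
  finally show ?thesis by (simp add: blinfun_adjoint_def inner_sum_right mult.commute)
qed

lemma blinfun_adjoint_diff: "blinfun_adjoint B (p - q) = blinfun_adjoint B p - blinfun_adjoint B q"
  by (simp add: blinfun_adjoint_def inner_diff_right scaleR_diff_left sum_subtractf)

lemma norm_blinfun_adjoint_le: "norm (blinfun_adjoint B p) \<le> norm B * norm p"
proof -
  let ?z = "blinfun_adjoint B p"
  have "norm ?z * norm ?z = B ?z \<bullet> p"
    by (simp add: inner_blinfun_adjoint[symmetric] dot_square_norm power2_eq_square)
  also have "\<dots> \<le> norm (B ?z) * norm p" by (rule norm_cauchy_schwarz)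
  also have "\<dots> \<le> (norm B * norm ?z) * norm p" by (intro mult_right_mono norm_blinfun) simp
  finally have "norm ?z * norm ?z \<le> norm ?z * (norm B * norm p)" by (simp add: mult_ac)
  then show ?thesis by (cases "?z = 0") (auto dest: mult_left_le_imp_le)
qed

lemma continuous_blinfun_adjoint: "continuous_on UNIV (\<lambda>p. blinfun_adjoint (fst p) (snd p))"
  unfolding blinfun_adjoint_def by (intro continuous_intros)

context reference_trajectory
begin

text \<open>
  In integrated form the right-hand side at time \<open>s\<close> contains \<open>\<Psi>\<close> at the time \<open>\<sigma>(flr s) \<ge> s\<close>, so this is a Volterra
  equation that runs backward from \<open>b\<close>.
\<close>

lemma adjoint_solution_exists:
  obtains \<Psi> where "continuous_on {a..b} \<Psi>" "\<Psi> b = p1"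
    "\<And>t. t \<in> T \<Longrightarrow>
      has_delta_derivative T \<Psi> (- fst (blinfun_adjoint (A t) (\<Psi> (fwd_jump T t)))) t"
proof -
  define g where "g z t = fst (blinfun_adjoint (A t) (z (fwd_jump T t)))" for z t
  have rd_g: "rd (g z)" if "continuous_on {a..b} z" for z
    unfolding g_def
    by (rule rd_compose2[of "\<lambda>B p. fst (blinfun_adjoint B p)", OF _ rd_A rd_fwd_jump])
      (intro continuous_intros continuous_blinfun_adjoint continuous_on_subset[OF that T_sub])+
  obtain M where M: "M > 0" "\<And>t. t \<in> T \<Longrightarrow> norm (A t) \<le> M" using rd_bounded[OF rd_A] by metis
  have "\<exists>\<Psi>. continuous_on {a..b} \<Psi> \<and> (\<forall>t\<in>{a..b}. \<Psi> t = p1 + integral {t..b} (\<lambda>s. g \<Psi> (flr s)))"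
  proof (rule volterra_exists_backward[of a b M "\<lambda>z s. g z (flr s)" p1])
    show "(\<lambda>s. g z (flr s)) integrable_on {a..b}" if "continuous_on {a..b} z" for z
      by (rule rd_integrable[OF rd_g[OF that]]) auto
    show "norm (g z (flr s) - g w (flr s)) \<le> M * N"
      if s: "s \<in> {a..b}" and zw: "\<And>r. r \<in> {s..b} \<Longrightarrow> norm (z r - w r) \<le> N" for z w s N
    proof -
      let ?r = "fwd_jump T (flr s)"
      have t: "flr s \<in> T" using flr_in[OF s] by simp
      have r: "?r \<in> {s..b}"
        using le_fwd_jump_flr[of s] in_T_bounds[OF fwd_jump_props(2)[OF t]] s by auto
      have "g z (flr s) - g w (flr s) = fst (blinfun_adjoint (A (flr s)) (z ?r - w ?r))"
        by (simp add: g_def blinfun_adjoint_diff)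
      also have "norm \<dots> \<le> norm (A (flr s)) * norm (z ?r - w ?r)"
        using norm_fst_le order_trans[OF _ norm_blinfun_adjoint_le] by (metis prod.collapse)
      also have "\<dots> \<le> M * N" using M(2)[OF t] M(1) zw[OF r] by (intro mult_mono) auto
      finally show ?thesis .
    qed
    fix y assume "continuous_on {a..b} y" "\<And>t. t \<in> {a..b} \<Longrightarrow> y t = p1 + integral {t..b} (\<lambda>s. g y (flr s))"
    then show "\<exists>\<Psi>. continuous_on {a..b} \<Psi> \<and> (\<forall>t\<in>{a..b}. \<Psi> t = p1 + integral {t..b} (\<lambda>s. g \<Psi> (flr s)))"
      by blast
  qed (use M a_less_b in auto)
  then obtain \<Psi> where \<Psi>: "continuous_on {a..b} \<Psi>"
    "\<And>t. t \<in> {a..b} \<Longrightarrow> \<Psi> t = p1 + integral {t..b} (\<lambda>s. g \<Psi> (flr s))" by blast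
  have \<Psi>_forward: "\<Psi> t = (p1 + integral {a..b} (\<lambda>s. g \<Psi> (flr s))) + integral {a..t} (\<lambda>s. - g \<Psi> (flr s))"
    if t: "t \<in> T" for t
  proof -
    have tab: "t \<in> {a..b}" using in_T_bounds[OF t] by simp
    have "integral {a..t} (\<lambda>s. g \<Psi> (flr s)) + integral {t..b} (\<lambda>s. g \<Psi> (flr s))
      = integral {a..b} (\<lambda>s. g \<Psi> (flr s))"
      using tab by (intro Henstock_Kurzweil_Integration.integral_combine rd_integrable[OF rd_g[OF \<Psi>(1)]]) auto
    then show ?thesis using \<Psi>(2)[OF tab] by (simp add: algebra_simps)
  qed
  have "has_delta_derivative T \<Psi> (- g \<Psi> t) t" if t: "t \<in> T" for t
  proof -
    have "rd (\<lambda>t. - g \<Psi> t)" by (rule rd_compose[OF _ rd_g[OF \<Psi>(1)]]) (intro continuous_intros)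
    from has_delta_derivative_integral[OF this t]
    show ?thesis
      by (rule has_delta_derivative_cong[OF t, THEN iffD2, rotated]) (rule \<Psi>_forward)
  qed
  moreover have "\<Psi> b = p1" using \<Psi>(2)[of b] a_less_b by simp
  ultimately show ?thesis using that[of \<Psi>] \<Psi>(1) unfolding g_def by blast
qed

lemma rd_adjoint_along:
  assumes "continuous_on {a..b} \<Psi>"
  shows "rd (\<lambda>t. blinfun_adjoint (A t) (\<Psi> (fwd_jump T t)))"
  by (rule rd_compose2[OF continuous_blinfun_adjoint rd_A rd_fwd_jump[OF continuous_on_subset[OF assms T_sub]]])

lemma linear_trajectory_has_delta_derivative:
  assumes \<eta>: "linear_trajectory \<eta> v" and t: "t \<in> T"
  shows "has_delta_derivative T \<eta> (A t (\<eta> t, v t)) t"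
proof -
  have "has_delta_derivative T (\<lambda>t. \<eta> a + integral {a..t} (\<lambda>s. A (flr s) (\<eta> (flr s), v (flr s))))
      (A t (\<eta> t, v t)) t"
    by (rule has_delta_derivative_integral[OF rd_A_along[OF linear_trajectoryD(1,2)[OF \<eta>]] t])
  moreover have "\<eta> s = \<eta> a + integral {a..s} (\<lambda>s. A (flr s) (\<eta> (flr s), v (flr s)))" if "s \<in> T" for s
    using in_T_bounds[OF that] by (intro linear_trajectoryD(3)[OF \<eta>]) simp
  ultimately show ?thesis by (rule has_delta_derivative_cong[OF t, THEN iffD2, rotated])
qed

text \<open>
  In the product rule for \<open>\<Psi> \<bullet> \<eta>\<close> the terms with \<open>\<eta>\<close> cancel by the choice of the adjoint equation,
  and the control part of \<open>\<Gamma>\<close> remains.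
\<close>

lemma adjoint_duality:
  assumes \<Psi>: "continuous_on {a..b} \<Psi>" "\<And>t. t \<in> T \<Longrightarrow>
      has_delta_derivative T \<Psi> (- fst (blinfun_adjoint (A t) (\<Psi> (fwd_jump T t)))) t"
    and \<eta>: "linear_trajectory \<eta> v" and t: "t \<in> T"
  defines "\<Gamma> \<equiv> \<lambda>t. blinfun_adjoint (A t) (\<Psi> (fwd_jump T t))"
  shows "\<Psi> t \<bullet> \<eta> t = \<Psi> a \<bullet> \<eta> a + integral {a..t} (\<lambda>s. snd (\<Gamma> (flr s)) \<bullet> v (flr s))"
proof -
  have "has_delta_derivative T (\<lambda>t. \<Psi> t \<bullet> \<eta> t) (snd (\<Gamma> t) \<bullet> v t) t" if "t \<in> tk T" for t
  proof -
    have t: "t \<in> T" by (rule tk_sub_T[OF that])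
    have "(\<eta> t, v t) \<bullet> \<Gamma> t = A t (\<eta> t, v t) \<bullet> \<Psi> (fwd_jump T t)"
      unfolding \<Gamma>_def by (rule inner_blinfun_adjoint)
    then have "- fst (\<Gamma> t) \<bullet> \<eta> t + \<Psi> (fwd_jump T t) \<bullet> A t (\<eta> t, v t) = snd (\<Gamma> t) \<bullet> v t"
      by (simp add: inner_prod_def inner_commute)
    then show ?thesis
      using has_delta_derivative_inner[OF t \<Psi>(2)[OF t] linear_trajectory_has_delta_derivative[OF \<eta> t]]
      by (simp add: \<Gamma>_def)
  qed
  moreover have "rd (\<lambda>t. snd (\<Gamma> t) \<bullet> v t)"
    unfolding \<Gamma>_def
    by (rule rd_compose2[of "\<lambda>g w. snd g \<bullet> w", OF _ rd_adjoint_along[OF \<Psi>(1)] linear_trajectoryD(2)[OF \<eta>]])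
      (intro continuous_intros)
  ultimately show ?thesis using delta_antiderivative_integral[OF _ _ t] by blast
qed

lemma integral_square_zero:
  fixes f :: "real \<Rightarrow> 'x::euclidean_space"
  assumes f: "rd f" and zero: "integral {a..b} (\<lambda>s. f (flr s) \<bullet> f (flr s)) = 0" and t: "t \<in> tk T"
  shows "f t = 0"
proof -
  define F where "F t = integral {a..t} (\<lambda>s. f (flr s) \<bullet> f (flr s))" for t
  have rd: "rd (\<lambda>t. f t \<bullet> f t)" by (rule rd_compose[OF _ f]) (intro continuous_intros)
  have F: "F t = 0" if "t \<in> T" for t
  proof -
    note b = in_T_bounds[OF that]
    have "F t + integral {t..b} (\<lambda>s. f (flr s) \<bullet> f (flr s)) = 0"
      unfolding F_def zero[symmetric] using b
      by (intro Henstock_Kurzweil_Integration.integral_combine rd_integrable[OF rd]) auto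
    moreover have "F t \<ge> 0" "integral {t..b} (\<lambda>s. f (flr s) \<bullet> f (flr s)) \<ge> 0"
      unfolding F_def using b by (auto intro!: integral_nonneg rd_integrable[OF rd])
    ultimately show ?thesis by linarith
  qed
  have "has_delta_derivative T (\<lambda>t. 0 + F t) (f t \<bullet> f t) t"
    unfolding F_def by (rule has_delta_derivative_integral[OF rd tk_sub_T[OF t]])
  moreover have "has_delta_derivative T (\<lambda>t. 0 + F t) 0 t"
    using has_delta_derivative_cong[OF tk_sub_T[OF t], of "\<lambda>t. 0 + F t" "\<lambda>t. 0"] F
      has_delta_derivative_const[of 0 t] by auto
  ultimately show ?thesis using has_delta_derivative_unique[OF t] by fastforce
qed

text \<open>
  Orthogonality of \<open>p1\<close> to all final variations becomes, by duality, a statement about the initial value and the control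
  separately: the control variation \<open>0\<close> gives the condition on \<open>\<Psi> a\<close>, and the initial variation \<open>0\<close> together with the control
  variation \<open>snd \<Gamma>\<close> makes the integral of \<open>\<parallel>snd \<Gamma>\<parallel>\<^sup>2\<close> vanish.
\<close>

lemma multiplier_adjoint:
  assumes p1: "\<forall>\<eta> v. linear_trajectory \<eta> v \<and> \<eta> a \<in> N \<longrightarrow> p1 \<bullet> \<eta> b = 0" and N: "0 \<in> N"
  obtains \<Psi> where "\<Psi> b = p1" "\<And>n. n \<in> N \<Longrightarrow> \<Psi> a \<bullet> n = 0"
    "\<And>t. t \<in> tk T \<Longrightarrow>
      has_delta_derivative T \<Psi> (- fst (blinfun_adjoint (A t) (\<Psi> (fwd_jump T t)))) t"
    "\<And>t. t \<in> tk T \<Longrightarrow> snd (blinfun_adjoint (A t) (\<Psi> (fwd_jump T t))) = 0"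
proof -
  obtain \<Psi> where \<Psi>: "continuous_on {a..b} \<Psi>" "\<Psi> b = p1" "\<And>t. t \<in> T \<Longrightarrow>
      has_delta_derivative T \<Psi> (- fst (blinfun_adjoint (A t) (\<Psi> (fwd_jump T t)))) t"
    using adjoint_solution_exists[of p1] by metis
  define \<Gamma> where "\<Gamma> t = blinfun_adjoint (A t) (\<Psi> (fwd_jump T t))" for t
  have dual: "\<Psi> a \<bullet> \<eta> a + integral {a..b} (\<lambda>s. snd (\<Gamma> (flr s)) \<bullet> v (flr s)) = 0"
    if "linear_trajectory \<eta> v" "\<eta> a \<in> N" for \<eta> v
    using adjoint_duality[OF \<Psi>(1,3) that(1) b_in] p1[rule_format, OF conjI[OF that]] \<Psi>(2)
    by (simp add: \<Gamma>_def)
  have "\<Psi> a \<bullet> n = 0" if n: "n \<in> N" for n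
  proof -
    obtain \<eta> where "linear_trajectory \<eta> (\<lambda>t. 0)" "\<eta> a = n"
      using linear_trajectory_exists[OF rd_const] by metis
    then show ?thesis using dual[of \<eta> "\<lambda>t. 0"] n by simp
  qed
  moreover have "snd (\<Gamma> t) = 0" if t: "t \<in> tk T" for t
  proof (rule integral_square_zero[OF _ _ t])
    show rd: "rd (\<lambda>t. snd (\<Gamma> t))"
      unfolding \<Gamma>_def by (rule rd_compose[OF _ rd_adjoint_along[OF \<Psi>(1)]]) (intro continuous_intros)
    obtain \<eta> where "linear_trajectory \<eta> (\<lambda>t. snd (\<Gamma> t))" "\<eta> a = 0"
      using linear_trajectory_exists[OF rd] by metis
    then show "integral {a..b} (\<lambda>s. snd (\<Gamma> (flr s)) \<bullet> snd (\<Gamma> (flr s))) = 0"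
      using dual[of \<eta> "\<lambda>t. snd (\<Gamma> t)"] N by simp
  qed
  ultimately show ?thesis using that[of \<Psi>] \<Psi> tk_sub_T unfolding \<Gamma>_def by blast
qed

end

section \<open>The end-point map\<close>

context trajectory_tube
begin

text \<open>
  The map \<open>q\<close> selects the part of the final point that matters: everything if the final state is
  prescribed, the cost alone if it is free.
\<close>

definition reachable :: "('e \<Rightarrow> 'g) \<Rightarrow> 'e set \<Rightarrow> real \<Rightarrow> 'g set" where
  "reachable q N \<epsilon> = {q (Y b) | Y v. trajectory Y v \<and> Y a - X a \<in> N \<and>
    (\<forall>t\<in>T. norm (Y t - X t) \<le> \<epsilon> \<and> norm (v t - u t) \<le> \<epsilon>)}"

text \<open>
  Preimages of the basis vectors under the linearised end-point map span a finite-dimensional family of variations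
  on which the nonlinear end-point map \<open>F\<close> is Lipschitz and has the identity as its derivative at \<open>0\<close>.  By an
  open mapping theorem for maps that are differentiable at one point only, a consequence of Brouwer's
  fixed point theorem, \<open>F\<close> covers a neighbourhood of \<open>F 0\<close>.
\<close>

lemma endpoint_interior:
  fixes q :: "'e \<Rightarrow> 'g::euclidean_space"
  assumes q: "bounded_linear q" and N: "subspace N" and \<epsilon>: "\<epsilon> > 0"
    and onto: "\<And>z. \<exists>\<eta> v. linear_trajectory \<eta> v \<and> \<eta> a \<in> N \<and> q (\<eta> b) = z"
  shows "q (X b) \<in> interior (reachable q N \<epsilon>)"
proof -
  interpret q: bounded_linear q by fact
  obtain \<eta> v where \<eta>v: "\<And>i. linear_trajectory (\<eta> i) (v i)" "\<And>i. \<eta> i a \<in> N" "\<And>i. q (\<eta> i b) = i"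
    using onto by metis
  define \<eta>c where "\<eta>c c t = (\<Sum>i\<in>Basis. (c \<bullet> i) *\<^sub>R \<eta> i t)" for c :: 'g and t
  define vc where "vc c t = (\<Sum>i\<in>Basis. (c \<bullet> i) *\<^sub>R v i t)" for c :: 'g and t
  have lin: "linear_trajectory (\<eta>c c) (vc c)" for c
    unfolding \<eta>c_def vc_def by (intro linear_trajectory_sum linear_trajectory_scaleR \<eta>v)
  have \<eta>c_N: "\<eta>c c a \<in> N" for c
    unfolding \<eta>c_def using N \<eta>v(2) by (intro subspace_sum subspace_scale)
  have \<eta>c_b: "q (\<eta>c c b) = c" for c
    unfolding \<eta>c_def by (simp add: q.sum q.scale \<eta>v(3) euclidean_representation)
  have diff: "\<eta>c c t - \<eta>c c' t = \<eta>c (c - c') t" "vc c t - vc c' t = vc (c - c') t" for c c' t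
    by (simp_all add: \<eta>c_def vc_def inner_diff_left scaleR_diff_left sum_subtractf)
  have "\<exists>B>0. \<forall>t\<in>T. norm (v i t) \<le> B" for i
    using rd_bounded[OF linear_trajectoryD(2)[OF \<eta>v(1)[of i]]] by metis
  then have "\<exists>B. \<forall>i. B i > 0 \<and> (\<forall>t\<in>T. norm (v i t) \<le> B i)" by metis
  then obtain B where B: "\<And>i. B i > 0" "\<And>i t. t \<in> T \<Longrightarrow> norm (v i t) \<le> B i" by blast
  define M where "M = (\<Sum>i\<in>Basis. B i + norm (\<eta> i a)) + 1"
  have term_le: "\<bar>c \<bullet> i\<bar> * x \<le> (B i + norm (\<eta> i a)) * norm c"
    if "i \<in> Basis" "0 \<le> x" "x \<le> B i + norm (\<eta> i a)" for c :: 'g and i x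
    using mult_mono[OF Basis_le_norm[OF that(1), of c] that(3)] that(2) by (simp add: mult.commute)
  have M_le: "(\<Sum>i\<in>Basis. (B i + norm (\<eta> i a)) * norm c) \<le> M * norm c" for c :: 'g
    by (subst sum_distrib_right[symmetric]) (simp add: M_def distrib_right)
  have M: "M > 0" unfolding M_def using B(1)
    by (intro add_nonneg_pos sum_nonneg add_nonneg_nonneg) (auto intro: less_imp_le)
  have bounds: "norm (\<eta>c c a) \<le> M * norm c" "t \<in> T \<Longrightarrow> norm (vc c t) \<le> M * norm c" for c t
  proof -
    have "norm (\<eta>c c a) \<le> (\<Sum>i\<in>Basis. (B i + norm (\<eta> i a)) * norm c)"
      unfolding \<eta>c_def using less_imp_le[OF B(1)] by (intro sum_norm_le) (auto intro!: term_le)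
    then show "norm (\<eta>c c a) \<le> M * norm c" using M_le order_trans by blast
    assume t: "t \<in> T"
    have "norm (vc c t) \<le> (\<Sum>i\<in>Basis. (B i + norm (\<eta> i a)) * norm c)"
      unfolding vc_def using B(2)[OF t] by (intro sum_norm_le) (auto intro!: term_le add_increasing2)
    then show "norm (vc c t) \<le> M * norm c" using M_le order_trans by blast
  qed
  define s where "s = min (\<rho> / 2) \<epsilon> / (stability_const * M)"
  have s: "s > 0" using \<rho> \<epsilon> stability_const_ge_1 M by (simp add: s_def)
  have small: "stability_const * (M * norm c) \<le> \<rho> / 2" "stability_const * (M * norm c) \<le> \<epsilon>" "M * norm c \<le> \<rho> / 2" "M * norm c \<le> \<epsilon>"
    if "c \<in> ball 0 s" for c :: 'g
  proof -
    have "stability_const * M > 0" using stability_const_ge_1 M by simp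
    then have 1: "stability_const * (M * norm c) \<le> min (\<rho> / 2) \<epsilon>"
      using that by (simp add: s_def pos_less_divide_eq mult.commute mult.left_commute less_imp_le)
    have "1 * (M * norm c) \<le> stability_const * (M * norm c)" using stability_const_ge_1 M by (intro mult_right_mono) auto
    with 1 show "stability_const * (M * norm c) \<le> \<rho> / 2" "stability_const * (M * norm c) \<le> \<epsilon>"
      "M * norm c \<le> \<rho> / 2" "M * norm c \<le> \<epsilon>" by auto
  qed
  have "\<exists>Y. trajectory Y (\<lambda>t. u t + vc c t) \<and> Y a = X a + \<eta>c c a \<and>
      (\<forall>t\<in>{a..b}. norm (Y t - X t) \<le> stability_const * (M * norm c))" if "c \<in> ball 0 s" for c
    using perturbed_trajectory_exists[OF linear_trajectoryD(2)[OF lin] bounds small(1)[OF that]] by metis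
  then obtain Y where Y: "\<And>c. c \<in> ball 0 s \<Longrightarrow> trajectory (Y c) (\<lambda>t. u t + vc c t)"
    "\<And>c. c \<in> ball 0 s \<Longrightarrow> Y c a = X a + \<eta>c c a"
    "\<And>c t. c \<in> ball 0 s \<Longrightarrow> t \<in> {a..b} \<Longrightarrow> norm (Y c t - X t) \<le> stability_const * (M * norm c)" by metis
  have Y_T: "norm (Y c t - X t) \<le> stability_const * (M * norm c)" if "c \<in> ball 0 s" "t \<in> T" for c t
    using Y(3)[OF that(1)] in_T_bounds[OF that(2)] by simp
  have tube: "dist (Y c t, u t + vc c t) (X t, u t) \<le> \<rho>" if "c \<in> ball 0 s" "t \<in> T" for c t
    using dist_Pair_le[of "Y c t" "X t" "\<rho> / 2" "u t + vc c t" "u t" "\<rho> / 2"]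
      Y_T[OF that] small(1,3)[OF that(1)] bounds(2)[OF that(2), of c] by simp
  define F where "F c = q (Y c b)" for c
  obtain Q where Q: "Q > 0" "\<And>x. norm (q x) \<le> norm x * Q" using q.pos_bounded by blast
  have b_ab: "b \<in> {a..b}" using a_less_b by simp
  have "norm (F c - F c') \<le> (stability_const * M * Q) * norm (c - c')" if "c \<in> ball 0 s" "c' \<in> ball 0 s" for c c'
  proof -
    have "norm (Y c b - Y c' b) \<le> stability_const * (M * norm (c - c'))"
      using perturbed_trajectories_close[where m = "M * norm (c - c')", OF Y(1)[OF that(1)] tube[OF that(1)] Y(1)[OF that(2)]
          tube[OF that(2)] _ _ b_ab] bounds(1)[of "c - c'"]
        bounds(2)[of _ "c - c'"] Y(2) that
      by (simp add: diff)
    then have "norm (Y c b - Y c' b) * Q \<le> stability_const * (M * norm (c - c')) * Q"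
      using Q(1) by (intro mult_right_mono) auto
    then show ?thesis unfolding F_def q.diff[symmetric] using Q(2)[of "Y c b - Y c' b"] by (simp add: mult_ac)
  qed
  then have "(stability_const * M * Q)-lipschitz_on (ball 0 s) F"
    using stability_const_ge_1 M Q(1) by (intro lipschitz_onI) (auto simp: dist_norm)
  then have F_cont: "continuous_on (ball 0 s) F" by (rule lipschitz_on_continuous_on)
  have "Y 0 b = X b" using Y(3)[OF _ b_ab, of 0] s by simp
  then have F0: "F 0 = q (X b)" by (simp add: F_def)
  have "(F has_derivative id) (at 0)"
    unfolding has_derivative_at_alt
  proof (intro conjI allI impI)
    fix e :: real assume e: "e > 0"
    define e' where "e' = e / (M * Q)"
    have e': "e' > 0" using e M Q by (simp add: e'_def)
    obtain r where r: "r > 0" "\<And>Y \<eta> v m. trajectory Y (\<lambda>t. u t + v t) \<and> linear_trajectory \<eta> v \<and>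
        Y a = X a + \<eta> a \<and> (\<forall>t\<in>T. norm (v t) \<le> m \<and> norm (Y t - X t) \<le> stability_const * m) \<and> 0 \<le> m \<and> m \<le> r \<Longrightarrow>
        (\<forall>t\<in>{a..b}. norm (Y t - X t - \<eta> t) \<le> e' * m)"
      using perturbation_first_order[OF e'] by blast
    have "norm (F c - F 0 - id (c - 0)) \<le> e * norm (c - 0)" if "norm (c - 0) < min s (r / M)" for c
    proof -
      have c: "c \<in> ball 0 s" "M * norm c \<le> r" using that M by (auto simp: pos_less_divide_eq mult.commute)
      have "norm (Y c b - X b - \<eta>c c b) \<le> e' * (M * norm c)"
        using M by (intro bspec[OF r(2)[of "Y c" "vc c" "\<eta>c c"] b_ab] conjI ballI Y(1,2) Y_T c lin bounds(2)) auto
      then have "norm (Y c b - X b - \<eta>c c b) * Q \<le> e' * (M * norm c) * Q"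
        using Q(1) by (intro mult_right_mono) auto
      also have "\<dots> = e * norm c" using M Q by (simp add: e'_def)
      finally have "norm (q (Y c b - X b - \<eta>c c b)) \<le> e * norm c" using Q(2) order_trans by blast
      then show ?thesis by (simp add: F0[unfolded F_def] F_def q.diff \<eta>c_b)
    qed
    moreover have "min s (r / M) > 0" using s r(1) M by simp
    ultimately show "\<exists>d>0. \<forall>y. norm (y - 0) < d \<longrightarrow> norm (F y - F 0 - id (y - 0)) \<le> e * norm (y - 0)"
      by blast
  qed (simp add: id_def)
  then have "F 0 \<in> interior (F ` ball 0 s)"
    using s by (intro sussmann_open_mapping[OF open_ball F_cont _ _ _ _ subset_refl]) (auto simp: id_def)
  moreover have "F ` ball 0 s \<subseteq> reachable q N \<epsilon>"
  proof
    fix z assume "z \<in> F ` ball 0 s"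
    then obtain c where c: "c \<in> ball 0 s" "z = q (Y c b)" by (auto simp: F_def)
    have "norm (Y c t - X t) \<le> \<epsilon>" "norm (u t + vc c t - u t) \<le> \<epsilon>" if "t \<in> T" for t
      using Y_T[OF c(1) that] bounds(2)[OF that, of c] small[OF c(1)] by auto
    moreover have "Y c a - X a \<in> N" using Y(2)[OF c(1)] \<eta>c_N by simp
    ultimately show "z \<in> reachable q N \<epsilon>"
      unfolding reachable_def using Y(1)[OF c(1)] c(2) by blast
  qed
  ultimately show ?thesis using interior_mono unfolding F0 by blast
qed

text \<open>
  The attainable linear variations form a subspace, which is proper by \<open>endpoint_interior\<close>; the multiplier is a normal
  vector of it.
\<close>

lemma boundary_endpoint_multiplier:
  fixes q :: "'e \<Rightarrow> 'g::euclidean_space"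
  assumes q: "bounded_linear q" and N: "subspace N" and \<epsilon>: "\<epsilon> > 0"
    and boundary: "q (X b) \<notin> interior (reachable q N \<epsilon>)"
  obtains l where "l \<noteq> 0" "\<And>\<eta> v. linear_trajectory \<eta> v \<Longrightarrow> \<eta> a \<in> N \<Longrightarrow> l \<bullet> q (\<eta> b) = 0"
proof -
  interpret q: bounded_linear q by fact
  define W where "W = {q (\<eta> b) | \<eta> v. linear_trajectory \<eta> v \<and> \<eta> a \<in> N}"
  have "subspace W" unfolding subspace_def
  proof (intro conjI ballI allI)
    show "0 \<in> W" unfolding W_def
      using linear_trajectory_zero N by (force simp: subspace_0 q.zero)
    fix x y assume "x \<in> W" "y \<in> W"
    then obtain \<eta> v \<zeta> w where *: "linear_trajectory \<eta> v" "\<eta> a \<in> N" "x = q (\<eta> b)"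
      "linear_trajectory \<zeta> w" "\<zeta> a \<in> N" "y = q (\<zeta> b)" unfolding W_def by blast
    then show "x + y \<in> W" unfolding W_def mem_Collect_eq
      using N linear_trajectory_add[OF *(1,4)]
      by (intro exI[of _ "\<lambda>t. \<eta> t + \<zeta> t"] exI[of _ "\<lambda>t. v t + w t"]) (simp add: q.add subspace_add)
  next
    fix c x assume "x \<in> W"
    then obtain \<eta> v where *: "linear_trajectory \<eta> v" "\<eta> a \<in> N" "x = q (\<eta> b)" unfolding W_def by blast
    then show "c *\<^sub>R x \<in> W" unfolding W_def mem_Collect_eq
      using N linear_trajectory_scaleR[OF *(1), of c]
      by (intro exI[of _ "\<lambda>t. c *\<^sub>R \<eta> t"] exI[of _ "\<lambda>t. c *\<^sub>R v t"]) (simp add: q.scale subspace_scale)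
  qed
  then have W: "span W = W" by (rule span_eq_iff[THEN iffD2])
  have "W \<noteq> UNIV"
  proof
    assume UNIV: "W = UNIV"
    have "\<exists>\<eta> v. linear_trajectory \<eta> v \<and> \<eta> a \<in> N \<and> q (\<eta> b) = z" for z
    proof -
      have "z \<in> W" using UNIV by simp
      then show ?thesis unfolding W_def by blast
    qed
    then show False using boundary endpoint_interior[OF q N \<epsilon>] by blast
  qed
  then have "span W \<subset> span UNIV" by (simp add: W psubset_eq)
  then obtain l where l: "l \<noteq> 0" "\<And>y. y \<in> span W \<Longrightarrow> orthogonal l y"
    using orthogonal_to_subspace_exists_gen by metis
  have "l \<bullet> q (\<eta> b) = 0" if "linear_trajectory \<eta> v" "\<eta> a \<in> N" for \<eta> v
  proof -
    have "q (\<eta> b) \<in> W" using that unfolding W_def by blast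
    then show ?thesis using l(2) W by (simp add: orthogonal_def)
  qed
  then show ?thesis using that l(1) by blast
qed

end

section \<open>The cost as an additional state\<close>

lemma C1_fun_total_deriv:
  assumes "C1_fun f"
  shows "(f has_derivative blinfun_apply (total_deriv f x)) (at x)" "continuous_on UNIV (total_deriv f)"
proof -
  obtain D where D: "\<And>x. (f has_derivative blinfun_apply (D x)) (at x)" "continuous_on UNIV D"
    using assms unfolding C1_fun_def by blast
  have "total_deriv f y = D y" for y
    unfolding total_deriv_def frechet_derivative_at[OF D(1), symmetric] by (rule blinfun_apply_inverse)
  then have "total_deriv f = D" by (rule ext)
  with D show "(f has_derivative blinfun_apply (total_deriv f x)) (at x)"
    "continuous_on UNIV (total_deriv f)" by simp_all
qed

lemma grad_eq:
  assumes "(f has_derivative (\<lambda>h. h \<bullet> g)) (at x)"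
  shows "grad f x = g"
  unfolding grad_def
proof (rule the_equality)
  show "GDERIV f x :> g" using assms by (simp add: gderiv_def)
  fix g' assume "GDERIV f x :> g'"
  then have "(\<lambda>h. h \<bullet> g') = (\<lambda>h. h \<bullet> g)"
    unfolding gderiv_def by (rule has_derivative_unique[OF _ assms])
  then have "(g' - g) \<bullet> (g' - g) = 0" by (simp add: inner_diff_right fun_eq_iff)
  then show "g' = g" by simp
qed

text \<open>
  The data do not depend on the accumulated cost, which is the first coordinate of the augmented
  state; this projection forgets it.
\<close>

definition drop_cost :: "((real \<times> 'y::real_normed_vector) \<times> 'u::real_normed_vector) \<Rightarrow>\<^sub>L ('y \<times> 'u)" where
  "drop_cost = Blinfun (\<lambda>p. (snd (fst p), snd p))"

lemma drop_cost_apply [simp]: "drop_cost p = (snd (fst p), snd p)"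
  unfolding drop_cost_def
  by (subst bounded_linear_Blinfun_apply)
    (intro bounded_linear_Pair bounded_linear_snd
      bounded_linear_compose[OF bounded_linear_snd bounded_linear_fst] refl)+

definition augmented_dynamics ::
  "(real \<Rightarrow> 'y \<Rightarrow> 'u \<Rightarrow> real) \<Rightarrow> (real \<Rightarrow> 'y \<Rightarrow> 'u \<Rightarrow> 'y) \<Rightarrow> real \<Rightarrow> (real \<times> 'y) \<times> 'u \<Rightarrow> real \<times> 'y" where
  "augmented_dynamics L \<phi> t p = (L t (snd (fst p)) (snd p), \<phi> t (snd (fst p)) (snd p))"

definition augmented_deriv ::
  "(real \<Rightarrow> 'y::real_normed_vector \<Rightarrow> 'u::real_normed_vector \<Rightarrow> real) \<Rightarrow> (real \<Rightarrow> 'y \<Rightarrow> 'u \<Rightarrow> 'y) \<Rightarrow>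
    real \<Rightarrow> (real \<times> 'y) \<times> 'u \<Rightarrow> ((real \<times> 'y) \<times> 'u) \<Rightarrow>\<^sub>L (real \<times> 'y)" where
  "augmented_deriv L \<phi> t p =
    ((Blinfun (\<lambda>r. (r, 0)) o\<^sub>L total_deriv (\<lambda>(y, u). L t y u) (drop_cost p)) +
     (Blinfun (\<lambda>y. (0, y)) o\<^sub>L total_deriv (\<lambda>(y, u). \<phi> t y u) (drop_cost p))) o\<^sub>L drop_cost"

lemma augmented_deriv_apply:
  "augmented_deriv L \<phi> t p h =
    (total_deriv (\<lambda>(y, u). L t y u) (snd (fst p), snd p) (snd (fst h), snd h),
     total_deriv (\<lambda>(y, u). \<phi> t y u) (snd (fst p), snd p) (snd (fst h), snd h))"
proof -
  have "bounded_linear (\<lambda>r::real. (r, 0 :: 'a))" "bounded_linear (\<lambda>y::'a. (0::real, y))"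
    by (intro bounded_linear_Pair bounded_linear_ident bounded_linear_zero)+
  then show ?thesis
    by (simp add: augmented_deriv_def plus_blinfun.rep_eq bounded_linear_Blinfun_apply)
qed

context time_scale_interval
begin

text \<open>
  Both the dynamics and their derivative are obtained from the data by composition with continuous linear
  maps, which preserves rd-continuity along curves.
\<close>

lemma control_system_augmented:
  fixes L :: "real \<Rightarrow> 'y::euclidean_space \<Rightarrow> 'u::euclidean_space \<Rightarrow> real"
  assumes L: "C1_data T L" and \<phi>: "C1_data T \<phi>"
  shows "control_system T a b (augmented_dynamics L \<phi>) (augmented_deriv L \<phi>)"
proof
  note rules = C1_fun_total_deriv
  fix t assume t: "t \<in> T"
  have CL: "C1_fun (\<lambda>(y, u). L t y u)" and C\<phi>: "C1_fun (\<lambda>(y, u). \<phi> t y u)"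
    using L \<phi> t unfolding C1_data_def by blast+
  show "(augmented_dynamics L \<phi> t has_derivative blinfun_apply (augmented_deriv L \<phi> t p)) (at p)" for p
  proof -
    have d: "(blinfun_apply drop_cost has_derivative blinfun_apply drop_cost) (at p)"
      by (rule bounded_linear_imp_has_derivative[OF blinfun.bounded_linear_right])
    have "((\<lambda>p. ((\<lambda>(y, u). L t y u) (drop_cost p), (\<lambda>(y, u). \<phi> t y u) (drop_cost p))) has_derivative
      (\<lambda>h. (total_deriv (\<lambda>(y, u). L t y u) (drop_cost p) (drop_cost h),
            total_deriv (\<lambda>(y, u). \<phi> t y u) (drop_cost p) (drop_cost h)))) (at p)"
      by (intro has_derivative_Pair has_derivative_compose[OF d] rules CL C\<phi>)
    then show ?thesis
      by (simp add: augmented_dynamics_def[abs_def] augmented_deriv_apply[abs_def])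
  qed
  have cont: "continuous_on UNIV (\<lambda>p. total_deriv f (blinfun_apply drop_cost p))"
    if "C1_fun f" for f :: "'y \<times> 'u \<Rightarrow> 'z::real_normed_vector"
    by (rule continuous_on_compose2[OF rules(2)[OF that]])
      (auto intro!: continuous_intros)
  show "continuous_on UNIV (augmented_deriv L \<phi> t)"
    unfolding augmented_deriv_def[abs_def]
    by (intro continuous_intros bounded_bilinear.continuous_on[OF bounded_bilinear_blinfun_compose]
        cont CL C\<phi>)
next
  have drop: "continuous_on T (\<lambda>t. blinfun_apply drop_cost (x t))"
    if "continuous_on T x" for x :: "real \<Rightarrow> (real \<times> 'y) \<times> 'u"
    using that by (intro bounded_linear.continuous_on[OF blinfun.bounded_linear_right])
  have fields: "rd_continuous_field T (\<lambda>t (y, u). L t y u)" "rd_continuous_field T (\<lambda>t (y, u). \<phi> t y u)"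
    "rd_continuous_field T (\<lambda>t. total_deriv (\<lambda>(y, u). L t y u))"
    "rd_continuous_field T (\<lambda>t. total_deriv (\<lambda>(y, u). \<phi> t y u))"
    using L \<phi> unfolding C1_data_def by blast+
  show "rd_continuous_field T (augmented_dynamics L \<phi>)"
    unfolding rd_continuous_field_def
  proof (intro allI impI)
    fix x :: "real \<Rightarrow> (real \<times> 'y) \<times> 'u" assume x: "continuous_on T x"
    show "rd (\<lambda>t. augmented_dynamics L \<phi> t (x t))"
      using rd_Pair[OF fields(1,2)[unfolded rd_continuous_field_def, rule_format, OF drop[OF x]]]
      by (simp add: augmented_dynamics_def)
  qed
  show "rd_continuous_field T (augmented_deriv L \<phi>)"
    unfolding rd_continuous_field_def
  proof (intro allI impI)
    fix x :: "real \<Rightarrow> (real \<times> 'y) \<times> 'u" assume x: "continuous_on T x"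
    show "rd (\<lambda>t. augmented_deriv L \<phi> t (x t))"
      unfolding augmented_deriv_def
      by (rule rd_compose2[of "\<lambda>M N. ((Blinfun (\<lambda>r. (r, 0)) o\<^sub>L M) + (Blinfun (\<lambda>y. (0, y)) o\<^sub>L N)) o\<^sub>L drop_cost",
            OF _ fields(3,4)[unfolded rd_continuous_field_def, rule_format, OF drop[OF x]]])
        (intro continuous_intros bounded_bilinear.continuous_on[OF bounded_bilinear_blinfun_compose])
  qed
qed

lemma sup_norm_le:
  assumes "\<And>t. t \<in> tk T \<Longrightarrow> norm (f t) \<le> c"
  shows "sup_norm T f \<le> c"
  unfolding sup_norm_def using assms a_in_tk by (intro cSUP_least) auto

end

section \<open>The weak maximum principle\<close>

theorem theorem3:
  fixes T0 T :: "real set" and a b :: real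
    and L :: "real \<Rightarrow> real^'n \<Rightarrow> real^'m \<Rightarrow> real"
    and \<phi> :: "real \<Rightarrow> real^'n \<Rightarrow> real^'m \<Rightarrow> real^'n"
    and ya yb :: "(real^'n) option"
    and ys :: "real \<Rightarrow> real^'n" and us :: "real \<Rightarrow> real^'m"
  assumes "time_scale T0" and "a < b" and "T = {a..b} \<inter> T0" and "a \<in> T" and "b \<in> T"
    and "CARD('m) \<le> CARD('n)"
    and "C1_data T L" and "C1_data T \<phi>"
    and "\<forall>u :: real \<Rightarrow> real^'m. u \<in> C_rd T \<longrightarrow> (\<exists>y \<in> C1_rd T. solves_dynamics T \<phi> y u)"
    and "weak_local_minimizer T a b L \<phi> ya yb ys us"
  shows "\<exists>(\<psi>0 :: real) (\<psi> :: real \<Rightarrow> real^'n).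
      \<psi>0 \<ge> 0 \<and>
      (\<psi>0 \<noteq> 0 \<or> (\<exists>t\<in>T. \<psi> t \<noteq> 0)) \<and>
      (\<forall>t\<in>tk T. delta_differentiable T \<psi> t) \<and>
      (\<forall>t\<in>tk T.
         delta_deriv T ys t = H_psi L \<phi> t (ys t) (us t) \<psi>0 (\<psi> (fwd_jump T t)) \<and>
         delta_deriv T \<psi> t = - H_y L \<phi> t (ys t) (us t) \<psi>0 (\<psi> (fwd_jump T t)) \<and>
         H_u L \<phi> t (ys t) (us t) \<psi>0 (\<psi> (fwd_jump T t)) = 0) \<and>
      (ya = None \<longrightarrow> \<psi> a = 0) \<and>
      (yb = None \<longrightarrow> \<psi> b = 0)"
proof -
  interpret time_scale_interval T a b
    using assms(1-5) by unfold_locales (auto simp: time_scale_def intro: closed_Int)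
  define \<Phi> where "\<Phi> = augmented_dynamics L \<phi>"
  define D where "D = augmented_deriv L \<phi>"
  interpret control_system T a b \<Phi> D
    unfolding \<Phi>_def D_def by (rule control_system_augmented[OF assms(7,8)])
  have \<Phi>_eq: "\<Phi> t (z, w) = (L t (snd z) w, \<phi> t (snd z) w)" for t z w
    by (simp add: \<Phi>_def augmented_dynamics_def)
  have admissible: "admissible T a b \<phi> ya yb ys us"
    using assms(10) unfolding weak_local_minimizer_def by blast
  obtain \<delta> where \<delta>: "\<delta> > 0" "\<And>y u. admissible T a b \<phi> ya yb y u \<Longrightarrow>
      C1_norm T (\<lambda>t. y t - ys t) + sup_norm T (\<lambda>t. u t - us t) < \<delta> \<Longrightarrow>
      cost T a b L ys us \<le> cost T a b L y u"
    using assms(10) unfolding weak_local_minimizer_def by blast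
  have us: "rd us" using admissible by (simp add: admissible_def C_rd_iff)
  have ys_delta: "has_delta_derivative T ys (\<phi> t (ys t) (us t)) t" if t: "t \<in> tk T" for t
    using admissible delta_deriv_works[OF t, of ys] t
    unfolding admissible_def C1_rd_def solves_dynamics_def by force
  have ys_cont: "continuous_on T ys" by (rule continuous_on_of_delta_derivative[OF ys_delta])
  have rd_L: "rd (\<lambda>t. L t (ys t) (us t))"
    using field_compose_rd[of "\<lambda>t (y, u). L t y u" "\<lambda>t. (ys t, us t)"] assms(7)
      rd_Pair[OF continuous_on_imp_rd[OF ys_cont] us] unfolding C1_data_def by simp
  \<comment> \<open>The minimizer with its accumulated cost as first coordinate.\<close>
  define z where "z t = (0 + integral {a..t} (\<lambda>s. L (flr s) (ys (flr s)) (us (flr s))), ys t)" for t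
  have z_delta: "has_delta_derivative T z (\<Phi> t (z t, us t)) t" if t: "t \<in> tk T" for t
    using has_delta_derivative_Pair[OF has_delta_derivative_integral[OF rd_L tk_sub_T[OF t], of 0] ys_delta[OF t]]
    unfolding z_def[abs_def] \<Phi>_eq by simp
  obtain X where X_traj: "trajectory X us" and X_eq: "\<And>t. t \<in> T \<Longrightarrow> X t = z t"
    using trajectory_of_delta_solution[OF z_delta us] by metis
  have snd_X: "snd (X t) = ys t" if "t \<in> T" for t using X_eq[OF that] by (simp add: z_def)
  interpret reference_trajectory T a b \<Phi> D X us by unfold_locales (rule X_traj)
  obtain \<rho> K where \<rho>K: "\<rho> > 0" "K \<ge> 1"
    "\<And>t p q. t \<in> T \<Longrightarrow> dist p (X t, us t) \<le> \<rho> \<Longrightarrow> dist q (X t, us t) \<le> \<rho> \<Longrightarrow>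
      norm (\<Phi> t p - \<Phi> t q) \<le> K * norm (p - q)"
    "\<And>t. t \<in> T \<Longrightarrow> norm (A t) \<le> K"
    using Lipschitz_tube by metis
  interpret trajectory_tube T a b \<Phi> D X us \<rho> K by unfold_locales (fact \<rho>K)+

  have snd_delta: "has_delta_derivative T (\<lambda>t. snd (Y t)) (\<phi> t (snd (Y t)) (v t)) t"
    if "trajectory Y v" "t \<in> T" for Y v t
    using has_delta_derivative_bounded_linear[OF bounded_linear_snd trajectory_has_delta_derivative[OF that]]
    by (simp add: \<Phi>_eq)
  have cost_eq: "cost T a b L (\<lambda>t. snd (Y t)) v = fst (Y b) - fst (Y a)" if Y: "trajectory Y v" for Y v
    unfolding cost_def
  proof (rule delta_integral_eq)
    fix t assume "t \<in> tk T"
    from has_delta_derivative_bounded_linear[OF bounded_linear_fst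
        trajectory_has_delta_derivative[OF Y tk_sub_T[OF this]]]
    show "has_delta_derivative T (\<lambda>t. fst (Y t)) (L t (snd (Y t)) (v t)) t" by (simp add: \<Phi>_eq)
  qed
  have cost_X: "cost T a b L ys us = fst (X b) - fst (X a)"
    unfolding cost_def
  proof (rule delta_integral_eq)
    fix t assume t: "t \<in> tk T"
    from has_delta_derivative_bounded_linear[OF bounded_linear_fst
        trajectory_has_delta_derivative[OF X_traj tk_sub_T[OF t]]]
    show "has_delta_derivative T (\<lambda>t. fst (X t)) (L t (ys t) (us t)) t"
      using snd_X[OF tk_sub_T[OF t]] by (simp add: \<Phi>_eq)
  qed

  \<comment> \<open>The admitted initial variations: the cost starts from \<open>0\<close>, the state may vary only if it is free at \<open>a\<close>.\<close>
  define N where "N = {n :: real \<times> (real^'n). fst n = 0 \<and> (ya \<noteq> None \<longrightarrow> snd n = 0)}"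
  have N: "subspace N" unfolding N_def subspace_def by auto
  \<comment> \<open>States and controls within \<open>\<epsilon>\<close> stay in the tube, and their distance in the norm of the problem is at
    most \<open>\<epsilon> + 2 K \<epsilon> + \<epsilon>\<close>: state, derivative and control.\<close>
  define \<epsilon> where "\<epsilon> = min (\<rho> / 2) (\<delta> / (2 * (2 + 2 * K)))"
  have \<epsilon>: "\<epsilon> > 0" "\<epsilon> \<le> \<rho> / 2"
    using \<delta>(1) \<rho> K unfolding \<epsilon>_def by (simp, intro min.cobounded1)
  have \<epsilon>_\<delta>: "(2 + 2 * K) * \<epsilon> < \<delta>"
  proof -
    have "(2 + 2 * K) * \<epsilon> \<le> (2 + 2 * K) * (\<delta> / (2 * (2 + 2 * K)))"
      using K by (intro mult_left_mono) (auto simp: \<epsilon>_def)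
    also have "\<dots> = \<delta> / 2" using K by (simp add: divide_simps)
    also have "\<dots> < \<delta>" using \<delta>(1) by simp
    finally show ?thesis .
  qed
  have norm_snd_le': "norm (snd w) \<le> norm w" for w :: "real \<times> (real^'n)"
    by (metis norm_snd_le prod.collapse)
  have no_descent: "fst (X b) \<le> fst (Y b)"
    if Y: "trajectory Y v" "Y a - X a \<in> N"
      and close: "\<And>t. t \<in> T \<Longrightarrow> norm (Y t - X t) \<le> \<epsilon>" "\<And>t. t \<in> T \<Longrightarrow> norm (v t - us t) \<le> \<epsilon>"
      and end_cond: "endpoint_condition yb (snd (Y b))" for Y v
  proof -
    let ?y = "\<lambda>t. snd (Y t)"
    have dd: "delta_deriv T ?y t = \<phi> t (?y t) (v t)" if "t \<in> tk T" for t
      using delta_deriv_eq[OF that snd_delta[OF Y(1) tk_sub_T[OF that]]] .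
    have "?y \<in> C1_rd T"
      unfolding C1_rd_def
    proof (intro CollectI conjI ballI)
      show "delta_differentiable T ?y t" if "t \<in> tk T" for t
        using snd_delta[OF Y(1) tk_sub_T[OF that]] unfolding delta_differentiable_def by blast
      have "rd (\<lambda>t. snd (\<Phi> t (Y t, v t)))"
        by (rule rd_compose[OF _ rd_\<Phi>[OF trajectoryD(1,2)[OF Y(1)]]]) (intro continuous_intros)
      then show "rd_continuous_on T (tk T) (delta_deriv T ?y)"
        by (rule rd_continuous_on_subset) (auto simp: tk_sub_T dd \<Phi>_eq)
    qed
    moreover have "endpoint_condition ya (?y a)"
    proof -
      have "endpoint_condition ya (ys a)" using admissible by (simp add: admissible_def)
      moreover have "?y a = ys a" if "ya \<noteq> None"
        using Y(2) that snd_X[OF a_in] by (simp add: N_def)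
      ultimately show ?thesis unfolding endpoint_condition_def by auto
    qed
    ultimately have adm: "admissible T a b \<phi> ya yb ?y v"
      unfolding admissible_def solves_dynamics_def
      using trajectoryD(2)[OF Y(1)] end_cond dd by (simp add: C_rd_iff)
    have y_close: "norm (?y t - ys t) \<le> \<epsilon>" if "t \<in> tk T" for t
    proof -
      have "norm (?y t - ys t) = norm (snd (Y t - X t))" using snd_X[OF tk_sub_T[OF that]] by simp
      also have "\<dots> \<le> norm (Y t - X t)" by (rule norm_snd_le')
      also have "\<dots> \<le> \<epsilon>" by (rule close(1)[OF tk_sub_T[OF that]])
      finally show ?thesis .
    qed
    have d_close: "norm (delta_deriv T (\<lambda>t. ?y t - ys t) t) \<le> K * (2 * \<epsilon>)" if t: "t \<in> tk T" for t
    proof -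
      note tT = tk_sub_T[OF t]
      have "delta_deriv T (\<lambda>t. ?y t - ys t) t = \<phi> t (?y t) (v t) - \<phi> t (ys t) (us t)"
        by (rule delta_deriv_eq[OF t has_delta_derivative_diff[OF snd_delta[OF Y(1) tT] ys_delta[OF t]]])
      also have "\<dots> = snd (\<Phi> t (Y t, v t) - \<Phi> t (X t, us t))" using snd_X[OF tT] by (simp add: \<Phi>_eq)
      also have "norm \<dots> \<le> norm (\<Phi> t (Y t, v t) - \<Phi> t (X t, us t))"
        by (rule norm_snd_le')
      also have "\<dots> \<le> K * norm ((Y t, v t) - (X t, us t))"
        using dist_Pair_le[OF close[OF tT]] \<epsilon> \<rho> by (intro Lipschitz tT) auto
      also have "\<dots> \<le> K * (2 * \<epsilon>)"
        using dist_Pair_le[OF close[OF tT]] K by (intro mult_left_mono) (auto simp: dist_norm)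
      finally show ?thesis .
    qed
    have "C1_norm T (\<lambda>t. ?y t - ys t) + sup_norm T (\<lambda>t. v t - us t) \<le> (\<epsilon> + K * (2 * \<epsilon>)) + \<epsilon>"
      unfolding C1_norm_def using y_close d_close close(2) tk_sub_T
      by (intro add_mono sup_norm_le) auto
    also have "\<dots> < \<delta>" using \<epsilon>_\<delta> by (simp add: algebra_simps)
    finally have "cost T a b L ys us \<le> cost T a b L ?y v" using \<delta>(2)[OF adm] by blast
    moreover have "fst (Y a) = fst (X a)" using Y(2) by (simp add: N_def)
    ultimately show ?thesis using cost_X cost_eq[OF Y(1)] by simp
  qed

  \<comment> \<open>An interior point can be moved a little against any direction, in particular towards lower cost.\<close>
  have lower: "\<exists>\<tau>>0. w - \<tau> *\<^sub>R d \<in> S" if "w \<in> interior S" for w d :: "'w::real_normed_vector" and S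
  proof -
    obtain e where e: "e > 0" "ball w e \<subseteq> S" using \<open>w \<in> interior S\<close> mem_interior by blast
    define \<tau> where "\<tau> = e / (norm d + 1)"
    have d: "norm d + 1 > 0" by (simp add: add_nonneg_pos)
    then have \<tau>: "\<tau> > 0" "\<tau> * (norm d + 1) = e" using e(1) by (auto simp: \<tau>_def)
    then have "norm (\<tau> *\<^sub>R d) < e" by (simp add: distrib_left)
    then have "w - \<tau> *\<^sub>R d \<in> S" using e(2) by (auto simp: dist_norm subset_iff)
    then show ?thesis using \<tau>(1) by blast
  qed

  have "\<exists>p. p \<noteq> 0 \<and> (yb = None \<longrightarrow> snd p = 0) \<and>
    (\<forall>\<eta> v. linear_trajectory \<eta> v \<and> \<eta> a \<in> N \<longrightarrow> p \<bullet> \<eta> b = 0)"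
  proof (cases yb)
    case None
    have "fst (X b) \<notin> interior (reachable fst N \<epsilon>)"
    proof
      assume "fst (X b) \<in> interior (reachable fst N \<epsilon>)"
      then obtain \<tau> where "\<tau> > 0" "fst (X b) - \<tau> *\<^sub>R 1 \<in> reachable fst N \<epsilon>" using lower by blast
      then obtain Y v where "trajectory Y v" "Y a - X a \<in> N" "fst (Y b) = fst (X b) - \<tau>" "\<tau> > 0"
        "\<And>t. t \<in> T \<Longrightarrow> norm (Y t - X t) \<le> \<epsilon>" "\<And>t. t \<in> T \<Longrightarrow> norm (v t - us t) \<le> \<epsilon>"
        unfolding reachable_def by auto
      then show False using no_descent[of Y v] None by (simp add: endpoint_condition_def)
    qed
    then obtain l where "l \<noteq> 0" "\<And>\<eta> v. linear_trajectory \<eta> v \<Longrightarrow> \<eta> a \<in> N \<Longrightarrow> l \<bullet> fst (\<eta> b) = 0"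
      using boundary_endpoint_multiplier[OF bounded_linear_fst N \<epsilon>(1)] by metis
    then show ?thesis by (intro exI[of _ "(l, 0)"]) (auto simp: inner_prod_def zero_prod_def)
  next
    case (Some y1)
    have "X b \<notin> interior (reachable (\<lambda>x. x) N \<epsilon>)"
    proof
      assume "X b \<in> interior (reachable (\<lambda>x. x) N \<epsilon>)"
      then obtain \<tau> where "\<tau> > 0" "X b - \<tau> *\<^sub>R (1, 0) \<in> reachable (\<lambda>x. x) N \<epsilon>" using lower by blast
      then obtain Y v where Y: "trajectory Y v" "Y a - X a \<in> N" "Y b = X b - \<tau> *\<^sub>R (1, 0)" "\<tau> > 0"
        "\<And>t. t \<in> T \<Longrightarrow> norm (Y t - X t) \<le> \<epsilon>" "\<And>t. t \<in> T \<Longrightarrow> norm (v t - us t) \<le> \<epsilon>"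
        unfolding reachable_def by auto
      have "endpoint_condition yb (snd (Y b))"
        using admissible snd_X[OF b_in] Y(3) by (simp add: admissible_def)
      then show False using no_descent[OF Y(1,2,5,6)] Y(3,4) by simp
    qed
    then obtain l where "l \<noteq> 0" "\<And>\<eta> v. linear_trajectory \<eta> v \<Longrightarrow> \<eta> a \<in> N \<Longrightarrow> l \<bullet> \<eta> b = 0"
      using boundary_endpoint_multiplier[OF bounded_linear_ident N \<epsilon>(1)] by metis
    then show ?thesis using Some by (intro exI[of _ l]) auto
  qed
  then obtain p where p: "p \<noteq> 0" "yb = None \<Longrightarrow> snd p = 0"
    "\<forall>\<eta> v. linear_trajectory \<eta> v \<and> \<eta> a \<in> N \<longrightarrow> p \<bullet> \<eta> b = 0" by blast
  \<comment> \<open>Orthogonality is insensitive to the sign, which is free to make the cost multiplier nonnegative.\<close>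
  define p1 where "p1 = (if fst p \<ge> 0 then p else - p)"
  have p1: "fst p1 \<ge> 0" "p1 \<noteq> 0" "yb = None \<Longrightarrow> snd p1 = 0"
    "\<forall>\<eta> v. linear_trajectory \<eta> v \<and> \<eta> a \<in> N \<longrightarrow> p1 \<bullet> \<eta> b = 0"
    using p by (auto simp: p1_def)
  obtain \<Psi> where \<Psi>: "\<Psi> b = p1" "\<And>n. n \<in> N \<Longrightarrow> \<Psi> a \<bullet> n = 0"
    "\<And>t. t \<in> tk T \<Longrightarrow>
      has_delta_derivative T \<Psi> (- fst (blinfun_adjoint (A t) (\<Psi> (fwd_jump T t)))) t"
    "\<And>t. t \<in> tk T \<Longrightarrow> snd (blinfun_adjoint (A t) (\<Psi> (fwd_jump T t))) = 0"
    using multiplier_adjoint[OF p1(4) subspace_0[OF N]] by metis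
  define \<Gamma> where "\<Gamma> t = blinfun_adjoint (A t) (\<Psi> (fwd_jump T t))" for t
  have \<Gamma>_inner: "h \<bullet> \<Gamma> t = \<Psi> (fwd_jump T t) \<bullet> A t h" for h t
    unfolding \<Gamma>_def by (simp add: inner_blinfun_adjoint inner_commute)

  \<comment> \<open>The dynamics ignore the cost coordinate, so its adjoint is constant: this is \<open>\<psi>\<^sub>0\<close>.\<close>
  have fst_\<Psi>: "fst (\<Psi> t) = fst p1" if "t \<in> T" for t
  proof -
    have "fst (\<Psi> t) = fst (\<Psi> a)" if "t \<in> T" for t
    proof (rule delta_derivative_zero_constant[OF _ that])
      fix t assume t: "t \<in> tk T"
      have "fst (fst (\<Gamma> t)) = ((1, 0), 0) \<bullet> \<Gamma> t" by (simp add: inner_prod_def)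
      also have "\<dots> = 0"
        unfolding \<Gamma>_inner A_def
        by (simp add: D_def augmented_deriv_apply zero_prod_def[symmetric] blinfun.zero_right)
      finally show "has_delta_derivative T (\<lambda>t. fst (\<Psi> t)) 0 t"
        using has_delta_derivative_bounded_linear[OF bounded_linear_fst \<Psi>(3)[OF t]] by (simp add: \<Gamma>_def)
    qed
    then show ?thesis using that b_in \<Psi>(1) by metis
  qed
  define \<psi> where "\<psi> t = snd (\<Psi> t)" for t
  have \<Psi>_eq: "\<Psi> (fwd_jump T t) = (fst p1, \<psi> (fwd_jump T t))" if "t \<in> T" for t
    using fst_\<Psi>[OF fwd_jump_props(2)[OF that]] by (simp add: \<psi>_def prod_eq_iff)
  \<comment> \<open>The Hamiltonian is the pairing of the augmented adjoint with the augmented dynamics; the cost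
    coordinate can be set to \<open>0\<close>.\<close>
  have H: "hamiltonian L \<phi> t y w (fst p1) (\<psi> (fwd_jump T t)) = \<Psi> (fwd_jump T t) \<bullet> \<Phi> t ((0, y), w)"
    if "t \<in> T" for t y w
    unfolding \<Psi>_eq[OF that] by (simp add: hamiltonian_def \<Phi>_eq inner_prod_def)
  have \<Phi>_deriv: "((\<lambda>x. \<Psi> (fwd_jump T t) \<bullet> \<Phi> t x) has_derivative (\<lambda>h. h \<bullet> \<Gamma> t)) (at ((0, ys t), us t))"
    if t: "t \<in> T" for t
  proof -
    have "D t ((0, ys t), us t) = A t"
      unfolding A_def by (rule blinfun_eqI) (simp add: D_def augmented_deriv_apply snd_X[OF t])
    then show ?thesis
      using has_derivative_inner_right[OF \<Phi>_has_derivative[OF t, of "((0, ys t), us t)"]] unfolding \<Gamma>_inner by metis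
  qed
  have H_y: "H_y L \<phi> t (ys t) (us t) (fst p1) (\<psi> (fwd_jump T t)) = snd (fst (\<Gamma> t))" if t: "t \<in> T" for t
    unfolding H_y_def H[OF t]
  proof (rule grad_eq)
    have "((\<lambda>y. ((0 :: real, y), us t)) has_derivative (\<lambda>h. ((0, h), 0))) (at (ys t))"
      by (auto intro!: derivative_eq_intros)
    from has_derivative_compose[OF this \<Phi>_deriv[OF t]]
    show "((\<lambda>y. \<Psi> (fwd_jump T t) \<bullet> \<Phi> t ((0, y), us t)) has_derivative (\<lambda>h. h \<bullet> snd (fst (\<Gamma> t)))) (at (ys t))"
      by (simp add: inner_prod_def)
  qed
  have H_u: "H_u L \<phi> t (ys t) (us t) (fst p1) (\<psi> (fwd_jump T t)) = snd (\<Gamma> t)" if t: "t \<in> T" for t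
    unfolding H_u_def H[OF t]
  proof (rule grad_eq)
    have "((\<lambda>w. ((0 :: real, ys t), w)) has_derivative (\<lambda>h. (0, h))) (at (us t))"
      by (auto intro!: derivative_eq_intros simp: zero_prod_def)
    from has_derivative_compose[OF this \<Phi>_deriv[OF t]]
    show "((\<lambda>w. \<Psi> (fwd_jump T t) \<bullet> \<Phi> t ((0, ys t), w)) has_derivative (\<lambda>h. h \<bullet> snd (\<Gamma> t))) (at (us t))"
      by (simp add: inner_prod_def)
  qed
  have H_psi: "H_psi L \<phi> t (ys t) (us t) (fst p1) q = \<phi> t (ys t) (us t)" for t q
    unfolding H_psi_def hamiltonian_def by (rule grad_eq) (auto intro!: derivative_eq_intros)
  have \<psi>_delta: "has_delta_derivative T \<psi> (- snd (fst (\<Gamma> t))) t" if t: "t \<in> tk T" for t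
    using has_delta_derivative_bounded_linear[OF bounded_linear_snd \<Psi>(3)[OF t]]
    by (simp add: \<psi>_def[abs_def] \<Gamma>_def)
  show ?thesis
  proof (intro exI[of _ "fst p1"] exI[of _ \<psi>] conjI ballI impI)
    show "fst p1 \<ge> 0" by (rule p1(1))
    show "fst p1 \<noteq> 0 \<or> (\<exists>t\<in>T. \<psi> t \<noteq> 0)"
      using p1(2) b_in \<Psi>(1) unfolding \<psi>_def by (auto simp: prod_eq_iff intro!: bexI[of _ b])
    fix t assume t: "t \<in> tk T"
    note tT = tk_sub_T[OF t]
    show "delta_differentiable T \<psi> t" using \<psi>_delta[OF t] unfolding delta_differentiable_def by blast
    show "delta_deriv T ys t = H_psi L \<phi> t (ys t) (us t) (fst p1) (\<psi> (fwd_jump T t))"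
      unfolding H_psi by (rule delta_deriv_eq[OF t ys_delta[OF t]])
    show "delta_deriv T \<psi> t = - H_y L \<phi> t (ys t) (us t) (fst p1) (\<psi> (fwd_jump T t))"
      unfolding H_y[OF tT] by (rule delta_deriv_eq[OF t \<psi>_delta[OF t]])
    show "H_u L \<phi> t (ys t) (us t) (fst p1) (\<psi> (fwd_jump T t)) = 0"
      unfolding H_u[OF tT] \<Gamma>_def by (rule \<Psi>(4)[OF t])
  next
    assume "ya = None"
    then have "(0, \<psi> a) \<in> N" by (simp add: N_def)
    from \<Psi>(2)[OF this] show "\<psi> a = 0" by (simp add: \<psi>_def inner_prod_def)
  next
    assume "yb = None"
    then show "\<psi> b = 0" using p1(3) \<Psi>(1) by (simp add: \<psi>_def)
  qed
qed

end
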